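(* For every integer $n\ge1$ and every $c>1$ there is a constant $C_2=C_2(c,n)$ with the following property. Let $g$ be a $c$-bounded Riemannian metric on the sphere $\mathbb{S}^n$, let $a,d>0$, $b>1$ and $\epsilon>0$. Then (1) the metric $\mathcal{T}_{a,d}\,g$ is hyperbolic on $B_a$; (2) the metric $\mathcal{T}_{a,d}\,g$ is radially $\epsilon$-close to hyperbolic outside $B_b$ (that is, on $\mathbb{R}^{n+1}\setminus B_b$), provided $$C_2\left(e^{-b}+\frac1d\right)\le\epsilon .$$
   Context: $B_r\subset\mathbb{R}^{n+1}$ is the ball of radius $r$ centered at the origin; $\mathbb{R}^{n+1}\setminus\{0\}$ is identified with $\mathbb{S}^n\times(0,\infty)$ by polar coordinates; $\sigma_{\mathbb{S}^n}$ is the canonical round metric. Two variable warping deformation: fix a smooth function $\rho:\mathbb{R}\to[0,1]$ with $\rho(t)=0$ for $t\le0$, $\rho(t)=1$ for $t\ge1$, $|\rho'|<3$ and $|\rho''|<12$. For $a,d>0$ put $\rho_{a,d}(t)=\rho\big(2\frac{t-a}{d}\big)$, $(g_{a,d})_t=\sigma_{\mathbb{S}^n}+\rho_{a,d}(t)(g-\sigma_{\mathbb{S}^n})$ and $$\mathcal{T}_{a,d}\,g=\sinh^2(t)\,(g_{a,d})_t+dt^2,$$ a Riemannian metric on $\mathbb{R}^{n+1}$. $c$-bounded ($c>1$): for each $n$ fix a finite atlas of $\mathbb{S}^n$ whose charts $\psi:U\to\mathbb{S}^n$, $U\subset\mathbb{R}^n$, extend to the compact closure of their domains and such that for every $p\in\mathbb{S}^n$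 some chart satisfies $d_{\mathbb{R}^n}(\psi^{-1}(p),\mathbb{R}^n\setminus U)\ge1$. A metric $g$ on $\mathbb{S}^n$ is $c$-bounded if in every chart of this atlas its matrix satisfies $|g|_{C^2}<c$ and $|\det g|>1/c$ at every point. Here $|\cdot|_{C^2}$ is the uniform $C^2$ norm: the maximum of the sup norms of all partial derivatives of order $\le 2$ of the entries. Radially $\epsilon$-close to hyperbolic: let $\mathbb{B}\subset\mathbb{R}^n$ be the unit ball and $\mathbb{T}=\mathbb{B}\times(-1,1)$ with metric $\sigma=e^{2t}\sigma_{\mathbb{R}^n}+dt^2$, $\sigma_{\mathbb{R}^n}$ flat. A metric $h$ on $\mathbb{S}^n\times(0,\infty)$ of the form $\tilde g_t+dt^2$ is radially $\epsilon$-close to hyperbolic on a subset $S$ if for every $p\in S$ there is a chart (diffeomorphism onto an open subset) $\phi:\mathbb{T}\to\mathbb{S}^n\times(0,\infty)$ with $\phi(0,0)=p$, of the form $\phi(x,t)=(\phi_1(x),t+t_0)$ for some number $t_0$ and chart $\phi_1$ of $\mathbb{S}^n$, such that $|\phi^*h-\sigma|_{C^2}<\epsilon$. *)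

theory Defs
  imports "HOL-Analysis.Analysis"
begin

text \<open>
  \<open>(real^'n) \<times> real\<close> plays the role of \<open>n+1\<close>-dimensional Euclidean space, where
  \<open>n = CARD('n) \<ge> 1\<close>; so \<open>sphere 0 1\<close> in this type is the \<open>n\<close>-sphere.
\<close>

definition dir_deriv ::
    "'a::real_normed_vector \<Rightarrow> ('a \<Rightarrow> 'b::real_normed_vector) \<Rightarrow> 'a \<Rightarrow> 'b" where
  "dir_deriv v f x = frechet_derivative f (at x) v"

text \<open>\<open>k\<close> times continuously differentiable; intended for open \<open>W\<close>.\<close>

primrec Ck_on ::
    "nat \<Rightarrow> 'a::euclidean_space set \<Rightarrow> ('a \<Rightarrow> 'b::euclidean_space) \<Rightarrow> bool" where
  "Ck_on 0 W f \<longleftrightarrow> continuous_on W f"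
| "Ck_on (Suc k) W f \<longleftrightarrow>
     (\<forall>x\<in>W. f differentiable (at x)) \<and> (\<forall>v. Ck_on k W (dir_deriv v f))"

text \<open>
  Smoothness on an arbitrary subset of a Euclidean space: locally the restriction of a
  smooth map defined on an open set. For open sets this is ordinary smoothness, and for
  the submanifolds used below it is smoothness in the sense of manifolds.
\<close>

definition smooth_on ::
    "'a::euclidean_space set \<Rightarrow> ('a \<Rightarrow> 'b::euclidean_space) \<Rightarrow> bool" where
  "smooth_on S f \<longleftrightarrow>
     (\<forall>p\<in>S. \<exists>W F. open W \<and> p \<in> W \<and> (\<forall>k. Ck_on k W F) \<and> (\<forall>x\<in>W \<inter> S. F x = f x))"

definition diffeomorphism_on ::
    "'a::euclidean_space set \<Rightarrow> 'b::euclidean_space set \<Rightarrow> ('a \<Rightarrow> 'b) \<Rightarrow> bool" where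
  "diffeomorphism_on S T f \<longleftrightarrow>
     bij_betw f S T \<and> smooth_on S f \<and> smooth_on T (inv_into S f)"

text \<open>Charts of a submanifold \<open>M\<close> are parametrizations, defined on open Euclidean sets.\<close>

definition chart_of ::
    "'b::euclidean_space set \<Rightarrow> 'a::euclidean_space set \<Rightarrow> ('a \<Rightarrow> 'b) \<Rightarrow> bool" where
  "chart_of M U \<psi> \<longleftrightarrow>
     open U \<and> openin (top_of_set M) (\<psi> ` U) \<and> diffeomorphism_on U (\<psi> ` U) \<psi>"

text \<open>
  A tensor field assigns to a point \<open>p\<close> a form on ambient vectors; only its values on vectors
  tangent at \<open>p\<close> are meaningful.
\<close>

type_synonym 'a tensor = "'a \<Rightarrow> 'a \<Rightarrow> 'a \<Rightarrow> real"

definition inner_product_on :: "'a::real_vector set \<Rightarrow> ('a \<Rightarrow> 'a \<Rightarrow> real) \<Rightarrow> bool" where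
  "inner_product_on V B \<longleftrightarrow>
     (\<forall>u\<in>V. \<forall>v\<in>V. B u v = B v u) \<and>
     (\<forall>u\<in>V. \<forall>v\<in>V. \<forall>w\<in>V. B (u + v) w = B u w + B v w) \<and>
     (\<forall>u\<in>V. \<forall>w\<in>V. \<forall>r. B (r *\<^sub>R u) w = r * B u w) \<and>
     (\<forall>u\<in>V. u \<noteq> 0 \<longrightarrow> B u u > 0)"

definition pullback ::
    "('a::real_normed_vector \<Rightarrow> 'b::real_normed_vector) \<Rightarrow> 'b tensor \<Rightarrow> 'a tensor" where
  "pullback f h x u v = h (f x) (dir_deriv u f x) (dir_deriv v f x)"

definition sphere_tangent :: "'a::real_inner \<Rightarrow> 'a set" where
  "sphere_tangent p = {v. p \<bullet> v = 0}"

definition sphere_metric :: "((real^'n) \<times> real) tensor \<Rightarrow> bool" where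
  "sphere_metric g \<longleftrightarrow>
     (\<forall>p\<in>sphere 0 1. inner_product_on (sphere_tangent p) (g p)) \<and>
     (\<forall>(U :: (real^'n) set) \<psi>. chart_of (sphere 0 1) U \<psi> \<longrightarrow>
        (\<forall>i\<in>Basis. \<forall>j\<in>Basis. smooth_on U (\<lambda>x. pullback \<psi> g x i j)))"

definition round_metric :: "((real^'n) \<times> real) tensor" where
  "round_metric p u v = u \<bullet> v"

definition metric_on :: "'a::euclidean_space set \<Rightarrow> 'a tensor \<Rightarrow> bool" where
  "metric_on W G \<longleftrightarrow>
     (\<forall>x\<in>W. inner_product_on UNIV (G x)) \<and> (\<forall>u v. smooth_on W (\<lambda>x. G x u v))"

text \<open>
  \<open>christoffel G x u v\<close> is the covariant derivative of the constant field \<open>v\<close> in direction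
  \<open>u\<close> at \<open>x\<close>, given by the Koszul formula; \<open>curvature G x u v w\<close> is \<open>R(u,v)w\<close> in the convention
  \<open>R(u,v) = [\<nabla>_u, \<nabla>_v] - \<nabla>_[u,v]\<close>.
\<close>

definition christoffel :: "'a::euclidean_space tensor \<Rightarrow> 'a \<Rightarrow> 'a \<Rightarrow> 'a \<Rightarrow> 'a" where
  "christoffel G x u v = (THE z. \<forall>w. 2 * G x z w =
     dir_deriv u (\<lambda>y. G y v w) x + dir_deriv v (\<lambda>y. G y u w) x - dir_deriv w (\<lambda>y. G y u v) x)"

definition curvature :: "'a::euclidean_space tensor \<Rightarrow> 'a \<Rightarrow> 'a \<Rightarrow> 'a \<Rightarrow> 'a \<Rightarrow> 'a" where
  "curvature G x u v w =
     dir_deriv u (\<lambda>y. christoffel G y v w) x - dir_deriv v (\<lambda>y. christoffel G y u w) x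
     + christoffel G x u (christoffel G x v w) - christoffel G x v (christoffel G x u w)"

definition sectional_curvature :: "'a::euclidean_space tensor \<Rightarrow> 'a \<Rightarrow> 'a \<Rightarrow> 'a \<Rightarrow> real" where
  "sectional_curvature G x u v =
     G x (curvature G x u v v) u / (G x u u * G x v v - (G x u v)\<^sup>2)"

definition hyperbolic_on :: "'a::euclidean_space set \<Rightarrow> 'a tensor \<Rightarrow> bool" where
  "hyperbolic_on W G \<longleftrightarrow> metric_on W G \<and>
     (\<forall>x\<in>W. \<forall>u v. u \<noteq> v \<and> independent {u, v} \<longrightarrow> sectional_curvature G x u v = -1)"

definition C2_norm_fun :: "'a::euclidean_space set \<Rightarrow> ('a \<Rightarrow> real) \<Rightarrow> ennreal" where
  "C2_norm_fun U f = Max {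
     (SUP x\<in>U. ennreal \<bar>f x\<bar>),
     (SUP k\<in>Basis. SUP x\<in>U. ennreal \<bar>dir_deriv k f x\<bar>),
     (SUP k\<in>Basis. SUP l\<in>Basis. SUP x\<in>U. ennreal \<bar>dir_deriv l (dir_deriv k f) x\<bar>)}"

definition C2_norm :: "'a::euclidean_space set \<Rightarrow> 'a tensor \<Rightarrow> ennreal" where
  "C2_norm U h = (SUP i\<in>Basis. SUP j\<in>Basis. C2_norm_fun U (\<lambda>x. h x i j))"

text \<open>
  A chart extends to the compact closure of its domain if it is the restriction of a chart
  defined on an open neighbourhood of that closure.
\<close>

definition good_atlas :: "((real^'n) set \<times> (real^'n \<Rightarrow> (real^'n) \<times> real)) set \<Rightarrow> bool" where
  "good_atlas \<A> \<longleftrightarrow>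
     finite \<A> \<and>
     (\<forall>(U, \<psi>)\<in>\<A>. chart_of (sphere 0 1) U \<psi> \<and> compact (closure U) \<and>
        (\<exists>V \<psi>'. closure U \<subseteq> V \<and> chart_of (sphere 0 1) V \<psi>' \<and> (\<forall>x\<in>U. \<psi>' x = \<psi> x))) \<and>
     (\<Union>(U, \<psi>)\<in>\<A>. \<psi> ` U) = sphere 0 1 \<and>
     (\<forall>p\<in>sphere 0 1. \<exists>(U, \<psi>)\<in>\<A>. p \<in> \<psi> ` U \<and> infdist (inv_into U \<psi> p) (- U) \<ge> 1)"

definition c_bounded ::
    "((real^'n) set \<times> (real^'n \<Rightarrow> (real^'n) \<times> real)) set \<Rightarrow> real \<Rightarrow>
     ((real^'n) \<times> real) tensor \<Rightarrow> bool" where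
  "c_bounded \<A> c g \<longleftrightarrow>
     (\<forall>(U, \<psi>)\<in>\<A>. C2_norm U (pullback \<psi> g) < ennreal c \<and>
        (\<forall>x\<in>U. \<bar>det (\<chi> i j. pullback \<psi> g x (axis i 1) (axis j 1))\<bar> > 1 / c))"

text \<open>
  The metric \<open>g\<^sub>t + dt\<^sup>2\<close> on the product of the sphere and \<open>{0<..}\<close>, a submanifold of
  \<open>((real^'n) \<times> real) \<times> real\<close>; \<open>gt t\<close> is a metric on the sphere.
\<close>

definition radial_metric ::
    "(real \<Rightarrow> ((real^'n) \<times> real) tensor) \<Rightarrow> (((real^'n) \<times> real) \<times> real) tensor" where
  "radial_metric gt = (\<lambda>(\<theta>, t) (u, \<alpha>) (v, \<beta>). gt t \<theta> u v + \<alpha> * \<beta>)"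

text \<open>
  A metric on the product of the sphere and \<open>{0<..}\<close>, read on the complement of the origin in
  polar coordinates \<open>x = t *\<^sub>R \<theta>\<close>. The differential of \<open>x \<mapsto> (\<theta>, t)\<close> maps \<open>u\<close> to
  \<open>((u - (u \<bullet> \<theta>) *\<^sub>R \<theta>) /\<^sub>R t, u \<bullet> \<theta>)\<close>. The value at the origin is the continuous extension
  for the metrics considered here, which near the origin are \<open>(sinh t)\<^sup>2\<close> times the round
  metric plus \<open>dt\<^sup>2\<close>.
\<close>

definition polar_metric ::
    "(((real^'n) \<times> real) \<times> real) tensor \<Rightarrow> ((real^'n) \<times> real) tensor" where
  "polar_metric h x u v =
     (if x = 0 then u \<bullet> v
      else let t = norm x; \<theta> = x /\<^sub>R t; D = (\<lambda>w. ((w - (w \<bullet> \<theta>) *\<^sub>R \<theta>) /\<^sub>R t, w \<bullet> \<theta>))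
           in h (\<theta>, t) (D u) (D v))"

definition cylinder :: "((real^'n) \<times> real) set" where
  "cylinder = ball 0 1 \<times> {-1<..<1}"

definition model_metric :: "((real^'n) \<times> real) tensor" where
  "model_metric = (\<lambda>(x, t) (u, \<alpha>) (v, \<beta>). exp (2 * t) * (u \<bullet> v) + \<alpha> * \<beta>)"

definition radially_close_to_hyperbolic ::
    "real \<Rightarrow> (real \<Rightarrow> ((real^'n) \<times> real) tensor) \<Rightarrow> (((real^'n) \<times> real) \<times> real) set \<Rightarrow> bool" where
  "radially_close_to_hyperbolic \<epsilon> gt S \<longleftrightarrow>
     (\<forall>p\<in>S. \<exists>(\<phi> :: (real^'n) \<times> real \<Rightarrow> ((real^'n) \<times> real) \<times> real) \<phi>\<^sub>1 t\<^sub>0.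
        chart_of (sphere 0 1 \<times> {0<..}) cylinder \<phi> \<and>
        \<phi> (0, 0) = p \<and>
        chart_of (sphere 0 1) (ball 0 1) \<phi>\<^sub>1 \<and>
        (\<forall>(x, t)\<in>cylinder. \<phi> (x, t) = (\<phi>\<^sub>1 x, t + t\<^sub>0)) \<and>
        C2_norm cylinder
          (\<lambda>z u v. pullback \<phi> (radial_metric gt) z u v - model_metric z u v) < ennreal \<epsilon>)"

definition cutoff :: "(real \<Rightarrow> real) \<Rightarrow> bool" where
  "cutoff \<rho> \<longleftrightarrow>
     smooth_on UNIV \<rho> \<and> (\<forall>t. 0 \<le> \<rho> t \<and> \<rho> t \<le> 1) \<and>
     (\<forall>t\<le>0. \<rho> t = 0) \<and> (\<forall>t\<ge>1. \<rho> t = 1) \<and>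
     (\<forall>t. \<bar>deriv \<rho> t\<bar> < 3) \<and> (\<forall>t. \<bar>deriv (deriv \<rho>) t\<bar> < 12)"

definition rho_ad :: "(real \<Rightarrow> real) \<Rightarrow> real \<Rightarrow> real \<Rightarrow> real \<Rightarrow> real" where
  "rho_ad \<rho> a d t = \<rho> (2 * ((t - a) / d))"

definition g_ad ::
    "(real \<Rightarrow> real) \<Rightarrow> real \<Rightarrow> real \<Rightarrow> ((real^'n) \<times> real) tensor \<Rightarrow> real \<Rightarrow>
     ((real^'n) \<times> real) tensor" where
  "g_ad \<rho> a d g t p u v =
     round_metric p u v + rho_ad \<rho> a d t * (g p u v - round_metric p u v)"

definition warp_family ::
    "(real \<Rightarrow> real) \<Rightarrow> real \<Rightarrow> real \<Rightarrow> ((real^'n) \<times> real) tensor \<Rightarrow> real \<Rightarrow>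
     ((real^'n) \<times> real) tensor" where
  "warp_family \<rho> a d g t p u v = (sinh t)\<^sup>2 * g_ad \<rho> a d g t p u v"

definition two_variable_warp ::
    "(real \<Rightarrow> real) \<Rightarrow> real \<Rightarrow> real \<Rightarrow> ((real^'n) \<times> real) tensor \<Rightarrow>
     ((real^'n) \<times> real) tensor" where
  "two_variable_warp \<rho> a d g = polar_metric (radial_metric (warp_family \<rho> a d g))"

definition outside_ball :: "real \<Rightarrow> (((real^'n) \<times> real) \<times> real) set" where
  "outside_ball b = {(\<theta>, t). \<theta> \<in> sphere 0 1 \<and> 0 < t \<and> t *\<^sub>R \<theta> \<notin> ball 0 b}"

end

theory Submission
  imports Defs
begin

text \<open>
  On \<open>B\<^sub>a\<close> the warped metric is \<open>A(\<bar>x\<bar>\<^sup>2) u \<bullet> v + B(\<bar>x\<bar>\<^sup>2) (x \<bullet> u) (x \<bullet> v)\<close> with \<open>A(t\<^sup>2) = (sinh t / t)\<^sup>2\<close>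
  and \<open>A(s) + s B(s) = 1\<close>. Its Christoffel symbols have the same rotationally invariant shape, and constant
  curvature \<open>-1\<close> reduces to three scalar differential equations for functions of \<open>s\<close>, which follow
  from the equations satisfied by \<open>sinh (sqrt s) / sqrt s\<close>.

  Near a point \<open>(\<theta>, s)\<close> with \<open>s \<ge> b\<close>, take an atlas chart \<open>\<psi>\<close> with \<open>\<psi> p = \<theta>\<close> and use
  \<open>x \<mapsto> \<psi> (p + 2 e\<^sup>-\<^sup>s L x)\<close>, where \<open>L\<close> takes the standard basis to a basis orthonormal for the
  metric at \<open>p\<close>. Then \<open>4 e\<^sup>-\<^sup>2\<^sup>s (sinh (t + s))\<^sup>2\<close> differs from \<open>e\<^sup>2\<^sup>t\<close> by \<open>O(e\<^sup>-\<^sup>s)\<close>, derivatives in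
  \<open>x\<close> gain a factor \<open>e\<^sup>-\<^sup>s\<close>, and derivatives of the cutoff in \<open>t\<close> gain a factor \<open>1/d\<close>. The norm of \<open>L\<close>
  is uniformly bounded because \<open>c\<close>-boundedness bounds the metric below by compactness. For small
  \<open>d\<close> the second derivative of the cutoff is only \<open>O(1/d\<^sup>2)\<close>; but then \<open>\<epsilon>\<close> is large, and a chart of
  tiny image suffices.
\<close>

subsection \<open>Directional derivatives and smoothness\<close>

text \<open>Connection and curvature are given by ambient formulas, so part (1) needs a description
  of the metric that is smooth at the origin, where polar coordinates degenerate. This is why all
  coefficients are functions of \<open>x \<bullet> x\<close> and quotients such as
  \<open>(1 - A) / s\<close> are replaced by power series. The relation \<open>A + s * B = 1\<close>
  expresses that the radial direction has unit length; it keeps the Christoffel coefficients free of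
  every division except that by \<open>A\<close>. In part (2) the factor 2 exp(-s) is forced by
  sinh(t + s) being asymptotic to exp(t + s) / 2. The frame \<open>L\<close> is orthonormal for the
  interpolated metric at level \<open>s\<close>, not for \<open>g\<close> itself, so that at the
  centre of the chart only the sinh factor contributes an error. Smallness elsewhere comes from
  small derivatives and the mean value inequality. The metrics and the atlas enter the final
  constant only through one number \<open>K\<close>, which bounds them from above and from below in
  every chart.\<close>

lemma dir_deriv_cong_open:
  assumes "open W" "x \<in> W" "\<And>y. y \<in> W \<Longrightarrow> f y = g y"
  shows "dir_deriv v f x = dir_deriv v g x"
proof -
  have "(f has_derivative D) (at x) \<longleftrightarrow> (g has_derivative D) (at x)" for D
    using has_derivative_transform_within_open[of f D x UNIV W g]
      has_derivative_transform_within_open[of g D x UNIV W f] assms by auto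
  then show ?thesis
    by (simp add: dir_deriv_def frechet_derivative_def)
qed

lemma differentiable_cong_open:
  assumes "open W" "x \<in> W" "\<And>y. y \<in> W \<Longrightarrow> f y = g y" "f differentiable (at x)"
  shows "g differentiable (at x)"
  using assms has_derivative_transform_within_open unfolding differentiable_def by blast

lemma dir_deriv_eq:
  "(f has_derivative D) (at x) \<Longrightarrow> dir_deriv v f x = D v"
  by (metis dir_deriv_def frechet_derivative_at)

lemma has_derivative_dir_deriv:
  "f differentiable (at x) \<Longrightarrow> (f has_derivative (\<lambda>v. dir_deriv v f x)) (at x)"
  unfolding dir_deriv_def by (simp add: frechet_derivative_works[symmetric] eta_contract_eq)

lemma linear_dir_deriv:
  "f differentiable (at x) \<Longrightarrow> linear (\<lambda>v. dir_deriv v f x)"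
  using has_derivative_dir_deriv has_derivative_linear by blast

lemma dir_deriv_const [simp]: "dir_deriv v (\<lambda>x. c) = (\<lambda>x. 0)"
  by (rule ext, rule dir_deriv_eq) (rule has_derivative_const)

lemma dir_deriv_bounded_linear:
  "bounded_linear f \<Longrightarrow> dir_deriv v f = (\<lambda>x. f v)"
  by (rule ext, rule dir_deriv_eq) (rule bounded_linear_imp_has_derivative)

lemma dir_deriv_add:
  "f differentiable (at x) \<Longrightarrow> g differentiable (at x) \<Longrightarrow>
    dir_deriv v (\<lambda>x. f x + g x) x = dir_deriv v f x + dir_deriv v g x"
  by (intro dir_deriv_eq has_derivative_add has_derivative_dir_deriv)

lemma (in bounded_bilinear) dir_deriv_prod:
  "f differentiable (at x) \<Longrightarrow> g differentiable (at x) \<Longrightarrow>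
    dir_deriv v (\<lambda>x. prod (f x) (g x)) x = prod (f x) (dir_deriv v g x) + prod (dir_deriv v f x) (g x)"
  by (rule dir_deriv_eq[OF FDERIV]) (auto intro: has_derivative_dir_deriv)

lemma dir_deriv_bounded_linear_comp:
  "bounded_linear h \<Longrightarrow> f differentiable (at x) \<Longrightarrow>
    dir_deriv v (\<lambda>x. h (f x)) x = h (dir_deriv v f x)"
  by (rule dir_deriv_eq[OF bounded_linear.has_derivative[OF _ has_derivative_dir_deriv]])

lemma has_derivative_affine_comp:
  assumes "bounded_linear L" "f differentiable (at (c + L x))"
  shows "((\<lambda>x. f (c + L x)) has_derivative (\<lambda>v. dir_deriv (L v) f (c + L x))) (at x)"
proof -
  have "((\<lambda>x. c + L x) has_derivative L) (at x)"
    using has_derivative_add[OF has_derivative_const bounded_linear_imp_has_derivative[OF assms(1)]]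
    by simp
  from has_derivative_compose[OF this has_derivative_dir_deriv[OF assms(2)]]
  show ?thesis by simp
qed

lemmas dir_deriv_affine_comp = dir_deriv_eq[OF has_derivative_affine_comp]

section \<open>Calculus of \<open>k\<close> times continuously differentiable maps\<close>

lemma Ck_on_subset: "Ck_on k W f \<Longrightarrow> V \<subseteq> W \<Longrightarrow> Ck_on k V f"
  by (induction k arbitrary: f) (auto intro: continuous_on_subset)

lemma Ck_on_cong:
  assumes "open W"
  shows "(\<And>x. x \<in> W \<Longrightarrow> f x = g x) \<Longrightarrow> Ck_on k W f \<Longrightarrow> Ck_on k W g"
proof (induction k arbitrary: f g)
  case 0
  then show ?case by (simp cong: continuous_on_cong)
next
  case (Suc k)
  have "Ck_on k W (dir_deriv v g)" for v
    by (rule Suc.IH[of "dir_deriv v f"])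
      (use Suc.prems dir_deriv_cong_open[OF assms, of _ f g v] in simp_all)
  then show ?case
    using Suc.prems differentiable_cong_open[OF assms, of _ f g] by auto
qed

lemma Ck_on_SucD: "Ck_on (Suc k) W f \<Longrightarrow> Ck_on k W f"
proof (induction k arbitrary: f)
  case 0
  then show ?case
    by (auto intro!: continuous_at_imp_continuous_on differentiable_imp_continuous_within)
qed simp

lemma Ck_on_continuous: "Ck_on k W f \<Longrightarrow> continuous_on W f"
proof (induction k)
  case (Suc k)
  then show ?case using Ck_on_SucD by blast
qed simp

text \<open>\<open>dir_deriv\<close> is taken in the full space, so it does not depend on the
  neighbourhood \<open>W\<close> chosen at each point; only continuity and differentiability at
  single points remain to be checked.\<close>

lemma Ck_on_local:
  "(\<And>p. p \<in> S \<Longrightarrow> \<exists>W. open W \<and> p \<in> W \<and> Ck_on k W f) \<Longrightarrow> Ck_on k S f"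
proof (induction k arbitrary: f)
  case 0
  then show ?case
    by (force intro!: continuous_at_imp_continuous_on simp: continuous_on_eq_continuous_at)
next
  case (Suc k)
  have "f differentiable (at p)" if "p \<in> S" for p
    using Suc.prems[OF that] by auto
  moreover have "Ck_on k S (dir_deriv v f)" for v
    by (rule Suc.IH) (use Suc.prems in fastforce)
  ultimately show ?case by simp
qed

lemma smooth_onE:
  assumes "smooth_on S f" "p \<in> S"
  obtains W F where "open W" "p \<in> W" "\<forall>k. Ck_on k W F" "\<forall>x\<in>W \<inter> S. F x = f x"
  using assms(1)[unfolded smooth_on_def, THEN bspec, OF assms(2)]
  by (elim exE conjE) (rule that)

lemma smooth_on_open_iff:
  assumes "open S"
  shows "smooth_on S f \<longleftrightarrow> (\<forall>k. Ck_on k S f)"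
proof
  assume f: "smooth_on S f"
  show "\<forall>k. Ck_on k S f"
  proof (rule allI, rule Ck_on_local)
    fix k p assume "p \<in> S"
    obtain W F where WF: "open W" "p \<in> W" "\<forall>k. Ck_on k W F" "\<forall>x\<in>W \<inter> S. F x = f x"
    by (rule smooth_onE[OF f \<open>p \<in> S\<close>])
    have "Ck_on k (W \<inter> S) F" by (rule Ck_on_subset[OF WF(3)[rule_format]]) simp
    then have "Ck_on k (W \<inter> S) f"
      using Ck_on_cong[of "W \<inter> S" F f] WF assms by (auto simp: open_Int)
    then show "\<exists>W. open W \<and> p \<in> W \<and> Ck_on k W f"
      using WF \<open>p \<in> S\<close> assms by (intro exI[of _ "W \<inter> S"]) auto
  qed
qed (use assms in \<open>auto simp: smooth_on_def\<close>)

lemma Ck_on_const [simp]: "Ck_on k W (\<lambda>x. c)"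
  by (induction k arbitrary: c) auto

lemma Ck_on_bounded_linear: "bounded_linear f \<Longrightarrow> Ck_on k W f"
  by (cases k) (auto simp: dir_deriv_bounded_linear linear_continuous_on
      intro: bounded_linear_imp_differentiable)

lemma Ck_on_add:
  assumes "open W"
  shows "Ck_on k W f \<Longrightarrow> Ck_on k W g \<Longrightarrow> Ck_on k W (\<lambda>x. f x + g x)"
proof (induction k arbitrary: f g)
  case 0
  then show ?case by (simp add: continuous_on_add)
next
  case (Suc k)
  have "Ck_on k W (dir_deriv v (\<lambda>x. f x + g x))" for v
    by (rule Ck_on_cong[OF assms _ Suc.IH, of "dir_deriv v f" "dir_deriv v g"])
      (use Suc.prems in \<open>auto simp: dir_deriv_add\<close>)
  then show ?case using Suc.prems by (auto intro: differentiable_add)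
qed

lemma Ck_on_bilinear:
  fixes f :: "'a::euclidean_space \<Rightarrow> 'b::euclidean_space"
    and g :: "'a \<Rightarrow> 'c::euclidean_space"
    and pr :: "'b \<Rightarrow> 'c \<Rightarrow> 'd::euclidean_space"
  assumes "open W" "bounded_bilinear pr"
  shows "Ck_on k W f \<Longrightarrow> Ck_on k W g \<Longrightarrow> Ck_on k W (\<lambda>x. pr (f x) (g x))"
proof (induction k arbitrary: f g)
  case 0
  then show ?case by (simp add: bounded_bilinear.continuous_on[OF assms(2)])
next
  case (Suc k)
  have d: "f differentiable (at x)" "g differentiable (at x)" if "x \<in> W" for x
    using Suc.prems that by auto
  \<comment> \<open>The product rule leaves one factor undifferentiated, so the induction hypothesis
    is applied to \<open>f\<close> and \<open>g\<close> themselves as well as to their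
    derivatives.\<close>
  have fg: "Ck_on k W f" "Ck_on k W g"
    using Suc.prems by (auto intro: Ck_on_SucD simp del: Ck_on.simps)
  have "Ck_on k W (dir_deriv v (\<lambda>x. pr (f x) (g x)))" for v
    by (rule Ck_on_cong[OF assms(1) _ Ck_on_add[OF assms(1) Suc.IH Suc.IH],
          of f "dir_deriv v g" "dir_deriv v f" g])
      (use Suc.prems d fg in \<open>auto simp: bounded_bilinear.dir_deriv_prod[OF assms(2)]\<close>)
  moreover have "(\<lambda>x. pr (f x) (g x)) differentiable (at x)" if "x \<in> W" for x
    using bounded_bilinear.FDERIV[OF assms(2)] d[OF that] unfolding differentiable_def by blast
  ultimately show ?case by auto
qed

lemmas Ck_on_mult = Ck_on_bilinear[OF _ bounded_bilinear_mult]
  and Ck_on_inner = Ck_on_bilinear[OF _ bounded_bilinear_inner]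

lemma Ck_on_bounded_linear_comp:
  fixes f :: "'a::euclidean_space \<Rightarrow> 'b::euclidean_space" and h :: "'b \<Rightarrow> 'c::euclidean_space"
  assumes "open W" "bounded_linear h"
  shows "Ck_on k W f \<Longrightarrow> Ck_on k W (\<lambda>x. h (f x))"
proof (induction k arbitrary: f)
  case 0
  then show ?case by (simp add: bounded_linear.continuous_on[OF assms(2)])
next
  case (Suc k)
  have "Ck_on k W (dir_deriv v (\<lambda>x. h (f x)))" for v
    by (rule Ck_on_cong[OF assms(1) _ Suc.IH, of "dir_deriv v f"])
      (use Suc.prems in \<open>auto simp: dir_deriv_bounded_linear_comp[OF assms(2)]\<close>)
  moreover have "(\<lambda>x. h (f x)) differentiable (at x)" if "x \<in> W" for x
    using Suc.prems that bounded_linear.has_derivative[OF assms(2)]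
    unfolding differentiable_def Ck_on.simps by blast
  ultimately show ?case by auto
qed

lemma open_affine_vimage:
  assumes "open W" "bounded_linear L"
  shows "open {x. c + L x \<in> W}"
  using open_vimage[OF assms(1), of "\<lambda>x. c + L x"] assms(2)
  by (simp add: vimage_def continuous_on_add linear_continuous_on)

lemma Ck_on_affine_comp:
  fixes L :: "'c::euclidean_space \<Rightarrow> 'a::euclidean_space" and f :: "'a \<Rightarrow> 'b::euclidean_space"
  assumes "open W" "bounded_linear L"
  shows "Ck_on k W f \<Longrightarrow> Ck_on k {x. c + L x \<in> W} (\<lambda>x. f (c + L x))"
proof (induction k arbitrary: f)
  case 0
  then show ?case
    using continuous_on_compose2[of W f "{x. c + L x \<in> W}" "\<lambda>x. c + L x"] assms(2)
    by (auto simp: continuous_on_add linear_continuous_on)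
next
  case (Suc k)
  have "Ck_on k {x. c + L x \<in> W} (dir_deriv v (\<lambda>x. f (c + L x)))" for v
    by (rule Ck_on_cong[OF open_affine_vimage[OF assms] _ Suc.IH, of "dir_deriv (L v) f"])
      (use Suc.prems in \<open>auto simp: dir_deriv_affine_comp[OF assms(2)]\<close>)
  moreover have "(\<lambda>x. f (c + L x)) differentiable (at x)" if "c + L x \<in> W" for x
    using differentiableI[OF has_derivative_affine_comp[OF assms(2)]] Suc.prems that by auto
  ultimately show ?case by auto
qed

text \<open>A pair is the sum of the images of its components under two linear embeddings.\<close>

lemma Ck_on_Pair:
  assumes "open W" "Ck_on k W f" "Ck_on k W g"
  shows "Ck_on k W (\<lambda>x. (f x, g x))"
proof -
  have "bounded_linear (\<lambda>y::'b. (y, 0::'c))" "bounded_linear (\<lambda>y::'c. (0::'b, y))"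
    by (auto intro: bounded_linear_Pair bounded_linear_ident bounded_linear_zero)
  from Ck_on_add[OF assms(1) Ck_on_bounded_linear_comp[OF assms(1) this(1) assms(2)]
    Ck_on_bounded_linear_comp[OF assms(1) this(2) assms(3)]]
  show ?thesis by simp
qed

section \<open>Smooth maps on arbitrary subsets\<close>

lemma smooth_on_subset:
  assumes "smooth_on S f" "T \<subseteq> S"
  shows "smooth_on T f"
  unfolding smooth_on_def
proof
  fix p assume "p \<in> T"
  then have "p \<in> S" using assms(2) by blast
  obtain W F where "open W" "p \<in> W" "\<forall>k. Ck_on k W F" "\<forall>x\<in>W \<inter> S. F x = f x"
    by (rule smooth_onE[OF assms(1) \<open>p \<in> S\<close>])
  then show "\<exists>W F. open W \<and> p \<in> W \<and> (\<forall>k. Ck_on k W F) \<and> (\<forall>x\<in>W \<inter> T. F x = f x)"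
    using assms(2) by (intro exI[of _ W] exI[of _ F]) auto
qed

lemma smooth_on_cong:
  assumes "smooth_on S f" "\<And>x. x \<in> S \<Longrightarrow> f x = g x"
  shows "smooth_on S g"
  unfolding smooth_on_def
proof
  fix p assume "p \<in> S"
  obtain W F where "open W" "p \<in> W" "\<forall>k. Ck_on k W F" "\<forall>x\<in>W \<inter> S. F x = f x"
    by (rule smooth_onE[OF assms(1) \<open>p \<in> S\<close>])
  then show "\<exists>W F. open W \<and> p \<in> W \<and> (\<forall>k. Ck_on k W F) \<and> (\<forall>x\<in>W \<inter> S. F x = g x)"
    using assms(2) by (intro exI[of _ W] exI[of _ F]) simp
qed

lemma smooth_on_affine_post:
  fixes f :: "'a::euclidean_space \<Rightarrow> 'b::euclidean_space" and h :: "'b \<Rightarrow> 'c::euclidean_space"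
  assumes "bounded_linear h" "smooth_on S f"
  shows "smooth_on S (\<lambda>x. c + h (f x))"
  unfolding smooth_on_def
proof
  fix p assume p: "p \<in> S"
  obtain W F where WF: "open W" "p \<in> W" "\<forall>k. Ck_on k W F" "\<forall>x\<in>W \<inter> S. F x = f x"
    by (rule smooth_onE[OF assms(2) p])
  moreover have "Ck_on k W (\<lambda>x. c + h (F x))" for k
    using Ck_on_add[OF WF(1) Ck_on_const Ck_on_bounded_linear_comp[OF WF(1) assms(1)]] WF(3) by blast
  ultimately show "\<exists>W F. open W \<and> p \<in> W \<and> (\<forall>k. Ck_on k W F) \<and> (\<forall>x\<in>W \<inter> S. F x = c + h (f x))"
    by (intro exI[of _ W] exI[of _ "\<lambda>x. c + h (F x)"]) simp
qed

lemma smooth_on_affine_comp: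
  fixes L :: "'c::euclidean_space \<Rightarrow> 'a::euclidean_space" and f :: "'a \<Rightarrow> 'b::euclidean_space"
  assumes "bounded_linear L" "smooth_on S f" "\<And>x. x \<in> T \<Longrightarrow> c + L x \<in> S"
  shows "smooth_on T (\<lambda>x. f (c + L x))"
  unfolding smooth_on_def
proof
  fix p assume p: "p \<in> T"
  obtain W F where WF: "open W" "c + L p \<in> W" "\<forall>k. Ck_on k W F" "\<forall>x\<in>W \<inter> S. F x = f x"
    by (rule smooth_onE[OF assms(2) assms(3)[OF p]])
  then show "\<exists>W F. open W \<and> p \<in> W \<and> (\<forall>k. Ck_on k W F) \<and> (\<forall>x\<in>W \<inter> T. F x = f (c + L x))"
    using assms(3) open_affine_vimage[OF WF(1) assms(1)] Ck_on_affine_comp[OF WF(1) assms(1) WF(3)[rule_format]]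
    by (intro exI[of _ "{x. c + L x \<in> W}"] exI[of _ "\<lambda>x. F (c + L x)"]) auto
qed

lemma smooth_on_Pair:
  assumes "smooth_on S f" "smooth_on S g"
  shows "smooth_on S (\<lambda>x. (f x, g x))"
  unfolding smooth_on_def
proof
  fix p assume p: "p \<in> S"
  obtain W F where WF: "open W" "p \<in> W" "\<forall>k. Ck_on k W F" "\<forall>x\<in>W \<inter> S. F x = f x"
    by (rule smooth_onE[OF assms(1) p])
  obtain V G where VG: "open V" "p \<in> V" "\<forall>k. Ck_on k V G" "\<forall>x\<in>V \<inter> S. G x = g x"
    by (rule smooth_onE[OF assms(2) p])
  have "Ck_on k (W \<inter> V) (\<lambda>x. (F x, G x))" for k
    using WF VG by (intro Ck_on_Pair) (auto intro: Ck_on_subset)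
  then show "\<exists>W F. open W \<and> p \<in> W \<and> (\<forall>k. Ck_on k W F) \<and> (\<forall>x\<in>W \<inter> S. F x = (f x, g x))"
    using WF VG by (intro exI[of _ "W \<inter> V"] exI[of _ "\<lambda>x. (F x, G x)"]) auto
qed

lemma smooth_on_bounded_linear: "bounded_linear f \<Longrightarrow> smooth_on S f"
  unfolding smooth_on_def using Ck_on_bounded_linear by (metis UNIV_I open_UNIV)

lemma smooth_on_continuous: 
  assumes "smooth_on S f" shows "continuous_on S f"
  unfolding continuous_on_eq_continuous_within
proof
  fix p assume p: "p \<in> S"
  obtain W F where WF: "open W" "p \<in> W" "\<forall>k. Ck_on k W F" "\<forall>x\<in>W \<inter> S. F x = f x"
    by (rule smooth_onE[OF assms p])
  have "continuous (at p) F"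
    using Ck_on_continuous[OF WF(3)[rule_format]] WF(1,2) continuous_on_eq_continuous_at by blast
  then have "continuous (at p within S) F" using continuous_within_subset by blast
  then show "continuous (at p within S) f"
    using continuous_transform_within_openin[of p S F "S \<inter> W" f] WF p
    by (auto simp: openin_open_Int)
qed

subsection \<open>Charts\<close>

lemma chart_of_subset: "chart_of M U \<psi> \<Longrightarrow> x \<in> U \<Longrightarrow> \<psi> x \<in> M"
  unfolding chart_of_def by (meson image_subset_iff openin_imp_subset)

lemma chart_of_open: "chart_of M U \<psi> \<Longrightarrow> open U"
  and chart_of_inj: "chart_of M U \<psi> \<Longrightarrow> inj_on \<psi> U"
  and chart_of_smooth: "chart_of M U \<psi> \<Longrightarrow> smooth_on U \<psi>"
  and chart_of_smooth_inv: "chart_of M U \<psi> \<Longrightarrow> smooth_on (\<psi> ` U) (inv_into U \<psi>)"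
  and chart_of_openin: "chart_of M U \<psi> \<Longrightarrow> openin (top_of_set M) (\<psi> ` U)"
  by (auto simp: chart_of_def diffeomorphism_on_def bij_betw_def)

lemma chart_of_Ck_on: "chart_of M U \<psi> \<Longrightarrow> Ck_on k U \<psi>"
  using chart_of_smooth chart_of_open smooth_on_open_iff by blast

lemma Ck_on_differentiable: "Ck_on (Suc k) W f \<Longrightarrow> x \<in> W \<Longrightarrow> f differentiable (at x)"
  by simp

lemma chart_of_differentiable: "chart_of M U \<psi> \<Longrightarrow> x \<in> U \<Longrightarrow> \<psi> differentiable (at x)"
  using chart_of_Ck_on Ck_on_differentiable by blast

text \<open>A smooth local extension \<open>F\<close> of the inverse chart satisfies
  \<open>F (\<psi> y) = y\<close> near \<open>x\<close>. By the chain rule the derivative of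
  \<open>\<psi>\<close> has a left inverse, hence a trivial kernel.\<close>

lemma chart_of_immersion:
  assumes "chart_of M U \<psi>" "x \<in> U" "dir_deriv u \<psi> x = 0"
  shows "u = 0"
proof -
  obtain W F where WF: "open W" "\<psi> x \<in> W" "\<forall>k. Ck_on k W F" "\<forall>y\<in>W \<inter> \<psi> ` U. F y = inv_into U \<psi> y"
    by (rule smooth_onE[OF chart_of_smooth_inv[OF assms(1)], of "\<psi> x"]) (use assms(2) in auto)
  have "F differentiable (at (\<psi> x))" using WF Ck_on_differentiable by blast
  then have "((\<lambda>y. F (\<psi> y)) has_derivative (\<lambda>u. dir_deriv (dir_deriv u \<psi> x) F (\<psi> x))) (at x)"
    by (intro has_derivative_compose[OF has_derivative_dir_deriv has_derivative_dir_deriv]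
        chart_of_differentiable[OF assms(1,2)])
  moreover have "((\<lambda>y. F (\<psi> y)) has_derivative (\<lambda>u. u)) (at x)"
  proof (rule has_derivative_transform_within_open[OF has_derivative_ident])
    show "open (U \<inter> \<psi> -` W)"
      using continuous_on_open_vimage[OF chart_of_open[OF assms(1)], of \<psi>] WF(1)
        smooth_on_continuous[OF chart_of_smooth[OF assms(1)]] by (metis inf_commute)
    show "y = F (\<psi> y)" if "y \<in> U \<inter> \<psi> -` W" for y
      using that WF(4) inv_into_f_f[OF chart_of_inj[OF assms(1)]] by auto
  qed (use assms WF in auto)
  ultimately have "(\<lambda>u. dir_deriv (dir_deriv u \<psi> x) F (\<psi> x)) = (\<lambda>u. u)"
    by (rule has_derivative_unique)
  then have "u = dir_deriv (dir_deriv u \<psi> x) F (\<psi> x)" by (rule fun_cong[symmetric])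
  also have "\<dots> = 0" unfolding assms(3)
    using linear_0[OF linear_dir_deriv[OF \<open>F differentiable _\<close>]] .
  finally show ?thesis .
qed

text \<open>Differentiate \<open>\<psi> y \<bullet> \<psi> y = 1\<close>.\<close>

lemma chart_of_sphere_tangent:
  assumes "chart_of (sphere 0 1) U \<psi>" "x \<in> U"
  shows "dir_deriv u \<psi> x \<in> sphere_tangent (\<psi> x)"
proof -
  have d: "\<psi> differentiable (at x)" using chart_of_differentiable[OF assms] .
  have "dir_deriv u (\<lambda>y. \<psi> y \<bullet> \<psi> y) x = dir_deriv u (\<lambda>y. 1) x"
    by (rule dir_deriv_cong_open[OF chart_of_open[OF assms(1)] assms(2)])
      (use chart_of_subset[OF assms(1)] in \<open>auto simp: norm_eq_1\<close>)
  then show ?thesis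
    unfolding bounded_bilinear.dir_deriv_prod[OF bounded_bilinear_inner d d] sphere_tangent_def
    by (simp add: inner_commute)
qed

lemma chart_of_affine:
  fixes \<psi> :: "'a::euclidean_space \<Rightarrow> 'b::euclidean_space"
  assumes chart: "chart_of M U \<psi>" and T: "open T" "\<And>x. x \<in> T \<Longrightarrow> c + L x \<in> U"
    and L: "bounded_linear L" "bounded_linear L'" "\<And>y. L (L' y) = y" "\<And>x. L' (L x) = x"
  shows "chart_of M T (\<lambda>x. \<psi> (c + L x))"
proof -
  define \<phi> where "\<phi> = (\<lambda>x. \<psi> (c + L x))"
  have inj: "inj_on \<phi> T"
    by (rule inj_onI) (metis L(4) \<phi>_def T(2) add_left_cancel chart chart_of_inj inj_onD)
  have inv: "inv_into T \<phi> p = - L' c + L' (inv_into U \<psi> p)" if p: "p \<in> \<phi> ` T" for p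
  proof -
    obtain x where x: "x \<in> T" "p = \<phi> x" using p by blast
    have "inv_into U \<psi> p = c + L x"
      unfolding x \<phi>_def using inv_into_f_f[OF chart_of_inj[OF chart]] T(2)[OF x(1)] .
    then show ?thesis using x inv_into_f_f[OF inj x(1)]
      by (simp add: L linear_add[OF bounded_linear.linear[OF L(2)]])
  qed
  have sub: "\<phi> ` T \<subseteq> \<psi> ` U" using T(2) by (auto simp: \<phi>_def)
  have "smooth_on T \<phi>" unfolding \<phi>_def
    by (rule smooth_on_affine_comp[OF L(1) chart_of_smooth[OF chart] T(2)])
  moreover have "smooth_on (\<phi> ` T) (inv_into T \<phi>)"
    by (rule smooth_on_cong[OF smooth_on_affine_post[OF L(2) smooth_on_subset[OF chart_of_smooth_inv[OF chart] sub]]])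
      (simp add: inv)
  moreover have "openin (top_of_set M) (\<phi> ` T)"
  proof -
    \<comment> \<open>Writing the image as a preimage under the continuous inverse chart shows that
      it is relatively open.\<close>
    have "\<phi> ` T = \<psi> ` U \<inter> inv_into U \<psi> -` {y. - L' c + L' y \<in> T}" (is "_ = ?R")
    proof
      show "?R \<subseteq> \<phi> ` T"
      proof
        fix p assume p: "p \<in> ?R"
        then have "L' (inv_into U \<psi> p) - L' c \<in> T" by simp
        moreover have "p = \<phi> (L' (inv_into U \<psi> p) - L' c)"
          using p unfolding \<phi>_def
          by (simp add: linear_diff[OF bounded_linear.linear[OF L(1)]] L(3) f_inv_into_f)
        ultimately show "p \<in> \<phi> ` T" by blast
      qed
      show "\<phi> ` T \<subseteq> ?R" using sub inv inv_into_into[of _ \<phi> T] by force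
    qed
    moreover have "openin (top_of_set (\<psi> ` U)) ?R"
      by (intro continuous_openin_preimage_gen smooth_on_continuous chart_of_smooth_inv[OF chart]
          open_affine_vimage T L)
    ultimately show ?thesis using openin_trans chart_of_openin[OF chart] by metis
  qed
  ultimately have "chart_of M T \<phi>"
    using T inj by (simp add: chart_of_def diffeomorphism_on_def bij_betw_def)
  then show ?thesis by (simp add: \<phi>_def)
qed

lemma chart_of_times_translation:
  fixes \<phi> :: "'a::euclidean_space \<Rightarrow> 'b::euclidean_space" and J N :: "real set"
  assumes chart: "chart_of M T \<phi>" and J: "open J" and N: "\<And>t. t \<in> J \<Longrightarrow> t + s \<in> N"
  shows "chart_of (M \<times> N) (T \<times> J) (\<lambda>(x, t). (\<phi> x, t + s))"
proof -
  define \<Phi> where "\<Phi> = (\<lambda>(x, t). (\<phi> x, t + s))"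
  have im: "\<Phi> ` (T \<times> J) = \<phi> ` T \<times> (\<lambda>t. t + s) ` J" by (force simp: \<Phi>_def)
  have inj: "inj_on \<Phi> (T \<times> J)"
    using chart_of_inj[OF chart] by (auto simp: \<Phi>_def inj_on_def)
  have inv: "inv_into (T \<times> J) \<Phi> q = (inv_into T \<phi> (0 + fst q), - s + snd q)" if q: "q \<in> \<Phi> ` (T \<times> J)" for q
  proof -
    obtain x t where xt: "x \<in> T" "t \<in> J" "q = \<Phi> (x, t)" using q by auto
    then have "inv_into (T \<times> J) \<Phi> q = (x, t)" using inv_into_f_f[OF inj] by simp
    then show ?thesis using xt inv_into_f_f[OF chart_of_inj[OF chart]] by (simp add: \<Phi>_def)
  qed
  \<comment> \<open>The summand \<open>0\<close> matches the shape \<open>c + L x\<close> required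
    by the lemma on affine composition.\<close>
  have "smooth_on (T \<times> J) (\<lambda>z. (\<phi> (0 + fst z), s + snd z))"
    by (intro smooth_on_Pair smooth_on_affine_comp[OF bounded_linear_fst chart_of_smooth[OF chart]]
        smooth_on_affine_post[OF bounded_linear_ident smooth_on_bounded_linear[OF bounded_linear_snd]]) auto
  then have s1: "smooth_on (T \<times> J) \<Phi>"
    by (rule smooth_on_cong) (auto simp: \<Phi>_def)
  have "smooth_on (\<Phi> ` (T \<times> J)) (\<lambda>q. (inv_into T \<phi> (0 + fst q), - s + snd q))"
    by (intro smooth_on_Pair smooth_on_affine_comp[OF bounded_linear_fst chart_of_smooth_inv[OF chart]]
        smooth_on_affine_post[OF bounded_linear_ident smooth_on_bounded_linear[OF bounded_linear_snd]])
      (auto simp: im)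
  then have s2: "smooth_on (\<Phi> ` (T \<times> J)) (inv_into (T \<times> J) \<Phi>)"
    by (rule smooth_on_cong) (simp add: inv)
  have "open ((\<lambda>t. t + s) ` J)" using open_translation[OF J, of s] by (simp add: add.commute)
  then have "openin (top_of_set N) ((\<lambda>t. t + s) ` J)"
    using N by (intro open_subset) auto
  then have "openin (top_of_set (M \<times> N)) (\<Phi> ` (T \<times> J))"
    unfolding im by (rule openin_Times[OF chart_of_openin[OF chart]])
  then have "chart_of (M \<times> N) (T \<times> J) \<Phi>"
    using s1 s2 inj J chart_of_open[OF chart]
    by (simp add: chart_of_def diffeomorphism_on_def bij_betw_def open_Times)
  then show ?thesis by (simp add: \<Phi>_def)
qed

text \<open>\<open>g\<close> is an inner product only on tangent vectors, so the algebraic laws rest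
  on the tangency of the differential of the chart, and definiteness on its injectivity.\<close>

lemma inner_product_on_pullback:
  assumes "chart_of (sphere 0 1) U \<psi>" "x \<in> U" "inner_product_on (sphere_tangent (\<psi> x)) (g (\<psi> x))"
  shows "inner_product_on UNIV (pullback \<psi> g x)"
proof -
  note t = chart_of_sphere_tangent[OF assms(1,2)]
  note l = linear_dir_deriv[OF chart_of_differentiable[OF assms(1,2)]]
  have "dir_deriv u \<psi> x \<noteq> 0" if "u \<noteq> 0" for u
    using chart_of_immersion[OF assms(1,2)] that by blast
  then show ?thesis
    using assms(3) t unfolding inner_product_on_def pullback_def by (simp add: linear_add[OF l] linear_scale[OF l])
qed

subsection \<open>Rotationally invariant metrics\<close>

text \<open>With \<open>x \<bullet> x\<close> in place of \<open>norm x\<close> the coefficients can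
  be smooth at the origin. At \<open>x\<close> the form is \<open>A\<close> times the Euclidean one
  orthogonally to \<open>x\<close>, and \<open>A + (x \<bullet> x) * B\<close> times it along
  \<open>x\<close>.\<close>

definition radial_form :: "(real \<Rightarrow> real) \<Rightarrow> (real \<Rightarrow> real) \<Rightarrow> 'a::euclidean_space tensor" where
  "radial_form A B x u v = A (x \<bullet> x) * (u \<bullet> v) + B (x \<bullet> x) * ((x \<bullet> u) * (x \<bullet> v))"

text \<open>A rotation-equivariant bilinear map, symmetric in \<open>u\<close> and \<open>v\<close>,
  with values in the span of \<open>u\<close>, \<open>v\<close> and \<open>x\<close>: the shape that
  the Koszul formula yields for a \<open>radial_form\<close>.\<close>

definition radial_connection ::
    "(real \<Rightarrow> real) \<Rightarrow> (real \<Rightarrow> real) \<Rightarrow> (real \<Rightarrow> real) \<Rightarrow> 'a::euclidean_space \<Rightarrow> 'a \<Rightarrow> 'a \<Rightarrow> 'a" where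
  "radial_connection p q r x u v =
     p (x \<bullet> x) *\<^sub>R ((x \<bullet> u) *\<^sub>R v + (x \<bullet> v) *\<^sub>R u)
     + (q (x \<bullet> x) * (u \<bullet> v) + r (x \<bullet> x) * ((x \<bullet> u) * (x \<bullet> v))) *\<^sub>R x"

lemma has_derivative_inner_self_comp:
  assumes "(p has_real_derivative p') (at (x \<bullet> x))"
  shows "((\<lambda>y::'a::euclidean_space. p (y \<bullet> y)) has_derivative (\<lambda>u. p' * (2 * (x \<bullet> u)))) (at x)"
proof -
  have "((\<lambda>y::'a. y \<bullet> y) has_derivative (\<lambda>u. 2 * (x \<bullet> u))) (at x)"
    by (auto intro!: derivative_eq_intros simp: inner_commute)
  from has_derivative_compose[OF this has_field_derivative_imp_has_derivative[OF assms]]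
  show ?thesis by simp
qed

lemma dir_deriv_radial_form:
  assumes "(A has_real_derivative A') (at (x \<bullet> x))" "(B has_real_derivative B') (at (x \<bullet> x))"
  shows "dir_deriv u (\<lambda>y. radial_form A B y v w) x =
    A' * (2 * (x \<bullet> u)) * (v \<bullet> w) + B' * (2 * (x \<bullet> u)) * ((x \<bullet> v) * (x \<bullet> w))
    + B (x \<bullet> x) * ((u \<bullet> v) * (x \<bullet> w) + (x \<bullet> v) * (u \<bullet> w))"
  unfolding radial_form_def
  by (rule dir_deriv_eq)
    (auto intro!: derivative_eq_intros has_derivative_inner_self_comp[OF assms(1)]
      has_derivative_inner_self_comp[OF assms(2)] simp: algebra_simps)

text \<open>For negative \<open>B\<close> the radial direction is the worst one, and Cauchy-Schwarz
  compares every vector with it.\<close>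

lemma radial_form_pos:
  assumes "A (x \<bullet> x) > 0" "A (x \<bullet> x) + (x \<bullet> x) * B (x \<bullet> x) > 0" "u \<noteq> 0"
  shows "radial_form A B x u u > 0"
proof (cases "B (x \<bullet> x) \<ge> 0")
  case True
  then show ?thesis using assms unfolding radial_form_def
    by (intro add_pos_nonneg mult_pos_pos mult_nonneg_nonneg[OF _ zero_le_square]) auto
next
  case False
  have "(x \<bullet> u)\<^sup>2 \<le> (x \<bullet> x) * (u \<bullet> u)" by (rule Cauchy_Schwarz_ineq)
  then have "B (x \<bullet> x) * ((x \<bullet> x) * (u \<bullet> u)) \<le> B (x \<bullet> x) * (x \<bullet> u)\<^sup>2"
    using False by (intro mult_left_mono_neg) auto
  moreover have "(A (x \<bullet> x) + (x \<bullet> x) * B (x \<bullet> x)) * (u \<bullet> u) > 0" using assms by auto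
  ultimately show ?thesis by (simp add: radial_form_def algebra_simps power2_eq_square)
qed

lemma inner_product_on_radial_form:
  assumes "A (x \<bullet> x) > 0" "A (x \<bullet> x) + (x \<bullet> x) * B (x \<bullet> x) > 0"
  shows "inner_product_on UNIV (radial_form A B x)"
  unfolding inner_product_on_def using radial_form_pos[of A x B] assms
  by (auto simp: radial_form_def inner_commute algebra_simps)

text \<open>By \<open>unit\<close>, pairing \<open>x\<close> with \<open>w\<close> in this metric
  gives just \<open>x \<bullet> w\<close>. The coefficients \<open>q\<close> and \<open>r\<close> of
  \<open>x\<close> can therefore be read off from the Koszul formula without inverting the metric.
  Positive definiteness makes the solution unique, as the definite description requires.\<close>

lemma christoffel_radial_form:
  assumes A: "(A has_real_derivative A') (at (x \<bullet> x))" and B: "(B has_real_derivative B') (at (x \<bullet> x))"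
    and pos: "A (x \<bullet> x) > 0" and unit: "A (x \<bullet> x) + (x \<bullet> x) * B (x \<bullet> x) = 1"
    and p: "p (x \<bullet> x) = A' / A (x \<bullet> x)" and q: "q (x \<bullet> x) = B (x \<bullet> x) - A'"
    and r: "r (x \<bullet> x) = B' - 2 * B (x \<bullet> x) * p (x \<bullet> x)"
  shows "christoffel (radial_form A B) x u v = radial_connection p q r x u v"
proof -
  have "2 * radial_form A B x (radial_connection p q r x u v) w =
     dir_deriv u (\<lambda>y. radial_form A B y v w) x + dir_deriv v (\<lambda>y. radial_form A B y u w) x
     - dir_deriv w (\<lambda>y. radial_form A B y u v) x" for w
  proof -
    define s b P where d: "s = x \<bullet> x" "b = B s" "P = p s"
    \<comment> \<open>With the inner products as opaque scalars the Koszul formula is a polynomial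
      identity.\<close>
    define xu xv xw uv uw vw where e: "xu = x \<bullet> u" "xv = x \<bullet> v" "xw = x \<bullet> w"
      "uv = u \<bullet> v" "uw = u \<bullet> w" "vw = v \<bullet> w"
    have c: "u \<bullet> x = x \<bullet> u" "v \<bullet> x = x \<bullet> v" "w \<bullet> x = x \<bullet> w"
      "v \<bullet> u = u \<bullet> v" "w \<bullet> u = u \<bullet> w" "w \<bullet> v = v \<bullet> w"
      by (simp_all add: inner_commute)
    have a: "A s = 1 - s * b" using unit by (simp add: d)
    have a': "A' = P * (1 - s * b)" using p pos a by (simp add: d)
    have q': "q s = b - A'" and r': "r s = B' - 2 * b * P" using q r by (simp_all add: d)
    show ?thesis
      unfolding dir_deriv_radial_form[OF A B]
      unfolding radial_form_def radial_connection_def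
      by (simp add: inner_add_left inner_add_right c d(1)[symmetric] e[symmetric] a q' r' d(2,3)[symmetric])
        (simp add: a' algebra_simps)
  qed
  then have sol: "\<forall>w. 2 * radial_form A B x (radial_connection p q r x u v) w =
     dir_deriv u (\<lambda>y. radial_form A B y v w) x + dir_deriv v (\<lambda>y. radial_form A B y u w) x
     - dir_deriv w (\<lambda>y. radial_form A B y u v) x" by blast
  have uniq: "z = z'" if "\<And>w. radial_form A B x z w = radial_form A B x z' w" for z z'
  proof (rule ccontr)
    assume "z \<noteq> z'"
    have "radial_form A B x (z - z') (z - z') = 0"
      using that[of "z - z'"] by (simp add: radial_form_def inner_diff_left inner_diff_right algebra_simps)
    then show False using radial_form_pos[of A x B "z - z'"] pos unit \<open>z \<noteq> z'\<close> by simp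
  qed
  show ?thesis unfolding christoffel_def
  proof (rule the_equality)
    show "\<forall>w. 2 * radial_form A B x (radial_connection p q r x u v) w =
      dir_deriv u (\<lambda>y. radial_form A B y v w) x + dir_deriv v (\<lambda>y. radial_form A B y u w) x
      - dir_deriv w (\<lambda>y. radial_form A B y u v) x" by (rule sol)
    fix z
    assume z: "\<forall>w. 2 * radial_form A B x z w =
      dir_deriv u (\<lambda>y. radial_form A B y v w) x + dir_deriv v (\<lambda>y. radial_form A B y u w) x
      - dir_deriv w (\<lambda>y. radial_form A B y u v) x"
    have "2 * radial_form A B x z w = 2 * radial_form A B x (radial_connection p q r x u v) w" for w
      unfolding sol[rule_format] z[rule_format] by (rule refl)
    then show "z = radial_connection p q r x u v" using uniq by simp
  qed
qed

lemma dir_deriv_radial_connection: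
  assumes "(p has_real_derivative p') (at (x \<bullet> x))" "(q has_real_derivative q') (at (x \<bullet> x))"
    "(r has_real_derivative r') (at (x \<bullet> x))"
  shows "dir_deriv u (\<lambda>y. radial_connection p q r y v w) x =
    (p' * (2 * (x \<bullet> u))) *\<^sub>R ((x \<bullet> v) *\<^sub>R w + (x \<bullet> w) *\<^sub>R v)
    + p (x \<bullet> x) *\<^sub>R ((u \<bullet> v) *\<^sub>R w + (u \<bullet> w) *\<^sub>R v)
    + (q' * (2 * (x \<bullet> u)) * (v \<bullet> w) + r' * (2 * (x \<bullet> u)) * ((x \<bullet> v) * (x \<bullet> w))
       + r (x \<bullet> x) * ((u \<bullet> v) * (x \<bullet> w) + (x \<bullet> v) * (u \<bullet> w))) *\<^sub>R x
    + (q (x \<bullet> x) * (v \<bullet> w) + r (x \<bullet> x) * ((x \<bullet> v) * (x \<bullet> w))) *\<^sub>R u"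
  unfolding radial_connection_def
  by (rule dir_deriv_eq)
    (auto intro!: derivative_eq_intros has_derivative_inner_self_comp[OF assms(1)]
      has_derivative_inner_self_comp[OF assms(2)] has_derivative_inner_self_comp[OF assms(3)]
      simp: algebra_simps)

text \<open>The right side is \<open>R(u,v)w\<close> in constant curvature -1. Paired with
  \<open>z\<close>, the left side is a combination of three scalar expressions antisymmetric in
  \<open>u\<close> and \<open>v\<close>, whose coefficients are the left sides of \<open>E1\<close>,
  \<open>E2\<close> and \<open>E3\<close>. Every term of the last two expressions has a factor
  \<open>x \<bullet> u\<close> or \<open>x \<bullet> v\<close>, so they vanish at the origin, where
  only \<open>E1\<close> is imposed.\<close>

lemma radial_curvature_identity:
  fixes x u v w :: "'a::euclidean_space"
  assumes p: "(p has_real_derivative p') (at (x \<bullet> x))" and q: "(q has_real_derivative q') (at (x \<bullet> x))"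
    and r: "(r has_real_derivative r') (at (x \<bullet> x))"
    and E1: "p (x \<bullet> x) - q (x \<bullet> x) - p (x \<bullet> x) * q (x \<bullet> x) * (x \<bullet> x) = A (x \<bullet> x)"
    and E2: "x \<noteq> 0 \<Longrightarrow> 2 * p' - r (x \<bullet> x) - (p (x \<bullet> x))\<^sup>2 - p (x \<bullet> x) * r (x \<bullet> x) * (x \<bullet> x) = B (x \<bullet> x)"
    and E3: "x \<noteq> 0 \<Longrightarrow> 2 * q' - r (x \<bullet> x) + (q (x \<bullet> x))\<^sup>2 + r (x \<bullet> x) * q (x \<bullet> x) * (x \<bullet> x) = 0"
  shows "dir_deriv u (\<lambda>y. radial_connection p q r y v w) x - dir_deriv v (\<lambda>y. radial_connection p q r y u w) x
      + radial_connection p q r x u (radial_connection p q r x v w)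
      - radial_connection p q r x v (radial_connection p q r x u w)
    = radial_form A B x u w *\<^sub>R v - radial_form A B x v w *\<^sub>R u" (is "?L = ?R")
proof (rule vector_eq_ldot[THEN iffD1], rule allI)
  fix z
  define s P Q R where d: "s = x \<bullet> x" "P = p s" "Q = q s" "R = r s"
  define xu xv xw xz uv uw uz vw vz wz where e: "xu = x \<bullet> u" "xv = x \<bullet> v" "xw = x \<bullet> w" "xz = x \<bullet> z"
    "uv = u \<bullet> v" "uw = u \<bullet> w" "uz = u \<bullet> z" "vw = v \<bullet> w" "vz = v \<bullet> z" "wz = w \<bullet> z"
  have c: "u \<bullet> x = x \<bullet> u" "v \<bullet> x = x \<bullet> v" "w \<bullet> x = x \<bullet> w" "z \<bullet> x = x \<bullet> z"
    "v \<bullet> u = u \<bullet> v" "w \<bullet> u = u \<bullet> w" "z \<bullet> u = u \<bullet> z" "w \<bullet> v = v \<bullet> w" "z \<bullet> v = v \<bullet> z" "z \<bullet> w = w \<bullet> z"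
    by (simp_all add: inner_commute)
  have "z \<bullet> ?L = (P - Q - P * Q * s) * (uw * vz - vw * uz)
     + (2 * p' - R - P\<^sup>2 - P * R * s) * (xw * (xu * vz - xv * uz))
     + (2 * q' - R + Q\<^sup>2 + R * Q * s) * ((xu * vw - xv * uw) * xz)"
    unfolding dir_deriv_radial_connection[OF p q r] unfolding radial_connection_def
    by (simp add: inner_add_left inner_add_right inner_diff_right c d[symmetric] e[symmetric])
      (simp add: algebra_simps power2_eq_square)
  also have "\<dots> = A s * (uw * vz - vw * uz) + B s * (xw * (xu * vz - xv * uz))"
  proof (cases "x = 0")
    case True
    then have "xu = 0" "xv = 0" by (simp_all add: e)
    then show ?thesis using E1 by (simp add: d)
  next
    case False
    then show ?thesis using E1 E2 E3 by (simp add: d)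
  qed
  also have "\<dots> = z \<bullet> ?R"
    unfolding radial_form_def
    by (simp add: inner_diff_right c d[symmetric] e[symmetric]) (simp add: algebra_simps)
  finally show "z \<bullet> ?L = z \<bullet> ?R" .
qed

lemma sectional_curvature_eq_minus1:
  assumes ip: "inner_product_on UNIV (G x)"
    and R: "curvature G x u v v = G x u v *\<^sub>R v - G x v v *\<^sub>R u"
    and ind: "u \<noteq> v" "independent {u, v}"
  shows "sectional_curvature G x u v = -1"
proof -
  have sym: "G x a b = G x b a" and add: "G x (a + b) c = G x a c + G x b c"
    and scale: "G x (t *\<^sub>R a) c = t * G x a c" and pos: "a \<noteq> 0 \<Longrightarrow> G x a a > 0" for a b c t
    using ip unfolding inner_product_on_def by auto
  have diff: "G x (a - b) c = G x a c - G x b c" for a b c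
    using add[of a "(-1) *\<^sub>R b" c] scale[of "-1" b c] by simp
  have v: "v \<noteq> 0" using ind(2) dependent_zero by auto
  \<comment> \<open>\<open>?w\<close> is the component of \<open>u\<close> orthogonal to
    \<open>v\<close>, scaled by \<open>G x v v\<close>. Its squared length is \<open>G x v v\<close>
    times the Gram determinant, which is the denominator of the sectional curvature.\<close>
  let ?w = "G x v v *\<^sub>R u - G x u v *\<^sub>R v"
  have "?w \<noteq> 0"
  proof
    assume "?w = 0"
    then have "u = (G x u v / G x v v) *\<^sub>R v"
      using pos[OF v] by (simp add: divideR_right eq_vector_fraction_iff)
    then have "u \<in> span {v}" by (metis insertI1 span_base span_scale)
    moreover have "{u, v} - {u} = {v}" using ind(1) by auto
    ultimately show False using ind(2) unfolding dependent_def by (metis insertI1)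
  qed
  then have "G x ?w ?w > 0" by (rule pos)
  also have "G x ?w ?w = G x v v * (G x u u * G x v v - (G x u v)\<^sup>2)"
    unfolding diff scale sym[of u ?w] sym[of v ?w] unfolding diff scale
    by (simp add: sym[of v u] algebra_simps power2_eq_square)
  finally have "G x u u * G x v v - (G x u v)\<^sup>2 \<noteq> 0" by auto
  moreover have "G x (curvature G x u v v) u = - (G x u u * G x v v - (G x u v)\<^sup>2)"
    unfolding R by (simp add: diff scale sym[of v u] power2_eq_square)
  ultimately show ?thesis by (simp add: sectional_curvature_def divide_eq_eq)
qed

subsection \<open>The hyperbolic metric in normal coordinates\<close>

definition entire_coeffs :: "(nat \<Rightarrow> real) \<Rightarrow> bool" where
  "entire_coeffs c \<longleftrightarrow> (\<forall>x. summable (\<lambda>n. c n * x ^ n))"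

definition power_series :: "(nat \<Rightarrow> real) \<Rightarrow> real \<Rightarrow> real" where
  "power_series c x = (\<Sum>n. c n * x ^ n)"

lemma entire_coeffs_diffs: "entire_coeffs c \<Longrightarrow> entire_coeffs (diffs c)"
  unfolding entire_coeffs_def using termdiff_converges_all by blast

lemma power_series_deriv:
  "entire_coeffs c \<Longrightarrow> (power_series c has_real_derivative power_series (diffs c) x) (at x)"
  unfolding entire_coeffs_def power_series_def[abs_def]
  by (rule termdiffs_strong_converges_everywhere) blast

lemma power_series_0: "power_series c 0 = c 0"
  unfolding power_series_def by (simp add: powser_zero)

text \<open>A directional derivative is a linear factor times the series with coefficients
  \<open>diffs c\<close>, which is again entire; hence the induction over \<open>k\<close> with
  arbitrary \<open>c\<close>.\<close>

lemma Ck_on_power_series: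
  "entire_coeffs c \<Longrightarrow> Ck_on k UNIV (\<lambda>x::'a::euclidean_space. power_series c (x \<bullet> x))"
proof (induction k arbitrary: c)
  case 0
  have "isCont (power_series c) y" for y using power_series_deriv[OF 0] DERIV_isCont by blast
  then have "continuous_on UNIV (power_series c)" by (simp add: continuous_at_imp_continuous_on)
  then have "continuous_on UNIV (\<lambda>x::'a. power_series c (x \<bullet> x))"
    by (rule continuous_on_compose2) (auto intro!: continuous_intros)
  then show ?case by simp
next
  case (Suc k)
  have d: "((\<lambda>x::'a. power_series c (x \<bullet> x)) has_derivative
      (\<lambda>v. power_series (diffs c) (x \<bullet> x) * (2 * (x \<bullet> v)))) (at x)" for x
  proof -
    have "((\<lambda>y::'a. y \<bullet> y) has_derivative (\<lambda>u. 2 * (x \<bullet> u))) (at x)"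
      by (auto intro!: derivative_eq_intros simp: inner_commute)
    from has_derivative_compose[OF this has_field_derivative_imp_has_derivative[OF power_series_deriv[OF Suc.prems]]]
    show ?thesis by simp
  qed
  have "dir_deriv v (\<lambda>x::'a. power_series c (x \<bullet> x)) = (\<lambda>x. power_series (diffs c) (x \<bullet> x) * (2 * (x \<bullet> v)))" for v
    by (rule ext, rule dir_deriv_eq[OF d])
  moreover have "Ck_on k UNIV (\<lambda>x. power_series (diffs c) (x \<bullet> x) * (2 * (x \<bullet> v)))" for v :: 'a
    by (rule Ck_on_mult[OF open_UNIV Suc.IH[OF entire_coeffs_diffs[OF Suc.prems]]
          Ck_on_bounded_linear]) (intro bounded_linear_intros)
  ultimately show ?case
    using d by (auto simp: differentiable_def)
qed

definition sinhc_coeffs :: "nat \<Rightarrow> real" where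
  "sinhc_coeffs n = 1 / fact (2 * n + 1)"

text \<open>\<open>sinh (sqrt s) / sqrt s\<close> as a power series in \<open>s\<close>, which is smooth across the origin.\<close>

definition sinhc :: "real \<Rightarrow> real" where
  "sinhc = power_series sinhc_coeffs"

text \<open>This is \<open>(sinhc s - 1) / s\<close> with the value at \<open>0\<close> filled
  in.\<close>

definition sinhc_tail :: "real \<Rightarrow> real" where
  "sinhc_tail = power_series (\<lambda>n. sinhc_coeffs (Suc n))"

lemma summable_fact_ge:
  assumes "\<And>n. n \<le> g n"
  shows "summable (\<lambda>n. 1 / fact (g n) * (x::real) ^ n)"
proof (rule summable_comparison_test)
  show "summable (\<lambda>n. inverse (fact n) * \<bar>x\<bar> ^ n)" by (rule summable_exp)
  have "norm (1 / fact (g n) * x ^ n) \<le> inverse (fact n) * \<bar>x\<bar> ^ n" for n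
    using fact_mono[OF assms[of n], where ?'a = real]
    by (auto simp: abs_mult power_abs inverse_eq_divide intro!: mult_right_mono divide_left_mono)
  then show "\<exists>N. \<forall>n\<ge>N. norm (1 / fact (g n) * x ^ n) \<le> inverse (fact n) * \<bar>x\<bar> ^ n" by blast
qed

lemma entire_sinhc: "entire_coeffs sinhc_coeffs" "entire_coeffs (\<lambda>n. sinhc_coeffs (Suc n))"
  unfolding entire_coeffs_def sinhc_coeffs_def 
  using summable_fact_ge[of "\<lambda>n. 2 * n + 1"] summable_fact_ge[of "\<lambda>n. 2 * Suc n + 1"] by auto

lemma sinhc_eq_tail: "sinhc s = 1 + s * sinhc_tail s"
proof -
  have "summable (\<lambda>n. sinhc_coeffs n * s ^ n)"
    using entire_sinhc(1) unfolding entire_coeffs_def by blast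
  from suminf_split_head[OF this]
  have "sinhc s = 1 + (\<Sum>n. s * (sinhc_coeffs (Suc n) * s ^ n))"
    by (simp add: sinhc_def power_series_def sinhc_coeffs_def mult_ac)
  also have "(\<Sum>n. s * (sinhc_coeffs (Suc n) * s ^ n)) = s * sinhc_tail s"
    using entire_sinhc(2) unfolding entire_coeffs_def sinhc_tail_def power_series_def
    by (intro suminf_mult) blast
  finally show ?thesis .
qed

lemma sinhc_sinh: "t * sinhc (t\<^sup>2) = sinh t"
proof -
  have "(\<lambda>n. if even n then 0 else t ^ n /\<^sub>R fact n) sums sinh t"
    by (rule sinh_converges)
  then have "(\<lambda>n. (if even (2 * n + 1) then 0 else t ^ (2 * n + 1) /\<^sub>R fact (2 * n + 1))) sums sinh t"
    \<comment> \<open>The terms of even index vanish, so the odd indices \<open>2 * n + 1\<close>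
      carry the whole sum.\<close>
    by (subst (asm) sums_mono_reindex[symmetric, of "\<lambda>n. 2 * n + 1"])
      (auto simp: strict_mono_def elim!: oddE)
  then have "(\<lambda>n. t * (sinhc_coeffs n * (t\<^sup>2) ^ n)) sums sinh t"
    by (simp add: sinhc_coeffs_def power_mult[symmetric] field_simps del: fact_Suc)
  moreover have "(\<lambda>n. t * (sinhc_coeffs n * (t\<^sup>2) ^ n)) sums (t * sinhc (t\<^sup>2))"
    using entire_sinhc(1) unfolding entire_coeffs_def sinhc_def power_series_def
    by (intro sums_mult summable_sums) blast
  ultimately show ?thesis using sums_unique2 by blast
qed

lemma sinhc_pos: "s \<ge> 0 \<Longrightarrow> sinhc s > 0"
  using sinhc_sinh[of "sqrt s"] sinh_real_pos_iff[of "sqrt s"] zero_less_mult_pos[of "sqrt s" "sinhc s"]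
  by (cases "s = 0") (auto simp: sinhc_eq_tail[of 0])

definition sinhc1 :: "real \<Rightarrow> real" where
  "sinhc1 = power_series (diffs sinhc_coeffs)"

definition sinhc2 :: "real \<Rightarrow> real" where
  "sinhc2 = power_series (diffs (diffs sinhc_coeffs))"

lemma sinhc_deriv: "(sinhc has_real_derivative sinhc1 s) (at s)"
  and sinhc1_deriv: "(sinhc1 has_real_derivative sinhc2 s) (at s)"
  unfolding sinhc_def sinhc1_def sinhc2_def
  by (intro power_series_deriv entire_sinhc entire_coeffs_diffs)+

text \<open>Differentiate \<open>t * sinhc (t\<^sup>2) = sinh t\<close> at
  \<open>t = sqrt s\<close>.\<close>

lemma cosh_sqrt_eq:
  assumes "s > 0"
  shows "cosh (sqrt s) = sinhc s + 2 * s * sinhc1 s"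
proof -
  have "((\<lambda>t. t * sinhc (t\<^sup>2)) has_real_derivative sinhc s + sqrt s * (sinhc1 s * (2 * sqrt s))) (at (sqrt s))"
    using assms by (auto intro!: derivative_eq_intros DERIV_chain2[OF sinhc_deriv])
  moreover have "(\<lambda>t. t * sinhc (t\<^sup>2)) = sinh" using sinhc_sinh by blast
  moreover have "(sinh has_real_derivative cosh (sqrt s)) (at (sqrt s))"
    by (auto intro!: derivative_eq_intros)
  ultimately have "cosh (sqrt s) = sinhc s + sqrt s * (sinhc1 s * (2 * sqrt s))"
    using DERIV_unique by metis
  then show ?thesis using assms by (simp add: algebra_simps)
qed

text \<open>This is \<open>cosh\<^sup>2 - sinh\<^sup>2 = 1\<close> in the variable
  \<open>s\<close>.\<close>

lemma sinhc_first_integral: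
  assumes "s > 0"
  shows "(sinhc s + 2 * s * sinhc1 s)\<^sup>2 = 1 + s * (sinhc s)\<^sup>2"
proof -
  have "sqrt s * sinhc s = sinh (sqrt s)" using sinhc_sinh[of "sqrt s"] assms by simp
  then have "(sinh (sqrt s))\<^sup>2 = s * (sinhc s)\<^sup>2" using assms by (metis less_imp_le power_mult_distrib real_sqrt_pow2)
  then show ?thesis using cosh_square_eq[of "sqrt s"] cosh_sqrt_eq[OF assms] by simp
qed

text \<open>Differentiating the formula for \<open>cosh (sqrt s)\<close> once more produces
  \<open>sinhc s / 2\<close> on the other side. The result is the equation
  \<open>sinh'' = sinh\<close> in the variable \<open>s\<close>.\<close>

lemma sinhc_ode:
  assumes "s > 0"
  shows "4 * s * sinhc2 s = sinhc s - 6 * sinhc1 s"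
proof -
  have "((\<lambda>s. sinhc s + 2 * s * sinhc1 s) has_real_derivative
      sinhc1 s + (2 * sinhc1 s + 2 * s * sinhc2 s)) (at s)"
    by (auto intro!: derivative_eq_intros sinhc_deriv sinhc1_deriv)
  then have "((\<lambda>s. cosh (sqrt s)) has_real_derivative sinhc1 s + (2 * sinhc1 s + 2 * s * sinhc2 s)) (at s)"
    by (rule has_field_derivative_transform_within_open[of _ _ _ "{0<..}"]) (use assms cosh_sqrt_eq in auto)
  moreover have "((\<lambda>s. cosh (sqrt s)) has_real_derivative sinh (sqrt s) * (inverse (sqrt s) / 2)) (at s)"
    using assms by (auto intro!: derivative_eq_intros)
  ultimately have "sinhc1 s + (2 * sinhc1 s + 2 * s * sinhc2 s) = sinh (sqrt s) * (inverse (sqrt s) / 2)"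
    by (rule DERIV_unique)
  also have "\<dots> = sinhc s / 2"
    using sinhc_sinh[of "sqrt s"] assms by (auto simp: field_simps)
  finally show ?thesis by simp
qed

section \<open>Coefficients of the hyperbolic metric and of its connection\<close>

definition hyp_A :: "real \<Rightarrow> real" where
  "hyp_A s = (sinhc s)\<^sup>2"

text \<open>The regular form of \<open>(1 - hyp_A s) / s\<close>, without the division that is undefined at \<open>0\<close>.\<close>

definition hyp_B :: "real \<Rightarrow> real" where
  "hyp_B s = - sinhc_tail s * (1 + sinhc s)"

lemma hyp_A_pos: "s \<ge> 0 \<Longrightarrow> hyp_A s > 0"
  using sinhc_pos[of s] by (simp add: hyp_A_def)

text \<open>With \<open>F = sinhc s\<close>, factor \<open>1 - F\<^sup>2\<close> as
  \<open>(1 - F) * (1 + F)\<close> and use \<open>1 - F = - s * sinhc_tail s\<close>.\<close>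

lemma hyp_A_B: "hyp_A s + s * hyp_B s = 1"
  by (simp add: hyp_A_def hyp_B_def power2_eq_square sinhc_eq_tail[of s] algebra_simps)

lemma Ck_on_hyp_A: "Ck_on k UNIV (\<lambda>x::'a::euclidean_space. hyp_A (x \<bullet> x))"
  unfolding hyp_A_def power2_eq_square sinhc_def
  by (intro Ck_on_mult Ck_on_power_series entire_sinhc open_UNIV)

lemma Ck_on_hyp_B: "Ck_on k UNIV (\<lambda>x::'a::euclidean_space. hyp_B (x \<bullet> x))"
proof -
  have "Ck_on k UNIV (\<lambda>x::'a. (-1) * (power_series (\<lambda>n. sinhc_coeffs (Suc n)) (x \<bullet> x) * (1 + power_series sinhc_coeffs (x \<bullet> x))))"
    by (intro Ck_on_mult Ck_on_add Ck_on_const Ck_on_power_series entire_sinhc open_UNIV)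
  then show ?thesis by (simp add: hyp_B_def sinhc_tail_def sinhc_def)
qed

definition hyp_A1 :: "real \<Rightarrow> real" where
  "hyp_A1 s = 2 * sinhc s * sinhc1 s"

definition hyp_A2 :: "real \<Rightarrow> real" where
  "hyp_A2 s = 2 * (sinhc1 s)\<^sup>2 + 2 * sinhc s * sinhc2 s"

definition sinhc_tail1 :: "real \<Rightarrow> real" where
  "sinhc_tail1 = power_series (diffs (\<lambda>n. sinhc_coeffs (Suc n)))"

definition sinhc_tail2 :: "real \<Rightarrow> real" where
  "sinhc_tail2 = power_series (diffs (diffs (\<lambda>n. sinhc_coeffs (Suc n))))"

lemma sinhc_tail_deriv: "(sinhc_tail has_real_derivative sinhc_tail1 s) (at s)"
  and sinhc_tail1_deriv: "(sinhc_tail1 has_real_derivative sinhc_tail2 s) (at s)"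
  unfolding sinhc_tail_def sinhc_tail1_def sinhc_tail2_def
  by (intro power_series_deriv entire_sinhc entire_coeffs_diffs)+

definition hyp_B1 :: "real \<Rightarrow> real" where
  "hyp_B1 s = - sinhc_tail1 s * (1 + sinhc s) - sinhc_tail s * sinhc1 s"

lemma hyp_A_deriv: "(hyp_A has_real_derivative hyp_A1 s) (at s)"
  and hyp_A1_deriv: "(hyp_A1 has_real_derivative hyp_A2 s) (at s)"
  and hyp_B_deriv: "(hyp_B has_real_derivative hyp_B1 s) (at s)"
  unfolding hyp_A_def[abs_def] hyp_A1_def[abs_def] hyp_A2_def hyp_B_def[abs_def] hyp_B1_def
  by (auto intro!: derivative_eq_intros sinhc_deriv sinhc1_deriv sinhc_tail_deriv simp: algebra_simps power2_eq_square)

text \<open>Existence is enough here: the derivative of the coefficient \<open>r\<close> enters the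
  curvature only with the factor \<open>(x \<bullet> u) * (x \<bullet> v)\<close>, which is
  symmetric in \<open>u\<close> and \<open>v\<close> and cancels.\<close>

lemma hyp_B1_differentiable: "\<exists>D. (hyp_B1 has_real_derivative D) (at s)"
  unfolding hyp_B1_def[abs_def]
  by (rule exI) (auto intro!: derivative_eq_intros sinhc_deriv sinhc1_deriv sinhc_tail_deriv sinhc_tail1_deriv)

text \<open>Differentiate the constant \<open>hyp_A s + s * hyp_B s\<close>.\<close>

lemma hyp_B1_eq: "hyp_A1 s + hyp_B s + s * hyp_B1 s = 0"
proof -
  have "((\<lambda>s. hyp_A s + s * hyp_B s) has_real_derivative hyp_A1 s + hyp_B s + s * hyp_B1 s) (at s)"
    by (auto intro!: derivative_eq_intros hyp_A_deriv hyp_B_deriv)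
  then show ?thesis unfolding hyp_A_B using DERIV_unique DERIV_const by blast
qed

definition hyp_p :: "real \<Rightarrow> real" where
  "hyp_p s = hyp_A1 s / hyp_A s"

definition hyp_q :: "real \<Rightarrow> real" where
  "hyp_q s = hyp_B s - hyp_A1 s"

definition hyp_r :: "real \<Rightarrow> real" where
  "hyp_r s = hyp_B1 s - 2 * hyp_B s * hyp_p s"

lemma hyp_p_eq: "s \<ge> 0 \<Longrightarrow> hyp_p s = 2 * sinhc1 s / sinhc s"
  using sinhc_pos[of s] by (simp add: hyp_p_def hyp_A1_def hyp_A_def power2_eq_square)

definition hyp_p1 :: "real \<Rightarrow> real" where
  "hyp_p1 s = hyp_A2 s / hyp_A s - (hyp_p s)\<^sup>2"

lemma hyp_p_deriv: "s \<ge> 0 \<Longrightarrow> (hyp_p has_real_derivative hyp_p1 s) (at s)"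
  unfolding hyp_p_def[abs_def] hyp_p1_def using hyp_A_pos[of s]
  by (auto intro!: derivative_eq_intros hyp_A_deriv hyp_A1_deriv simp: field_simps power2_eq_square)

lemma hyp_q_deriv: "(hyp_q has_real_derivative hyp_B1 s - hyp_A2 s) (at s)"
  unfolding hyp_q_def[abs_def] by (auto intro!: derivative_eq_intros hyp_B_deriv hyp_A1_deriv)

lemma hyp_r_deriv: "s \<ge> 0 \<Longrightarrow> \<exists>D. (hyp_r has_real_derivative D) (at s)"
proof -
  assume s: "s \<ge> 0"
  obtain D where "(hyp_B1 has_real_derivative D) (at s)" using hyp_B1_differentiable by blast
  from DERIV_diff[OF this DERIV_mult[OF DERIV_cmult[OF hyp_B_deriv, of 2] hyp_p_deriv[OF s]]]
  show ?thesis unfolding hyp_r_def[abs_def] by blast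
qed

text \<open>Replace the \<open>1\<close> in \<open>s * hyp_B s = 1 - hyp_A s\<close> by the first
  integral and divide by \<open>s\<close>. This removes \<open>sinhc_tail\<close>, so that the
  curvature equations become polynomial.\<close>

lemma hyp_B_poly:
  assumes "s > 0"
  shows "hyp_B s = 4 * sinhc s * sinhc1 s + 4 * s * (sinhc1 s)\<^sup>2 - (sinhc s)\<^sup>2"
proof -
  have "s * hyp_B s = s * (4 * sinhc s * sinhc1 s + 4 * s * (sinhc1 s)\<^sup>2 - (sinhc s)\<^sup>2)"
    using hyp_A_B[of s] sinhc_first_integral[OF assms] by (simp add: hyp_A_def power2_eq_square algebra_simps)
  then show ?thesis using assms by simp
qed

lemma hyp_constant_curvature_diag:
  assumes "s \<ge> 0"
  shows "hyp_p s - hyp_q s - hyp_p s * hyp_q s * s = hyp_A s"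
proof (cases "s = 0")
  \<comment> \<open>At the origin the leading coefficients of the series give
    \<open>hyp_p 0 = 1/3\<close> and \<open>hyp_q 0 = -2/3\<close>, whose difference is
    \<open>hyp_A 0 = 1\<close>.\<close>
  case True
  have "sinhc 0 = 1" by (simp add: sinhc_eq_tail[of 0])
  moreover have "sinhc1 0 = 1 / 6" "sinhc_tail 0 = 1 / 6"
    by (simp_all add: sinhc1_def sinhc_tail_def power_series_0 diffs_def sinhc_coeffs_def fact_numeral)
  ultimately show ?thesis
    by (simp add: True hyp_p_eq hyp_q_def hyp_B_def hyp_A1_def hyp_A_def)
next
  case False
  then have s: "s > 0" using assms by simp
  define F g where Fg: "F = sinhc s" "g = sinhc1 s"
  have F: "F > 0" using sinhc_pos assms by (simp add: Fg)
  have I: "(F + 2 * s * g)\<^sup>2 = 1 + s * F\<^sup>2" using sinhc_first_integral[OF s] by (simp add: Fg)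
  have p: "hyp_p s * F = 2 * g" using hyp_p_eq assms F by (simp add: Fg)
  have q: "hyp_q s = 2 * F * g + 4 * s * g\<^sup>2 - F\<^sup>2"
    unfolding hyp_q_def hyp_B_poly[OF s] by (simp add: hyp_A1_def Fg)
  \<comment> \<open>The factor \<open>F\<close> clears the denominator of
    \<open>hyp_p\<close>.\<close>
  have "F * (hyp_p s - hyp_q s - hyp_p s * hyp_q s * s) = 2 * g - hyp_q s * (F + 2 * s * g)"
    using p by algebra
  also have "\<dots> = F * F\<^sup>2" unfolding q using I by algebra
  finally show ?thesis using F by (simp add: hyp_A_def Fg)
qed

lemma hyp_constant_curvature_radial:
  assumes "s > 0"
  shows "2 * hyp_p1 s - hyp_r s - (hyp_p s)\<^sup>2 - hyp_p s * hyp_r s * s = hyp_B s"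
proof -
  define F g h p B B1 where Fg: "F = sinhc s" "g = sinhc1 s" "h = sinhc2 s" "p = hyp_p s" "B = hyp_B s" "B1 = hyp_B1 s"
  have F: "F > 0" using sinhc_pos assms by (simp add: Fg)
  have I: "(F + 2 * s * g)\<^sup>2 = 1 + s * F\<^sup>2" using sinhc_first_integral[OF assms] by (simp add: Fg)
  have p: "p * F = 2 * g" using hyp_p_eq assms F by (simp add: Fg)
  have h: "4 * s * h = F - 6 * g" using sinhc_ode[OF assms] by (simp add: Fg)
  have B: "B = 4 * F * g + 4 * s * g\<^sup>2 - F\<^sup>2" using hyp_B_poly[OF assms] by (simp add: Fg)
  have B1: "s * B1 = - 2 * F * g - B" using hyp_B1_eq[of s] by (simp add: Fg hyp_A1_def)
  have p1: "hyp_p1 s * F\<^sup>2 = 2 * g\<^sup>2 + 2 * F * h - 4 * g\<^sup>2"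
  proof -
    have "hyp_p1 s * F\<^sup>2 = hyp_A2 s - (p * F)\<^sup>2"
      using F by (simp add: hyp_p1_def hyp_A_def Fg power_mult_distrib field_simps)
    also have "\<dots> = 2 * g\<^sup>2 + 2 * F * h - 4 * g\<^sup>2"
      unfolding p hyp_A2_def by (simp add: Fg power_mult_distrib)
    finally show ?thesis .
  qed
  have r: "hyp_r s = B1 - 2 * B * p" by (simp add: hyp_r_def Fg)
  \<comment> \<open>\<open>h\<close> and \<open>B1\<close> are known only through
    \<open>4 * s * h\<close> and \<open>s * B1\<close>, which explains the factor \<open>s\<close>;
    \<open>F\<^sup>2\<close> clears the denominators of \<open>p\<close> and \<open>hyp_p1\<close>.
    The rest is polynomial elimination with the first integral \<open>I\<close>.\<close>
  have "s * F\<^sup>2 * (2 * hyp_p1 s - hyp_r s - p\<^sup>2 - p * hyp_r s * s) = s * F\<^sup>2 * B"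
    using p h B B1 p1 r I by algebra
  then show ?thesis using F assms by (simp add: Fg)
qed

text \<open>\<open>hyp_B1 s - hyp_A2 s\<close> is the derivative of \<open>hyp_q\<close>. The proof
  is the same elimination as for the radial equation, with the same clearing factor.\<close>

lemma hyp_constant_curvature_mixed:
  assumes "s > 0"
  shows "2 * (hyp_B1 s - hyp_A2 s) - hyp_r s + (hyp_q s)\<^sup>2 + hyp_r s * hyp_q s * s = 0"
proof -
  define F g h p B B1 where Fg: "F = sinhc s" "g = sinhc1 s" "h = sinhc2 s" "p = hyp_p s" "B = hyp_B s" "B1 = hyp_B1 s"
  have F: "F > 0" using sinhc_pos assms by (simp add: Fg)
  have I: "(F + 2 * s * g)\<^sup>2 = 1 + s * F\<^sup>2" using sinhc_first_integral[OF assms] by (simp add: Fg)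
  have p: "p * F = 2 * g" using hyp_p_eq assms F by (simp add: Fg)
  have h: "4 * s * h = F - 6 * g" using sinhc_ode[OF assms] by (simp add: Fg)
  have B: "B = 4 * F * g + 4 * s * g\<^sup>2 - F\<^sup>2" using hyp_B_poly[OF assms] by (simp add: Fg)
  have B1: "s * B1 = - 2 * F * g - B" using hyp_B1_eq[of s] by (simp add: Fg hyp_A1_def)
  have r: "hyp_r s = B1 - 2 * B * p" by (simp add: hyp_r_def Fg)
  have q: "hyp_q s = B - 2 * F * g" by (simp add: hyp_q_def Fg hyp_A1_def)
  have A2: "hyp_A2 s = 2 * g\<^sup>2 + 2 * F * h" by (simp add: hyp_A2_def Fg)
  have "s * F\<^sup>2 * (2 * (B1 - hyp_A2 s) - hyp_r s + (hyp_q s)\<^sup>2 + hyp_r s * hyp_q s * s) = 0"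
    using p h B B1 r q A2 I by algebra
  then show ?thesis using F assms by (simp add: Fg)
qed

text \<open>For \<open>norm x \<le> a\<close> the argument of \<open>\<rho>\<close> is nonpositive,
  so \<open>g\<close> drops out and the round metric remains. Splitting \<open>u\<close> and
  \<open>v\<close> into radial and tangential parts turns the polar expression into a combination of
  \<open>u \<bullet> v\<close> and \<open>(x \<bullet> u) * (x \<bullet> v)\<close>.\<close>

lemma two_variable_warp_eq_radial_form:
  assumes "\<And>t. t \<le> 0 \<Longrightarrow> \<rho> t = 0" "d > 0" "x \<in> ball 0 a"
  shows "two_variable_warp \<rho> a d g x = radial_form hyp_A hyp_B x"
proof (intro ext)
  fix u v
  show "two_variable_warp \<rho> a d g x u v = radial_form hyp_A hyp_B x u v"
  proof (cases "x = 0")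
    \<comment> \<open>The value prescribed at the origin fits because
      \<open>hyp_A 0 = 1\<close>.\<close>
    case True
    then show ?thesis using hyp_A_B[of 0]
      by (simp add: two_variable_warp_def polar_metric_def radial_form_def)
  next
    case False
    define t where t: "t = norm x"
    have t0: "t > 0" and ta: "t \<le> a" using False assms(3) by (simp_all add: t)
    have xx: "x \<bullet> x = t\<^sup>2" by (simp add: t power2_norm_eq_inner)
    have "rho_ad \<rho> a d t = 0"
      unfolding rho_ad_def using assms(1,2) ta by (simp add: divide_nonpos_pos)
    then have "two_variable_warp \<rho> a d g x u v =
        (sinh t)\<^sup>2 * (((u - (u \<bullet> (x /\<^sub>R t)) *\<^sub>R (x /\<^sub>R t)) /\<^sub>R t) \<bullet> ((v - (v \<bullet> (x /\<^sub>R t)) *\<^sub>R (x /\<^sub>R t)) /\<^sub>R t))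
        + (u \<bullet> (x /\<^sub>R t)) * (v \<bullet> (x /\<^sub>R t))"
      using False
      by (simp add: two_variable_warp_def polar_metric_def radial_metric_def warp_family_def g_ad_def
          round_metric_def Let_def t)
    also have "((u - (u \<bullet> (x /\<^sub>R t)) *\<^sub>R (x /\<^sub>R t)) /\<^sub>R t) \<bullet> ((v - (v \<bullet> (x /\<^sub>R t)) *\<^sub>R (x /\<^sub>R t)) /\<^sub>R t)
        = (u \<bullet> v - (x \<bullet> u) * (x \<bullet> v) / t\<^sup>2) / t\<^sup>2"
    proof -
      define \<theta> where \<theta>: "\<theta> = x /\<^sub>R t"
      have "\<theta> \<bullet> \<theta> = 1" using t0 left_inverse[of t] by (simp add: \<theta> xx power2_eq_square mult.assoc[symmetric] del: left_inverse)
      then have "(u - (u \<bullet> \<theta>) *\<^sub>R \<theta>) \<bullet> (v - (v \<bullet> \<theta>) *\<^sub>R \<theta>) = u \<bullet> v - (u \<bullet> \<theta>) * (v \<bullet> \<theta>)"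
        by (simp add: inner_diff_left inner_diff_right inner_commute[of \<theta> u] inner_commute[of \<theta> v])
      moreover have "(u \<bullet> \<theta>) * (v \<bullet> \<theta>) = (x \<bullet> u) * (x \<bullet> v) / t\<^sup>2"
        by (simp add: \<theta> inner_commute[of _ x] divide_inverse power2_eq_square)
      ultimately show ?thesis
        by (simp add: \<theta>[symmetric] divide_inverse power2_eq_square)
    qed
    also have "sinh t = t * sinhc (t\<^sup>2)" by (simp add: sinhc_sinh)
    also have "(t * sinhc (t\<^sup>2))\<^sup>2 * ((u \<bullet> v - (x \<bullet> u) * (x \<bullet> v) / t\<^sup>2) / t\<^sup>2) + (u \<bullet> (x /\<^sub>R t)) * (v \<bullet> (x /\<^sub>R t))
       = hyp_A (t\<^sup>2) * (u \<bullet> v) + (1 - hyp_A (t\<^sup>2)) / t\<^sup>2 * ((x \<bullet> u) * (x \<bullet> v))"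
      using t0 by (simp add: hyp_A_def inner_commute[of _ x] field_simps power2_eq_square)
    also have "(1 - hyp_A (t\<^sup>2)) / t\<^sup>2 = hyp_B (t\<^sup>2)"
      using hyp_A_B[of "t\<^sup>2"] t0 by (simp add: field_simps)
    finally show ?thesis by (simp add: radial_form_def xx)
  qed
qed

lemma smooth_radial_form:
  "Ck_on k UNIV (\<lambda>x. radial_form hyp_A hyp_B x u v)"
  unfolding radial_form_def
  by (intro Ck_on_add Ck_on_mult Ck_on_hyp_A Ck_on_hyp_B Ck_on_const open_UNIV
      Ck_on_bounded_linear bounded_linear_inner_left)

lemma hyperbolic_on_radial_form:
  fixes G :: "'a::euclidean_space tensor"
  assumes "open W" and G: "\<And>x. x \<in> W \<Longrightarrow> G x = radial_form hyp_A hyp_B x"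
  shows "hyperbolic_on W G"
  unfolding hyperbolic_on_def
proof (intro conjI ballI allI impI)
  have ip: "inner_product_on UNIV (G x)" if "x \<in> W" for x
    unfolding G[OF that] by (rule inner_product_on_radial_form) (simp_all add: hyp_A_pos hyp_A_B)
  have "smooth_on W (\<lambda>x. G x u v)" for u v
    unfolding smooth_on_open_iff[OF assms(1)]
    using Ck_on_cong[OF assms(1) _ Ck_on_subset[OF smooth_radial_form subset_UNIV], of u v] G by metis
  then show "metric_on W G" using ip by (simp add: metric_on_def)
  fix x u v :: 'a
  assume x: "x \<in> W" and uv: "u \<noteq> v \<and> independent {u, v}"
  \<comment> \<open>The formula is established on all of \<open>W\<close>, since the curvature at
    \<open>x\<close> differentiates the Christoffel symbols.\<close>
  have ch: "christoffel G y v w = radial_connection hyp_p hyp_q hyp_r y v w" if "y \<in> W" for y v w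
  proof -
    have "dir_deriv u (\<lambda>z. G z v w) y = dir_deriv u (\<lambda>z. radial_form hyp_A hyp_B z v w) y" for u v w
      by (rule dir_deriv_cong_open[OF assms(1) that]) (simp add: G)
    then have "christoffel G y v w = christoffel (radial_form hyp_A hyp_B) y v w"
      by (simp add: christoffel_def G[OF that])
    also have "\<dots> = radial_connection hyp_p hyp_q hyp_r y v w"
      by (rule christoffel_radial_form[OF hyp_A_deriv hyp_B_deriv])
        (simp_all add: hyp_A_pos hyp_A_B hyp_p_def hyp_q_def hyp_r_def)
    finally show ?thesis .
  qed
  have dch: "dir_deriv u (\<lambda>y. christoffel G y v w) x =
      dir_deriv u (\<lambda>y. radial_connection hyp_p hyp_q hyp_r y v w) x" for u v w
    by (rule dir_deriv_cong_open[OF assms(1) x ch])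
  obtain D where D: "(hyp_r has_real_derivative D) (at (x \<bullet> x))"
    using hyp_r_deriv[of "x \<bullet> x"] by auto
  have pos: "x \<bullet> x \<ge> 0" "x \<noteq> 0 \<Longrightarrow> x \<bullet> x > 0" by simp_all
  have "curvature G x u v v = G x u v *\<^sub>R v - G x v v *\<^sub>R u"
    unfolding curvature_def dch ch[OF x] G[OF x]
    by (rule radial_curvature_identity, rule hyp_p_deriv[OF pos(1)], rule hyp_q_deriv, rule D,
        rule hyp_constant_curvature_diag[OF pos(1)], erule hyp_constant_curvature_radial[OF pos(2)], erule hyp_constant_curvature_mixed[OF pos(2)])
  then show "sectional_curvature G x u v = -1"
    using sectional_curvature_eq_minus1[of G x u v] ip[OF x] uv by blast
qed

lemma hyperbolic_on_two_variable_warp: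
  assumes "cutoff \<rho>" "d > 0"
  shows "hyperbolic_on (ball 0 a) (two_variable_warp \<rho> a d g)"
  using assms by (intro hyperbolic_on_radial_form two_variable_warp_eq_radial_form) (auto simp: cutoff_def)

subsection \<open>Uniform \<open>C\<^sup>2\<close> bounds\<close>

text \<open>The bounds are stated for all directions and not only for basis vectors, which makes them
  stable under linear substitutions.\<close>

definition C2_bounded ::
    "'a::euclidean_space set \<Rightarrow> real \<Rightarrow> real \<Rightarrow> real \<Rightarrow> ('a \<Rightarrow> real) \<Rightarrow> bool" where
  "C2_bounded W K0 K1 K2 f \<longleftrightarrow> open W \<and> Ck_on 2 W f \<and>
     (\<forall>x\<in>W. \<bar>f x\<bar> \<le> K0 \<and> (\<forall>u. \<bar>dir_deriv u f x\<bar> \<le> K1 * norm u) \<and>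
       (\<forall>u v. \<bar>dir_deriv v (dir_deriv u f) x\<bar> \<le> K2 * norm u * norm v))"

lemma C2_boundedD:
  assumes "C2_bounded W K0 K1 K2 f"
  shows "open W" "Ck_on 2 W f" 
    "x \<in> W \<Longrightarrow> f differentiable (at x)" "x \<in> W \<Longrightarrow> dir_deriv u f differentiable (at x)"
    "x \<in> W \<Longrightarrow> \<bar>f x\<bar> \<le> K0" "x \<in> W \<Longrightarrow> \<bar>dir_deriv u f x\<bar> \<le> K1 * norm u"
    "x \<in> W \<Longrightarrow> \<bar>dir_deriv v (dir_deriv u f) x\<bar> \<le> K2 * norm u * norm v"
  using assms unfolding C2_bounded_def by (auto simp: numeral_2_eq_2)

lemma C2_bounded_cong:
  assumes "C2_bounded W K0 K1 K2 f" "\<And>x. x \<in> W \<Longrightarrow> f x = g x"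
  shows "C2_bounded W K0 K1 K2 g"
proof -
  note o = C2_boundedD(1)[OF assms(1)]
  have 1: "dir_deriv u f x = dir_deriv u g x" if "x \<in> W" for x u
    by (rule dir_deriv_cong_open[OF o that assms(2)])
  have 2: "dir_deriv v (dir_deriv u f) x = dir_deriv v (dir_deriv u g) x" if "x \<in> W" for x u v
    by (rule dir_deriv_cong_open[OF o that 1[of _ u]])
  have "Ck_on 2 W g" using Ck_on_cong[OF o, of f g] assms(2) C2_boundedD(2)[OF assms(1)] by blast
  then show ?thesis using assms 1 2 unfolding C2_bounded_def by metis
qed

lemma C2_bounded_mono:
  assumes "C2_bounded W K0 K1 K2 f" "K0 \<le> M0" "K1 \<le> M1" "K2 \<le> M2" 
  shows "C2_bounded W M0 M1 M2 f"
proof -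
  have "K1 * norm u \<le> M1 * norm u" "K2 * norm u * norm v \<le> M2 * norm u * norm v" for u v :: 'a
    using assms by (auto intro!: mult_right_mono)
  then show ?thesis using assms unfolding C2_bounded_def by (meson order_trans)
qed

lemma C2_bounded_const: "open W \<Longrightarrow> C2_bounded W \<bar>c\<bar> 0 0 (\<lambda>x. c)"
  unfolding C2_bounded_def by simp

lemma C2_bounded_add:
  assumes f: "C2_bounded W K0 K1 K2 f" and g: "C2_bounded W M0 M1 M2 g"
  shows "C2_bounded W (K0 + M0) (K1 + M1) (K2 + M2) (\<lambda>x. f x + g x)"
proof -
  note o = C2_boundedD(1)[OF f] and F = C2_boundedD[OF f] and G = C2_boundedD[OF g]
  have 1: "dir_deriv u (\<lambda>x. f x + g x) x = dir_deriv u f x + dir_deriv u g x" if "x \<in> W" for x u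
    using dir_deriv_add F(3)[OF that] G(3)[OF that] .
  have 2: "dir_deriv v (dir_deriv u (\<lambda>x. f x + g x)) x = dir_deriv v (dir_deriv u f) x + dir_deriv v (dir_deriv u g) x"
    if "x \<in> W" for x u v
  proof -
    have "dir_deriv v (dir_deriv u (\<lambda>x. f x + g x)) x = dir_deriv v (\<lambda>x. dir_deriv u f x + dir_deriv u g x) x"
      by (rule dir_deriv_cong_open[OF o that]) (rule 1)
    then show ?thesis using dir_deriv_add[OF F(4)[OF that] G(4)[OF that]] by simp
  qed
  have "\<bar>f x + g x\<bar> \<le> K0 + M0" if "x \<in> W" for x
    using F(5)[OF that] G(5)[OF that] by linarith
  moreover have "\<bar>dir_deriv u (\<lambda>x. f x + g x) x\<bar> \<le> (K1 + M1) * norm u" if "x \<in> W" for x u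
    unfolding 1[OF that] distrib_right using F(6)[OF that, of u] G(6)[OF that, of u] by linarith
  moreover have "\<bar>dir_deriv v (dir_deriv u (\<lambda>x. f x + g x)) x\<bar> \<le> (K2 + M2) * norm u * norm v" if "x \<in> W" for x u v
    unfolding 2[OF that] distrib_right using F(7)[OF that, of v u] G(7)[OF that, of v u] by linarith
  ultimately show ?thesis
    unfolding C2_bounded_def using o Ck_on_add[OF o F(2) G(2)] by blast
qed

lemma C2_bounded_mult:
  assumes f: "C2_bounded W K0 K1 K2 f" and g: "C2_bounded W M0 M1 M2 g"
    and nn: "K0 \<ge> 0" "K1 \<ge> 0" "K2 \<ge> 0"
  shows "C2_bounded W (K0 * M0) (K0 * M1 + K1 * M0) (K0 * M2 + 2 * K1 * M1 + K2 * M0) (\<lambda>x. f x * g x)"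
proof -
  note o = C2_boundedD(1)[OF f] and F = C2_boundedD[OF f] and G = C2_boundedD[OF g]
  note dm = bounded_bilinear.dir_deriv_prod[OF bounded_bilinear_mult]
  have dd: "(\<lambda>x. h x * k x) differentiable (at x)" if "h differentiable (at x)" "k differentiable (at x)"
    for h k :: "'a \<Rightarrow> real" and x using that by (rule differentiable_mult)
  have 1: "dir_deriv u (\<lambda>x. f x * g x) x = f x * dir_deriv u g x + dir_deriv u f x * g x" if "x \<in> W" for x u
    using dm[OF F(3)[OF that] G(3)[OF that]] .
  have 2: "dir_deriv v (dir_deriv u (\<lambda>x. f x * g x)) x =
      (f x * dir_deriv v (dir_deriv u g) x + dir_deriv v f x * dir_deriv u g x)
      + (dir_deriv u f x * dir_deriv v g x + dir_deriv v (dir_deriv u f) x * g x)"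
    if "x \<in> W" for x u v
  proof -
    have "dir_deriv v (dir_deriv u (\<lambda>x. f x * g x)) x = dir_deriv v (\<lambda>x. f x * dir_deriv u g x + dir_deriv u f x * g x) x"
      by (rule dir_deriv_cong_open[OF o that]) (rule 1)
    then show ?thesis
      using dir_deriv_add[OF dd[OF F(3) G(4)] dd[OF F(4) G(3)], OF that that that that]
      dm[OF F(3) G(4), OF that that] dm[OF F(4) G(3), OF that that] by simp
  qed
  have m: "\<bar>a * b\<bar> \<le> A * B" if "\<bar>a\<bar> \<le> A" "\<bar>b\<bar> \<le> B" for a b A B :: real
    unfolding abs_mult using that by (intro mult_mono) auto
  have "\<bar>f x * g x\<bar> \<le> K0 * M0" if "x \<in> W" for x
    using m[OF F(5) G(5), OF that that] .
  moreover have "\<bar>dir_deriv u (\<lambda>x. f x * g x) x\<bar> \<le> (K0 * M1 + K1 * M0) * norm u" if "x \<in> W" for x u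
    unfolding 1[OF that]
    using m[OF F(5) G(6), OF that that, of u] m[OF F(6) G(5), OF that that, of u] by (simp add: algebra_simps)
  moreover have "\<bar>dir_deriv v (dir_deriv u (\<lambda>x. f x * g x)) x\<bar> \<le> (K0 * M2 + 2 * K1 * M1 + K2 * M0) * norm u * norm v"
    if "x \<in> W" for x u v
    unfolding 2[OF that]
    using m[OF F(5) G(7), OF that that, of v u] m[OF F(7) G(5), OF that that, of v u]
      m[OF F(6) G(6), OF that that, of v u] m[OF F(6) G(6), OF that that, of u v] by (simp add: algebra_simps)
  ultimately show ?thesis
    unfolding C2_bounded_def using o Ck_on_mult[OF o F(2) G(2)] by blast
qed

text \<open>The factor \<open>4\<close> counts the terms of the second-order Leibniz rule.\<close>

lemma C2_bounded_mult':
  assumes "C2_bounded W K K K f" "C2_bounded W M M M g" "K \<ge> 0" "M \<ge> 0"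
  shows "C2_bounded W (4 * K * M) (4 * K * M) (4 * K * M) (\<lambda>x. f x * g x)"
  by (rule C2_bounded_mono[OF C2_bounded_mult[OF assms(1,2)]]) (use assms mult_nonneg_nonneg[of K M] in auto)

lemma C2_bounded_cmult:
  assumes "C2_bounded W K0 K1 K2 f"
  shows "C2_bounded W (\<bar>c\<bar> * K0) (\<bar>c\<bar> * K1) (\<bar>c\<bar> * K2) (\<lambda>x. c * f x)"
  using C2_bounded_mult[OF C2_bounded_const[OF C2_boundedD(1)[OF assms]] assms, of c] by simp

lemma C2_bounded_diff:
  assumes f: "C2_bounded W K0 K1 K2 f" and g: "C2_bounded W M0 M1 M2 g"
  shows "C2_bounded W (K0 + M0) (K1 + M1) (K2 + M2) (\<lambda>x. f x - g x)"
  using C2_bounded_add[OF f C2_bounded_cmult[OF g, of "-1"]] by simp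

lemma C2_bounded_sum:
  assumes "finite I" "open W" "\<And>i. i \<in> I \<Longrightarrow> C2_bounded W (K0 i) (K1 i) (K2 i) (f i)"
  shows "C2_bounded W (sum K0 I) (sum K1 I) (sum K2 I) (\<lambda>x. \<Sum>i\<in>I. f i x)"
  using assms
proof (induction I rule: finite_induct)
  case empty
  then show ?case using C2_bounded_const[of W 0] by simp
next
  case (insert i I)
  then show ?case using C2_bounded_add[of W "K0 i" "K1 i" "K2 i" "f i"] by simp
qed

text \<open>Each derivative of the composite brings one factor \<open>l\<close>: passing to a small
  chart damps the derivatives but not the supremum.\<close>

lemma C2_bounded_affine_comp:
  fixes L :: "'c::euclidean_space \<Rightarrow> 'a::euclidean_space"
  assumes f: "C2_bounded W K0 K1 K2 f" and V: "open V" "\<And>x. x \<in> V \<Longrightarrow> c + L x \<in> W"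
    and L: "bounded_linear L" "\<And>x. norm (L x) \<le> l * norm x" and K: "K1 \<ge> 0" "K2 \<ge> 0" "l \<ge> 0"
  shows "C2_bounded V K0 (l * K1) (l\<^sup>2 * K2) (\<lambda>x. f (c + L x))"
proof -
  note F = C2_boundedD[OF f]
  have 1: "dir_deriv u (\<lambda>x. f (c + L x)) x = dir_deriv (L u) f (c + L x)" if "x \<in> V" for x u
    by (rule dir_deriv_affine_comp[OF L(1) F(3)[OF V(2)[OF that]]])
  have 2: "dir_deriv v (dir_deriv u (\<lambda>x. f (c + L x))) x = dir_deriv (L v) (dir_deriv (L u) f) (c + L x)"
    if "x \<in> V" for x u v
  proof -
    have "dir_deriv v (dir_deriv u (\<lambda>x. f (c + L x))) x = dir_deriv v (\<lambda>x. dir_deriv (L u) f (c + L x)) x"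
      by (rule dir_deriv_cong_open[OF V(1) that]) (rule 1)
    then show ?thesis using dir_deriv_affine_comp[OF L(1) F(4)[OF V(2)[OF that]]] by simp
  qed
  have "\<bar>dir_deriv u (\<lambda>x. f (c + L x)) x\<bar> \<le> l * K1 * norm u" if "x \<in> V" for x u
    unfolding 1[OF that] using F(6)[OF V(2)[OF that], of "L u"] mult_left_mono[OF L(2)[of u] K(1)]
    by (simp add: mult_ac)
  moreover have "\<bar>dir_deriv v (dir_deriv u (\<lambda>x. f (c + L x))) x\<bar> \<le> l\<^sup>2 * K2 * norm u * norm v" if "x \<in> V" for x u v
  proof -
    have "norm (L u) * norm (L v) \<le> (l * norm u) * (l * norm v)"
      using L(2) K by (intro mult_mono) auto
    from mult_left_mono[OF this K(2)] show ?thesis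
      unfolding 2[OF that] using F(7)[OF V(2)[OF that], of "L v" "L u"]
      by (simp add: mult_ac power2_eq_square)
  qed
  moreover have "Ck_on 2 V (\<lambda>x. f (c + L x))"
    by (rule Ck_on_subset[OF Ck_on_affine_comp[OF F(1) L(1) F(2)]]) (use V in auto)
  ultimately show ?thesis using V F(5) unfolding C2_bounded_def by blast
qed

lemma C2_bounded_fst:
  assumes "C2_bounded V K0 K1 K2 f" "open J" "K1 \<ge> 0" "K2 \<ge> 0"
  shows "C2_bounded (V \<times> J) K0 K1 K2 (\<lambda>z. f (fst z))"
  using C2_bounded_affine_comp[OF assms(1), of "V \<times> J" 0 fst 1] C2_boundedD(1)[OF assms(1)] assms
  by (auto simp: open_Times norm_fst_le bounded_linear_fst)

lemma C2_bounded_snd: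
  assumes "C2_bounded J K0 K1 K2 f" "open V" "K1 \<ge> 0" "K2 \<ge> 0"
  shows "C2_bounded (V \<times> J) K0 K1 K2 (\<lambda>z. f (snd z))"
  using C2_bounded_affine_comp[OF assms(1), of "V \<times> J" 0 snd 1] C2_boundedD(1)[OF assms(1)] assms
  by (auto simp: open_Times norm_snd_le bounded_linear_snd)

text \<open>By the mean value inequality, a zero at one point of a convex set lets the
  first-derivative bound replace \<open>K0\<close>. This supplies the smallness of the supremum that
  rescaling alone does not give.\<close>

lemma C2_bounded_vanishing:
  assumes f: "C2_bounded W K0 K1 K2 f" and W: "convex W" "p \<in> W" "f p = 0"
    and r: "\<And>x. x \<in> W \<Longrightarrow> norm (x - p) \<le> r" and "K1 \<ge> 0"
  shows "C2_bounded W (K1 * r) K1 K2 f"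
proof -
  note F = C2_boundedD[OF f]
  have "\<bar>f x\<bar> \<le> K1 * r" if "x \<in> W" for x
  proof -
    have "norm (f x - f p) \<le> K1 * norm (x - p)"
      using W that
    proof (rule_tac differentiable_bound[of W f "\<lambda>x v. dir_deriv v f x"])
      show "(f has_derivative (\<lambda>v. dir_deriv v f x)) (at x within W)" if "x \<in> W" for x
        using has_derivative_dir_deriv[OF F(3)[OF that]] has_derivative_at_withinI by blast
      show "onorm (\<lambda>v. dir_deriv v f x) \<le> K1" if "x \<in> W" for x
        using F(6)[OF that] assms(6) by (intro onorm_bound) auto
    qed auto
    also have "\<dots> \<le> K1 * r" using r[OF that] assms(6) by (rule mult_left_mono)
    finally show ?thesis using W by simp
  qed
  then show ?thesis using f unfolding C2_bounded_def by blast
qed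

lemma C2_bounded_real:
  fixes f :: "real \<Rightarrow> real"
  assumes "open J" and f: "\<And>t. t \<in> J \<Longrightarrow> (f has_real_derivative f1 t) (at t)"
    and f1: "\<And>t. t \<in> J \<Longrightarrow> (f1 has_real_derivative f2 t) (at t)" and f2: "continuous_on J f2"
    and b: "\<And>t. t \<in> J \<Longrightarrow> \<bar>f t\<bar> \<le> K0" "\<And>t. t \<in> J \<Longrightarrow> \<bar>f1 t\<bar> \<le> K1" "\<And>t. t \<in> J \<Longrightarrow> \<bar>f2 t\<bar> \<le> K2"
  shows "C2_bounded J K0 K1 K2 f"
proof -
  have 1: "dir_deriv u f t = f1 t * u" if "t \<in> J" for t u
    using dir_deriv_eq[OF has_field_derivative_imp_has_derivative[OF f[OF that]]] .
  have g: "((\<lambda>t. f1 t * u) has_real_derivative f2 t * u) (at t)" if "t \<in> J" for t u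
    using DERIV_cmult_right[OF f1[OF that]] .
  have 2: "dir_deriv v (dir_deriv u f) t = f2 t * u * v" if "t \<in> J" for t u v
  proof -
    have "dir_deriv v (dir_deriv u f) t = dir_deriv v (\<lambda>t. f1 t * u) t"
      by (rule dir_deriv_cong_open[OF assms(1) that]) (rule 1)
    then show ?thesis
      using dir_deriv_eq[OF has_field_derivative_imp_has_derivative[OF g[OF that]]] by simp
  qed
  have "Ck_on 2 J f"
    unfolding numeral_2_eq_2 Ck_on.simps
  proof (intro conjI ballI allI)
    show "f differentiable (at t)" if "t \<in> J" for t
      using f[OF that] real_differentiable_def by blast
    show "dir_deriv u f differentiable (at t)" if "t \<in> J" for t u
      using differentiable_cong_open[OF assms(1) that, of "\<lambda>t. f1 t * u" "dir_deriv u f"] 1 g[OF that]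
        real_differentiable_def by metis
    have "continuous_on J (\<lambda>t. f2 t * u * v)" for u v by (intro continuous_intros f2)
    then show "continuous_on J (dir_deriv v (dir_deriv u f))" for u v
      by (rule continuous_on_eq) (rule 2[symmetric])
  qed
  then show ?thesis using assms(1) b unfolding C2_bounded_def
    by (auto simp: 1 2 abs_mult intro!: mult_right_mono)
qed

section \<open>Passage between basis directions and arbitrary directions\<close>

lemma dir_deriv_basis_sum:
  assumes "f differentiable (at x)"
  shows "dir_deriv u f x = (\<Sum>i\<in>Basis. (u \<bullet> i) *\<^sub>R dir_deriv i f x)"
proof -
  note l = linear_dir_deriv[OF assms]
  have "dir_deriv u f x = dir_deriv (\<Sum>i\<in>Basis. (u \<bullet> i) *\<^sub>R i) f x" by (simp add: euclidean_representation)
  then show ?thesis by (simp add: linear_sum[OF l] linear_scale[OF l])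
qed

lemma dir_deriv2_basis_sum:
  assumes "open W" "Ck_on 2 W f" "x \<in> W"
  shows "dir_deriv v (dir_deriv u f) x =
    (\<Sum>i\<in>Basis. \<Sum>j\<in>Basis. ((u \<bullet> i) * (v \<bullet> j)) *\<^sub>R dir_deriv j (dir_deriv i f) x)"
proof -
  have F: "f differentiable (at y)" "dir_deriv w f differentiable (at y)" if "y \<in> W" for y w
    using assms(2) that by (auto simp: numeral_2_eq_2)
  have "dir_deriv v (dir_deriv u f) x = dir_deriv v (\<lambda>x. \<Sum>i\<in>Basis. (u \<bullet> i) *\<^sub>R dir_deriv i f x) x"
    by (rule dir_deriv_cong_open[OF assms(1,3) dir_deriv_basis_sum[OF F(1)]])
  also have "\<dots> = (\<Sum>i\<in>Basis. (u \<bullet> i) *\<^sub>R dir_deriv v (dir_deriv i f) x)"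
    by (intro dir_deriv_eq has_derivative_sum has_derivative_scaleR_right has_derivative_dir_deriv F(2) assms)
  also have "\<dots> = (\<Sum>i\<in>Basis. (u \<bullet> i) *\<^sub>R (\<Sum>j\<in>Basis. (v \<bullet> j) *\<^sub>R dir_deriv j (dir_deriv i f) x))"
    using dir_deriv_basis_sum[OF F(2)[OF assms(3)]] by metis
  finally show ?thesis by (simp add: scaleR_sum_right)
qed

text \<open>Expanding the directions in the basis costs a factor of the dimension per derivative;
  its square is used for all three orders.\<close>

lemma C2_bounded_from_basis:
  fixes f :: "'a::euclidean_space \<Rightarrow> real"
  assumes W: "open W" "Ck_on 2 W f" and K: "K \<ge> 0"
    and b: "\<And>x. x \<in> W \<Longrightarrow> \<bar>f x\<bar> \<le> K" "\<And>x i. x \<in> W \<Longrightarrow> i \<in> Basis \<Longrightarrow> \<bar>dir_deriv i f x\<bar> \<le> K"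
      "\<And>x i j. x \<in> W \<Longrightarrow> i \<in> Basis \<Longrightarrow> j \<in> Basis \<Longrightarrow> \<bar>dir_deriv j (dir_deriv i f) x\<bar> \<le> K"
  shows "C2_bounded W ((real DIM('a))\<^sup>2 * K) ((real DIM('a))\<^sup>2 * K) ((real DIM('a))\<^sup>2 * K) f"
proof -
  have D: "1 \<le> real DIM('a)" using DIM_positive[where 'a = 'a] by linarith
  then have D2: "real DIM('a) \<le> (real DIM('a))\<^sup>2" by (simp add: power2_eq_square)
  have "\<bar>dir_deriv u f x\<bar> \<le> (real DIM('a))\<^sup>2 * K * norm u" if "x \<in> W" for x u
  proof -
    have "f differentiable (at x)" using W that by (auto simp: numeral_2_eq_2)
    then have "\<bar>dir_deriv u f x\<bar> \<le> (\<Sum>i\<in>Basis. \<bar>(u \<bullet> i) *\<^sub>R dir_deriv i f x\<bar>)"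
      using sum_abs[of "\<lambda>i. (u \<bullet> i) *\<^sub>R dir_deriv i f x" Basis] dir_deriv_basis_sum[of f x u] by simp
    also have "\<dots> \<le> (\<Sum>i\<in>(Basis::'a set). norm u * K)"
      using b(2)[OF that] Basis_le_norm[of _ u] by (intro sum_mono) (auto simp: abs_mult intro!: mult_mono)
    also have "\<dots> = real DIM('a) * (K * norm u)" by simp
    also have "\<dots> \<le> (real DIM('a))\<^sup>2 * (K * norm u)" using D2 K by (intro mult_right_mono) auto
    finally show ?thesis by (simp add: mult.assoc)
  qed
  moreover have "\<bar>dir_deriv v (dir_deriv u f) x\<bar> \<le> (real DIM('a))\<^sup>2 * K * norm u * norm v" if "x \<in> W" for x u v
  proof -
    have "\<bar>dir_deriv v (dir_deriv u f) x\<bar>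
        \<le> (\<Sum>i\<in>Basis. \<Sum>j\<in>Basis. \<bar>((u \<bullet> i) * (v \<bullet> j)) *\<^sub>R dir_deriv j (dir_deriv i f) x\<bar>)"
      unfolding dir_deriv2_basis_sum[OF W that, of v u] by (intro sum_abs[THEN order_trans] sum_mono sum_abs)
    also have "\<dots> \<le> (\<Sum>i\<in>(Basis::'a set). \<Sum>j\<in>(Basis::'a set). (norm u * norm v) * K)"
      using b(3)[OF that] Basis_le_norm[of _ u] Basis_le_norm[of _ v]
      by (intro sum_mono) (auto simp: abs_mult intro!: mult_mono)
    also have "\<dots> = (real DIM('a))\<^sup>2 * K * norm u * norm v" by (simp add: power2_eq_square)
    finally show ?thesis .
  qed
  moreover have "\<bar>f x\<bar> \<le> (real DIM('a))\<^sup>2 * K" if "x \<in> W" for x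
    using b(1)[OF that] mult_right_mono[OF order_trans[OF D D2] K] by simp
  ultimately show ?thesis using W unfolding C2_bounded_def by blast
qed

lemma C2_norm_fun_le:
  assumes "C2_bounded W K K K f"
  shows "C2_norm_fun W f \<le> ennreal K"
proof -
  note F = C2_boundedD[OF assms]
  have "\<bar>dir_deriv i f x\<bar> \<le> K" "\<bar>dir_deriv j (dir_deriv i f) x\<bar> \<le> K"
    if "x \<in> W" "i \<in> Basis" "j \<in> Basis" for x i j
    using F(6)[OF that(1), of i] F(7)[OF that(1), of j i] that by simp_all
  then have "(SUP x\<in>W. ennreal \<bar>f x\<bar>) \<le> ennreal K"
    "(SUP k\<in>Basis. SUP x\<in>W. ennreal \<bar>dir_deriv k f x\<bar>) \<le> ennreal K"
    "(SUP k\<in>Basis. SUP l\<in>Basis. SUP x\<in>W. ennreal \<bar>dir_deriv l (dir_deriv k f) x\<bar>) \<le> ennreal K"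
    using F(5) by (auto intro!: SUP_least ennreal_leI)
  then show ?thesis unfolding C2_norm_fun_def by simp
qed

lemma C2_norm_funD:
  assumes "C2_norm_fun W f < ennreal c" "x \<in> W"
  shows "\<bar>f x\<bar> \<le> c" "i \<in> Basis \<Longrightarrow> \<bar>dir_deriv i f x\<bar> \<le> c"
    "i \<in> Basis \<Longrightarrow> j \<in> Basis \<Longrightarrow> \<bar>dir_deriv j (dir_deriv i f) x\<bar> \<le> c"
proof -
  \<comment> \<open>\<open>ennreal\<close> maps negative numbers to \<open>0\<close>, so the strict
    bound forces \<open>c\<close> to be positive and the return to real inequalities is
    faithful.\<close>
  have c: "c > 0" using assms(1) by (metis ennreal_eq_0_iff not_le not_less_zero)
  have S: "(SUP x\<in>W. ennreal \<bar>f x\<bar>) < ennreal c"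
    "(SUP k\<in>Basis. SUP x\<in>W. ennreal \<bar>dir_deriv k f x\<bar>) < ennreal c"
    "(SUP k\<in>Basis. SUP l\<in>Basis. SUP x\<in>W. ennreal \<bar>dir_deriv l (dir_deriv k f) x\<bar>) < ennreal c"
    using assms(1) unfolding C2_norm_fun_def by (auto simp: Max_less_iff)
  have e: "\<bar>y\<bar> \<le> c" if "ennreal \<bar>y\<bar> \<le> s" "s < ennreal c" for y s
    using order_le_less_trans[OF that] c by (simp add: ennreal_less_iff)
  show "\<bar>f x\<bar> \<le> c" by (rule e[OF SUP_upper[OF assms(2)] S(1)])
  show "\<bar>dir_deriv i f x\<bar> \<le> c" if "i \<in> Basis"
    by (rule e[OF order_trans[OF SUP_upper[OF assms(2)] SUP_upper[OF that]] S(2)])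
  show "\<bar>dir_deriv j (dir_deriv i f) x\<bar> \<le> c" if "i \<in> Basis" "j \<in> Basis"
    by (rule e[OF order_trans[OF SUP_upper[OF assms(2)] order_trans[OF SUP_upper[OF that(2)] SUP_upper[OF that(1)]]] S(3)])
qed

subsection \<open>Positive definite forms\<close>

text \<open>If \<open>w = M *v u\<close> were nonzero, moving from \<open>u\<close> a suitable
  distance against \<open>w\<close> would make the quadratic form negative.\<close>

lemma psd_form_zero_imp_kernel:
  fixes M :: "real^'n^'n"
  assumes sym: "\<And>i j. M$i$j = M$j$i" and psd: "\<And>u. 0 \<le> u \<bullet> (M *v u)" and z: "u \<bullet> (M *v u) = 0"
  shows "M *v u = 0"
proof (rule ccontr)
  assume n: "M *v u \<noteq> 0"
  define w a b where d: "w = M *v u" "a = w \<bullet> w" "b = w \<bullet> (M *v w)"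
  have "transpose M = M" using sym by (simp add: transpose_def vec_eq_iff)
  then have s: "x \<bullet> (M *v y) = (M *v x) \<bullet> y" for x y
    by (metis dot_lmul_matrix transpose_matrix_vector)
  have a: "a > 0" and b: "b \<ge> 0" using n psd by (simp_all add: d)
  \<comment> \<open>Dividing by \<open>b + 1\<close> instead of the minimizing \<open>b\<close> also
    covers \<open>b = 0\<close>.\<close>
  define t where "t = - a / (b + 1)"
  have "0 \<le> (u + t *\<^sub>R w) \<bullet> (M *v (u + t *\<^sub>R w))" by (rule psd)
  also have "\<dots> = 2 * t * a + t\<^sup>2 * b"
    using z s[of u w] by (simp add: d matrix_vector_right_distrib matrix_vector_mult_scaleR
        inner_add_left inner_add_right algebra_simps power2_eq_square inner_commute)
  also have "\<dots> = a\<^sup>2 / (b + 1)\<^sup>2 * (- b - 2)"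
    using b by (simp add: t_def divide_simps power2_eq_square) (simp add: algebra_simps)
  also have "\<dots> < 0" using a b by (intro mult_pos_neg divide_pos_pos) auto
  finally show False by simp
qed

lemma det_nonzero_kernel:
  fixes M :: "real^'n^'n"
  assumes "det M \<noteq> 0" "M *v u = 0"
  shows "u = 0"
  using assms invertible_det_nz[of M] matrix_left_invertible_ker[of M] invertible_left_inverse[of M] by metis

text \<open>The matrices allowed here form a compact set, so the smallest eigenvalue has a minimum.\<close>

lemma psd_uniformly_positive:
  assumes "\<delta> > 0"
  shows "\<exists>\<kappa>>0. \<forall>M::real^'n^'n. (\<forall>i j. M$i$j = M$j$i) \<longrightarrow> (\<forall>u. 0 \<le> u \<bullet> (M *v u)) \<longrightarrow>
    (\<forall>i j. \<bar>M$i$j\<bar> \<le> c) \<longrightarrow> \<bar>det M\<bar> \<ge> \<delta> \<longrightarrow> (\<forall>u. \<kappa> * (norm u)\<^sup>2 \<le> u \<bullet> (M *v u))"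
proof -
  \<comment> \<open>Positive definiteness is not a closed condition. Semidefiniteness and the
    determinant bound are both closed, and together they exclude a kernel.\<close>
  define S where "S = {M::real^'n^'n. (\<forall>i j. M$i$j = M$j$i) \<and> (\<forall>u. 0 \<le> u \<bullet> (M *v u)) \<and>
    (\<forall>i j. \<bar>M$i$j\<bar> \<le> c) \<and> \<delta> \<le> \<bar>det M\<bar>}"
  have cdet: "continuous_on UNIV (\<lambda>M::real^'n^'n. \<bar>det M\<bar>)"
    unfolding det_def by (intro continuous_intros)
  have cform: "continuous_on UNIV (\<lambda>M::real^'n^'n. u \<bullet> (M *v u))" for u
    unfolding matrix_vector_mult_def inner_vec_def by (auto intro!: continuous_intros)
  have "closed S" unfolding S_def
    by (intro closed_Collect_conj closed_Collect_all closed_Collect_eq closed_Collect_le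
        continuous_on_const cform cdet continuous_intros)
  moreover have "bounded S"
  proof (rule boundedI)
    fix M :: "real^'n^'n" assume "M \<in> S"
    then have "\<bar>M$i$j\<bar> \<le> c" for i j by (simp add: S_def)
    then have "norm (M$i) \<le> (\<Sum>j\<in>(UNIV::'n set). c)" for i
      by (intro norm_le_l1_cart[THEN order_trans] sum_mono) simp
    then have "(\<Sum>i\<in>UNIV. norm (M$i)) \<le> (\<Sum>i\<in>(UNIV::'n set). \<Sum>j\<in>(UNIV::'n set). c)"
      by (intro sum_mono)
    moreover have "norm M \<le> (\<Sum>i\<in>UNIV. norm (M$i))"
      unfolding norm_vec_def[of M] by (rule L2_set_le_sum) simp
    ultimately show "norm M \<le> (\<Sum>i\<in>(UNIV::'n set). \<Sum>j\<in>(UNIV::'n set). c)" by linarith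
  qed
  ultimately have comp: "compact (S \<times> sphere (0::real^'n) 1)"
    by (intro compact_Times compact_sphere) (simp add: compact_eq_bounded_closed)
  show ?thesis
  proof (cases "S = {}")
    case True
    then have "M \<notin> S" for M by simp
    then show ?thesis unfolding S_def mem_Collect_eq using zero_less_one by metis
  next
    case False
    have cont: "continuous_on (S \<times> sphere (0::real^'n) 1) (\<lambda>z. snd z \<bullet> (fst z *v snd z))"
      unfolding matrix_vector_mult_def inner_vec_def by (auto intro!: continuous_intros)
    have "S \<times> sphere (0::real^'n) 1 \<noteq> {}" using False by simp
    from continuous_attains_inf[OF comp this cont]
    obtain z where z: "z \<in> S \<times> sphere (0::real^'n) 1"
      "\<forall>y\<in>S \<times> sphere (0::real^'n) 1. snd z \<bullet> (fst z *v snd z) \<le> snd y \<bullet> (fst y *v snd y)"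
      by (rule bexE)
    obtain M0 u0 where z0: "z = (M0, u0)" by (cases z)
    define \<kappa> where "\<kappa> = u0 \<bullet> (M0 *v u0)"
    have M0: "M0 \<in> S" and u0: "norm u0 = 1" using z(1) by (auto simp: z0)
    have "\<kappa> \<noteq> 0"
    proof
      assume "\<kappa> = 0"
      then have "M0 *v u0 = 0"
        using M0 psd_form_zero_imp_kernel[of M0 u0] by (auto simp: \<kappa>_def S_def)
      then show False using det_nonzero_kernel[of M0 u0] M0 u0 assms by (auto simp: S_def)
    qed
    moreover have "\<kappa> \<ge> 0" using M0 by (simp add: S_def \<kappa>_def)
    moreover have "\<kappa> * (norm u)\<^sup>2 \<le> u \<bullet> (M *v u)" if "M \<in> S" for M u
    proof (cases "u = 0")
      case False
      define w where "w = u /\<^sub>R norm u"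
      have "u = norm u *\<^sub>R w" "norm w = 1" using False by (simp_all add: w_def)
      moreover from this have "\<kappa> \<le> w \<bullet> (M *v w)"
        using z(2) that by (auto simp: z0 \<kappa>_def)
      ultimately have "\<kappa> * (norm u)\<^sup>2 \<le> (w \<bullet> (M *v w)) * (norm u)\<^sup>2" by (intro mult_right_mono) auto
      also have "\<dots> = (norm u *\<^sub>R w) \<bullet> (M *v (norm u *\<^sub>R w))"
        by (simp add: matrix_vector_mult_scaleR power2_eq_square)
      finally show ?thesis using \<open>u = norm u *\<^sub>R w\<close> by simp
    qed simp
    ultimately show ?thesis by (intro exI[of _ \<kappa>]) (auto simp: S_def)
  qed
qed

text \<open>Gram-Schmidt for \<open>B\<close>, by induction over sets of indices. As long as the set
  is proper, its vectors cannot span the space, so a vector outside the span is available for the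
  next step.\<close>

lemma orthonormal_family_exists:
  fixes B :: "real^'n \<Rightarrow> real^'n \<Rightarrow> real"
  assumes ip: "inner_product_on UNIV B"
  shows "\<exists>b::'n \<Rightarrow> real^'n. \<forall>i j. B (b i) (b j) = (if i = j then 1 else 0)"
proof -
  have sym: "B x y = B y x" and add: "B (x + y) z = B x z + B y z"
    and scale: "B (t *\<^sub>R x) z = t * B x z" and pos: "x \<noteq> 0 \<Longrightarrow> B x x > 0" for x y z t
    using ip unfolding inner_product_on_def by auto
  have lin: "linear (\<lambda>x. B x z)" for z by (rule linearI) (simp_all add: add scale)
  have "\<exists>b::'n \<Rightarrow> real^'n. \<forall>i\<in>S. \<forall>j\<in>S. B (b i) (b j) = (if i = j then 1 else 0)" for S :: "'n set"
    using finite[of S]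
  proof (induction S rule: finite_induct)
    case (insert k S)
    then obtain b :: "'n \<Rightarrow> real^'n" where b: "\<And>i j. i \<in> S \<Longrightarrow> j \<in> S \<Longrightarrow> B (b i) (b j) = (if i = j then 1 else 0)"
      by blast
    have "card S < CARD('n)" using insert by (intro psubset_card_mono) auto
    then have "dim (b ` S) < DIM(real^'n)"
      using dim_le_card'[of "b ` S"] card_image_le[of S b] insert.hyps by simp
    then obtain v where v: "v \<notin> span (b ` S)"
      using dim_span[of "b ` S"] dim_UNIV by (metis UNIV_eq_I nless_le)
    define w where "w = v - (\<Sum>i\<in>S. B v (b i) *\<^sub>R b i)"
    have "(\<Sum>i\<in>S. B v (b i) *\<^sub>R b i) \<in> span (b ` S)"
      by (intro span_sum span_scale span_base) auto
    then have "w \<noteq> 0" using v by (auto simp: w_def)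
    then have ww: "B w w > 0" by (rule pos)
    have wb: "B w (b j) = 0" if "j \<in> S" for j
    proof -
      have "B w (b j) = B v (b j) - (\<Sum>i\<in>S. B v (b i) * B (b i) (b j))"
        unfolding w_def by (simp add: linear_diff[OF lin] linear_sum[OF lin] scale)
      also have "(\<Sum>i\<in>S. B v (b i) * B (b i) (b j)) = (\<Sum>i\<in>S. if i = j then B v (b i) else 0)"
        using that b by (intro sum.cong) auto
      also have "\<dots> = B v (b j)" using that insert.hyps by simp
      finally show ?thesis by simp
    qed
    define b' where "b' = b(k := (1 / sqrt (B w w)) *\<^sub>R w)"
    have "B (b' k) (b' k) = 1"
      using ww by (simp add: b'_def scale sym[of w "_ *\<^sub>R w"] divide_simps real_sqrt_mult_self)
    moreover have "B (b' k) (b' j) = 0" "B (b' j) (b' k) = 0" if "j \<in> S" for j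
      using wb[OF that] that insert.hyps sym[of "b' j"] by (auto simp: b'_def scale)
    moreover have "B (b' i) (b' j) = (if i = j then 1 else 0)" if "i \<in> S" "j \<in> S" for i j
      using b[OF that] that insert.hyps by (auto simp: b'_def)
    ultimately show ?case using insert.hyps by (intro exI[of _ b']) auto
  qed simp
  from this[of UNIV] show ?thesis by simp
qed

text \<open>\<open>L\<close> maps the standard basis to a \<open>B\<close>-orthonormal one and
  \<open>L'\<close> reads off coordinates by pairing with that basis. The bound on \<open>L\<close>
  is the lower bound of \<open>B\<close> at \<open>L x\<close>, since
  \<open>B (L x) (L x) = x \<bullet> x\<close>.\<close>

lemma orthonormal_frame:
  fixes B :: "real^'n \<Rightarrow> real^'n \<Rightarrow> real"
  assumes ip: "inner_product_on UNIV B" and k: "\<kappa> > 0" "\<And>u. \<kappa> * (norm u)\<^sup>2 \<le> B u u"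
  obtains L L' :: "real^'n \<Rightarrow> real^'n" where "bounded_linear L" "bounded_linear L'" "\<forall>y. L (L' y) = y" "\<forall>x. L' (L x) = x"
    "\<forall>u v. B (L u) (L v) = u \<bullet> v" "\<forall>x. norm (L x) \<le> (1 / sqrt \<kappa>) * norm x"
proof -
  have sym: "B x y = B y x" and add: "B (x + y) z = B x z + B y z"
    and scale: "B (t *\<^sub>R x) z = t * B x z" for x y z t
    using ip unfolding inner_product_on_def by auto
  have lin: "linear (\<lambda>x. B x z)" for z by (rule linearI) (simp_all add: add scale)
  obtain b :: "'n \<Rightarrow> real^'n" where b: "\<And>i j. B (b i) (b j) = (if i = j then 1 else 0)"
    using orthonormal_family_exists[OF ip] by blast
  define L where "L = (\<lambda>x::real^'n. \<Sum>i\<in>UNIV. x$i *\<^sub>R b i)"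
  define L' where "L' = (\<lambda>y. \<chi> j. B y (b j))"
  have L: "linear L" by (rule linearI) (simp_all add: L_def sum.distrib scaleR_add_left scaleR_sum_right)
  have L': "linear L'" by (rule linearI) (simp_all add: L'_def vec_eq_iff add scale)
  have Lb: "B (L x) (b j) = x$j" for x j
    by (simp add: L_def linear_sum[OF lin] scale b if_distrib cong: if_cong)
  then have 1: "L' (L x) = x" for x by (simp add: L'_def vec_eq_iff)
  then have "L' \<circ> L = id" by auto
  then have "L \<circ> L' = id" using linear_inverse_left[OF L' L] by blast
  then have 2: "L (L' y) = y" for y by (metis comp_apply id_apply)
  have 3: "B (L u) (L v) = u \<bullet> v" for u v
  proof -
    have "B (L u) (L v) = (\<Sum>i\<in>UNIV. v$i * B (b i) (L u))"
      unfolding sym[of "L u"] by (subst (1) L_def) (simp add: linear_sum[OF lin] scale)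
    also have "\<dots> = (\<Sum>i\<in>UNIV. v$i * u$i)" by (simp add: sym[of _ "L u"] Lb)
    finally show ?thesis by (simp add: inner_vec_def mult.commute)
  qed
  have 4: "norm (L x) \<le> (1 / sqrt \<kappa>) * norm x" for x
  proof -
    have "\<kappa> * (norm (L x))\<^sup>2 \<le> (norm x)\<^sup>2" using k(2)[of "L x"] by (simp add: 3 power2_norm_eq_inner)
    then have "(sqrt \<kappa> * norm (L x))\<^sup>2 \<le> (norm x)\<^sup>2" using k(1) by (simp add: power_mult_distrib)
    then have "sqrt \<kappa> * norm (L x) \<le> norm x" by (rule power2_le_imp_le) simp
    then show ?thesis using k(1) by (simp add: field_simps)
  qed
  show ?thesis by (rule that[of L L']) (use L L' 1 2 3 4 in \<open>auto simp: linear_linear\<close>)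
qed

subsection \<open>Control of the metrics in the charts of the atlas\<close>

text \<open>The bounds from below and from above share one \<open>K\<close>, in a form that weakens
  as \<open>K\<close> grows, so that constants of different origin can be merged by a
  maximum.\<close>

definition chart_controlled ::
    "real \<Rightarrow> (real^'n) set \<Rightarrow> (real^'n \<Rightarrow> (real^'n) \<times> real) \<Rightarrow> ((real^'n) \<times> real) tensor \<Rightarrow> bool" where
  "chart_controlled K U \<psi> g \<longleftrightarrow>
     (\<forall>y\<in>U. inner_product_on UNIV (pullback \<psi> g y) \<and> (\<forall>u. (norm u)\<^sup>2 \<le> K * pullback \<psi> g y u u)) \<and>
     (\<forall>u v. C2_bounded U (K * norm u * norm v) (K * norm u * norm v) (K * norm u * norm v)
        (\<lambda>y. pullback \<psi> g y u v))"

lemma chart_controlled_mono: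
  fixes g :: "((real^'n) \<times> real) tensor"
  assumes "chart_controlled K U \<psi> g" "K \<le> K'"
  shows "chart_controlled K' U \<psi> g"
  unfolding chart_controlled_def
proof (intro conjI ballI allI)
  fix y u assume y: "y \<in> U"
  have ip: "inner_product_on UNIV (pullback \<psi> g y)" using assms(1) y by (simp add: chart_controlled_def)
  then show "inner_product_on UNIV (pullback \<psi> g y)" .
  have "pullback \<psi> g y u u \<ge> 0"
  proof (cases "u = 0")
    case True
    have "pullback \<psi> g y (0 *\<^sub>R u) u = 0 * pullback \<psi> g y u u"
      using ip unfolding inner_product_on_def by blast
    then show ?thesis using True by simp
  next
    case False
    then show ?thesis using ip unfolding inner_product_on_def by (simp add: less_imp_le)
  qed
  then have "K * pullback \<psi> g y u u \<le> K' * pullback \<psi> g y u u" by (rule mult_right_mono[OF assms(2)])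
  moreover have "(norm u)\<^sup>2 \<le> K * pullback \<psi> g y u u" using assms(1) y by (simp add: chart_controlled_def)
  ultimately show "(norm u)\<^sup>2 \<le> K' * pullback \<psi> g y u u" by linarith
next
  fix u v :: "real^'n"
  have "K * norm u * norm v \<le> K' * norm u * norm v"
    using assms(2) by (intro mult_right_mono) auto
  moreover have "C2_bounded U (K * norm u * norm v) (K * norm u * norm v) (K * norm u * norm v)
        (\<lambda>y. pullback \<psi> g y u v)" using assms(1) by (simp add: chart_controlled_def)
  ultimately show "C2_bounded U (K' * norm u * norm v) (K' * norm u * norm v) (K' * norm u * norm v)
        (\<lambda>y. pullback \<psi> g y u v)"
    using C2_bounded_mono by blast
qed

lemma inner_product_basis_sum:
  fixes B :: "'a::euclidean_space \<Rightarrow> 'a \<Rightarrow> real"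
  assumes "inner_product_on UNIV B"
  shows "B u v = (\<Sum>i\<in>Basis. \<Sum>j\<in>Basis. ((u \<bullet> i) * (v \<bullet> j)) * B i j)"
proof -
  have sym: "B x y = B y x" and add: "B (x + y) z = B x z + B y z"
    and scale: "B (t *\<^sub>R x) z = t * B x z" for x y z t
    using assms unfolding inner_product_on_def by auto
  have lin: "linear (\<lambda>x. B x z)" for z by (rule linearI) (simp_all add: add scale)
  have 1: "B x z = (\<Sum>i\<in>Basis. (x \<bullet> i) * B i z)" for x z
    by (subst euclidean_representation[symmetric, of x]) (simp add: linear_sum[OF lin] scale)
  have "B u v = (\<Sum>i\<in>Basis. (u \<bullet> i) * B v i)" by (subst 1) (simp add: sym)
  also have "\<dots> = (\<Sum>i\<in>Basis. (u \<bullet> i) * (\<Sum>j\<in>Basis. (v \<bullet> j) * B i j))"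
    by (subst 1) (simp add: sym)
  finally show ?thesis by (simp add: sum_distrib_left mult.assoc)
qed

lemma C2_bounded_bilinear:
  fixes h :: "'a::euclidean_space \<Rightarrow> 'b::euclidean_space \<Rightarrow> 'b \<Rightarrow> real"
  assumes W: "open W" "\<And>y. y \<in> W \<Longrightarrow> inner_product_on UNIV (h y)" and K: "K \<ge> 0"
    and b: "\<And>i j. i \<in> Basis \<Longrightarrow> j \<in> Basis \<Longrightarrow> C2_bounded W K K K (\<lambda>y. h y i j)"
  defines "N \<equiv> (real DIM('b))\<^sup>2 * K"
  shows "C2_bounded W (N * norm u * norm v) (N * norm u * norm v) (N * norm u * norm v) (\<lambda>y. h y u v)"
proof -
  define a where "a = (\<lambda>i j. \<bar>(u \<bullet> i) * (v \<bullet> j)\<bar> * K)"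
  define s where "s = (\<Sum>i\<in>(Basis::'b set). \<Sum>j\<in>(Basis::'b set). a i j)"
  have "C2_bounded W s s s (\<lambda>y. \<Sum>i\<in>Basis. \<Sum>j\<in>Basis. ((u \<bullet> i) * (v \<bullet> j)) * h y i j)"
    unfolding s_def a_def by (intro C2_bounded_sum C2_bounded_cmult b finite_Basis W)
  then have "C2_bounded W s s s (\<lambda>y. h y u v)"
    by (rule C2_bounded_cong) (rule inner_product_basis_sum[OF W(2), symmetric])
  moreover have "s \<le> N * norm u * norm v"
  proof -
    have "a i j \<le> norm u * norm v * K" if "i \<in> Basis" "j \<in> Basis" for i j
      unfolding a_def abs_mult using Basis_le_norm[OF that(1), of u] Basis_le_norm[OF that(2), of v] K
      by (intro mult_mono) auto
    then have "s \<le> (\<Sum>i\<in>(Basis::'b set). \<Sum>j\<in>(Basis::'b set). norm u * norm v * K)"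
      unfolding s_def by (intro sum_mono)
    then show ?thesis by (simp add: N_def power2_eq_square algebra_simps)
  qed
  ultimately show ?thesis using C2_bounded_mono by blast
qed

lemma C2_normD:
  assumes "C2_norm U h < ennreal c" "i \<in> Basis" "j \<in> Basis"
  shows "C2_norm_fun U (\<lambda>x. h x i j) < ennreal c"
  using assms(1) unfolding C2_norm_def
  by (rule order_le_less_trans[OF order_trans[OF SUP_upper[OF assms(3)] SUP_upper[OF assms(2)]]])

lemma sphere_metric_pullback:
  fixes U :: "(real^'n) set" and g :: "((real^'n) \<times> real) tensor"
  assumes "sphere_metric g" "chart_of (sphere 0 1) U \<psi>"
  shows "y \<in> U \<Longrightarrow> inner_product_on UNIV (pullback \<psi> g y)"
    and "i \<in> Basis \<Longrightarrow> j \<in> Basis \<Longrightarrow> Ck_on k U (\<lambda>x. pullback \<psi> g x i j)"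
proof -
  show "inner_product_on UNIV (pullback \<psi> g y)" if "y \<in> U"
    using assms(1) chart_of_subset[OF assms(2) that] 
    by (intro inner_product_on_pullback[OF assms(2) that]) (simp add: sphere_metric_def)
  show "Ck_on k U (\<lambda>x. pullback \<psi> g x i j)" if "i \<in> Basis" "j \<in> Basis"
  proof -
    have "\<forall>i\<in>Basis. \<forall>j\<in>Basis. smooth_on U (\<lambda>x. pullback \<psi> g x i j)"
      using assms unfolding sphere_metric_def by simp
    then have "smooth_on U (\<lambda>x. pullback \<psi> g x i j)" using that by blast
    then show ?thesis unfolding smooth_on_open_iff[OF chart_of_open[OF assms(2)]] by blast
  qed
qed

lemma matrix_form_eq:
  fixes B :: "real^'n \<Rightarrow> real^'n \<Rightarrow> real"
  assumes "inner_product_on UNIV B"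
  shows "u \<bullet> ((\<chi> i j. B (axis i 1) (axis j 1)) *v u) = B u u"
proof -
  have sum_Basis: "(\<Sum>i\<in>Basis. f i) = (\<Sum>i\<in>UNIV. f (axis i (1::real)))" for f :: "real^'n \<Rightarrow> real"
    unfolding Basis_vec_def by (subst sum.reindex[symmetric, of "\<lambda>i. axis i 1", unfolded comp_def])
      (auto simp: inj_on_def axis_eq_axis intro!: sum.cong)
  have "B u u = (\<Sum>i\<in>UNIV. \<Sum>j\<in>UNIV. ((u \<bullet> axis i 1) * (u \<bullet> axis j 1)) * B (axis i 1) (axis j 1))"
    by (subst inner_product_basis_sum[OF assms]) (simp only: sum_Basis)
  then show ?thesis
    by (simp add: inner_vec_def[of u "vec_lambda _"] matrix_vector_mult_def inner_axis sum_distrib_left mult_ac)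
qed

text \<open>The entries of the metric matrix are at most \<open>c\<close> and its determinant is at
  least \<open>1 / c\<close> in absolute value, so the compactness bound for matrices gives a lower
  bound that depends neither on the chart nor on \<open>g\<close>.\<close>

lemma c_bounded_imp_controlled:
  fixes \<A> :: "((real^'n) set \<times> (real^'n \<Rightarrow> (real^'n) \<times> real)) set"
  assumes "c > 0"
  shows "\<exists>K. \<forall>U \<psi> g. (U, \<psi>) \<in> \<A> \<longrightarrow> chart_of (sphere 0 1) U \<psi> \<longrightarrow> sphere_metric g \<longrightarrow> c_bounded \<A> c g \<longrightarrow>
    chart_controlled K U \<psi> g"
proof -
  obtain \<kappa> where k: "\<kappa> > 0" "\<forall>M::real^'n^'n. (\<forall>i j. M$i$j = M$j$i) \<longrightarrow> (\<forall>u. 0 \<le> u \<bullet> (M *v u)) \<longrightarrow>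
    (\<forall>i j. \<bar>M$i$j\<bar> \<le> c) \<longrightarrow> \<bar>det M\<bar> \<ge> 1 / c \<longrightarrow> (\<forall>u. \<kappa> * (norm u)\<^sup>2 \<le> u \<bullet> (M *v u))"
    using psd_uniformly_positive[of "1 / c" c] assms by auto
  define n where "n = real CARD('n)"
  \<comment> \<open>One factor \<open>n\<^sup>2\<close> comes from arbitrary directions of
    differentiation, the other from expanding the two argument vectors of the metric.\<close>
  define N where "N = n\<^sup>2 * (n\<^sup>2 * c)"
  have "chart_controlled (max N (1 / \<kappa>)) U \<psi> g"
    if A: "(U, \<psi>) \<in> \<A>" and ch: "chart_of (sphere 0 1) U \<psi>" and g: "sphere_metric g" and cb: "c_bounded \<A> c g"
    for U \<psi> g
  proof -
    note ip = sphere_metric_pullback(1)[OF g ch]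
    have cn: "C2_norm U (pullback \<psi> g) < ennreal c"
      and det: "y \<in> U \<Longrightarrow> \<bar>det (\<chi> i j. pullback \<psi> g y (axis i 1) (axis j 1))\<bar> > 1 / c" for y
      using cb A unfolding c_bounded_def by auto
    note cf = C2_norm_funD[OF C2_normD[OF cn]]
    have b: "C2_bounded U (n\<^sup>2 * c) (n\<^sup>2 * c) (n\<^sup>2 * c) (\<lambda>y. pullback \<psi> g y i j)"
      if ij: "i \<in> Basis" "j \<in> Basis" for i j
      using C2_bounded_from_basis[OF chart_of_open[OF ch] sphere_metric_pullback(2)[OF g ch ij], of c]
        cf[OF ij] assms by (simp add: n_def)
    have "C2_bounded U (N * norm u * norm v) (N * norm u * norm v) (N * norm u * norm v)
        (\<lambda>y. pullback \<psi> g y u v)" for u v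
      using C2_bounded_bilinear[OF chart_of_open[OF ch] ip _ b, of u v] assms by (simp add: N_def n_def)
    then have "C2_bounded U (max N (1 / \<kappa>) * norm u * norm v) (max N (1 / \<kappa>) * norm u * norm v)
        (max N (1 / \<kappa>) * norm u * norm v) (\<lambda>y. pullback \<psi> g y u v)" for u v
      by (rule C2_bounded_mono) (auto intro!: mult_right_mono)
    moreover have "(norm u)\<^sup>2 \<le> max N (1 / \<kappa>) * pullback \<psi> g y u u" if y: "y \<in> U" for y u
    proof -
      define M :: "real^'n^'n" where "M = (\<chi> i j. pullback \<psi> g y (axis i 1) (axis j 1))"
      have ax: "axis i (1::real) \<in> (Basis :: (real^'n) set)" for i by simp
      note form = matrix_form_eq[OF ip[OF y], folded M_def]
      have pos: "pullback \<psi> g y u u \<ge> 0" for u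
        using ip[OF y] inner_product_basis_sum[OF ip[OF y], of 0 0] unfolding inner_product_on_def
        by (cases "u = 0") (auto intro: less_imp_le)
      have "\<forall>i j. M$i$j = M$j$i" using ip[OF y] by (simp add: M_def inner_product_on_def)
      moreover have "\<forall>i j. \<bar>M$i$j\<bar> \<le> c"
        using cf(1)[OF ax ax y] by (simp add: M_def)
      moreover have "\<bar>det M\<bar> \<ge> 1 / c" using det[OF y] by (simp add: M_def less_imp_le)
      moreover have "\<forall>u. 0 \<le> u \<bullet> (M *v u)" unfolding form using pos by blast
      ultimately have "\<kappa> * (norm u)\<^sup>2 \<le> pullback \<psi> g y u u"
        using k(2)[rule_format, of M u] by (simp add: form)
      then have "(norm u)\<^sup>2 \<le> 1 / \<kappa> * pullback \<psi> g y u u" using k(1) by (simp add: field_simps)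
      also have "\<dots> \<le> max N (1 / \<kappa>) * pullback \<psi> g y u u" by (rule mult_right_mono[OF _ pos]) simp
      finally show ?thesis .
    qed
    ultimately show ?thesis using ip unfolding chart_controlled_def by blast
  qed
  then show ?thesis by blast
qed

section \<open>Uniformity over the finite atlas and control of the round metric\<close>

lemma finite_uniform_bound:
  fixes P :: "'i \<Rightarrow> real \<Rightarrow> bool"
  assumes "finite I" "\<And>i. i \<in> I \<Longrightarrow> \<exists>K. P i K" "\<And>i K K'. P i K \<Longrightarrow> K \<le> K' \<Longrightarrow> P i K'"
  shows "\<exists>K. \<forall>i\<in>I. P i K"
  using assms(1,2)
proof (induction I rule: finite_induct)
  case (insert i I)
  obtain K' where "P i K'" using insert.prems by blast
  moreover obtain K where "\<forall>i\<in>I. P i K" using insert.IH insert.prems by blast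
  ultimately have "\<forall>j\<in>insert i I. P j (max K K')" using assms(3) by (metis insert_iff max.cobounded1 max.cobounded2)
  then show ?case by blast
qed simp

lemma continuous_on_compact_bound:
  fixes f :: "'a::euclidean_space \<Rightarrow> real"
  assumes "compact C" "continuous_on C f"
  shows "\<exists>K. \<forall>x\<in>C. \<bar>f x\<bar> \<le> K"
  using compact_imp_bounded[OF compact_continuous_image[OF assms(2,1)]] by (auto simp: bounded_iff)

lemma C2_bounded_compact_closure:
  fixes f :: "'a::euclidean_space \<Rightarrow> real"
  assumes U: "open U" "compact (closure U)" "closure U \<subseteq> V" and f: "Ck_on 2 V f"
  shows "\<exists>K. C2_bounded U K K K f"
proof -
  \<comment> \<open>On the closed set the derivatives are still those of the full space, since
    \<open>V\<close> contains it. They are continuous there and hence bounded by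
    compactness.\<close>
  have f': "Ck_on 2 (closure U) f" by (rule Ck_on_subset[OF f U(3)])
  have c: "continuous_on (closure U) f" "continuous_on (closure U) (dir_deriv i f)"
    "continuous_on (closure U) (dir_deriv j (dir_deriv i f))" for i j
  proof -
    show "continuous_on (closure U) f" by (rule Ck_on_continuous[OF f'])
    have "Ck_on (Suc 0) (closure U) (dir_deriv i f)" using f' by (simp add: numeral_2_eq_2)
    then show "continuous_on (closure U) (dir_deriv i f)" by (rule Ck_on_continuous)
    show "continuous_on (closure U) (dir_deriv j (dir_deriv i f))" using f' by (simp add: numeral_2_eq_2)
  qed
  obtain K0 where K0: "\<forall>x\<in>closure U. \<bar>f x\<bar> \<le> K0" using continuous_on_compact_bound[OF U(2) c(1)] by blast
  have "\<exists>K. \<forall>i\<in>(Basis::'a set). \<forall>x\<in>closure U. \<bar>dir_deriv i f x\<bar> \<le> K"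
    by (rule finite_uniform_bound[OF finite_Basis continuous_on_compact_bound[OF U(2) c(2)]])
      (meson order_trans)
  then obtain K1 where K1: "\<forall>i\<in>(Basis::'a set). \<forall>x\<in>closure U. \<bar>dir_deriv i f x\<bar> \<le> K1" by blast
  have "\<exists>K. \<forall>p\<in>(Basis::'a set) \<times> (Basis::'a set). \<forall>x\<in>closure U. \<bar>dir_deriv (fst p) (dir_deriv (snd p) f) x\<bar> \<le> K"
    by (rule finite_uniform_bound[OF _ continuous_on_compact_bound[OF U(2) c(3)]])
      (simp, meson order_trans)
  then obtain K2 where K2: "\<forall>p\<in>(Basis::'a set) \<times> (Basis::'a set). \<forall>x\<in>closure U. \<bar>dir_deriv (fst p) (dir_deriv (snd p) f) x\<bar> \<le> K2"
    by blast
  define K where "K = max 0 (max K0 (max K1 K2))"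
  have K: "K0 \<le> K" "K1 \<le> K" "K2 \<le> K" "0 \<le> K" by (auto simp: K_def)
  have cl: "x \<in> U \<Longrightarrow> x \<in> closure U" for x using closure_subset by blast
  have "Ck_on 2 U f" using Ck_on_subset[OF f'] closure_subset by blast
  then have "C2_bounded U ((real DIM('a))\<^sup>2 * K) ((real DIM('a))\<^sup>2 * K) ((real DIM('a))\<^sup>2 * K) f"
  proof (intro C2_bounded_from_basis U K(4))
    fix x i j assume x: "x \<in> U"
    show "\<bar>f x\<bar> \<le> K" using K0[rule_format, OF cl[OF x]] K(1) by linarith
    show "\<bar>dir_deriv i f x\<bar> \<le> K" if "i \<in> Basis" using K1[rule_format, OF that cl[OF x]] K(2) by linarith
    show "\<bar>dir_deriv j (dir_deriv i f) x\<bar> \<le> K" if "i \<in> Basis" "j \<in> Basis"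
      using K2[rule_format, OF _ cl[OF x], of "(j, i)"] that K(3) by simp
  qed
  then show ?thesis by blast
qed

text \<open>Here the bounds come from the extension \<open>\<psi>'\<close> of the chart over the
  compact closure: the entries are continuous there, and the length of the image of a unit vector
  attains a minimum, which is positive because \<open>\<psi>'\<close> is an immersion.\<close>

lemma round_metric_controlled:
  fixes \<psi> :: "real^'n \<Rightarrow> (real^'n) \<times> real"
  assumes ch: "chart_of (sphere 0 1) U \<psi>" and U: "compact (closure U)" "closure U \<subseteq> V"
    and ch': "chart_of (sphere 0 1) V \<psi>'" and eq: "\<And>x. x \<in> U \<Longrightarrow> \<psi>' x = \<psi> x"
  shows "\<exists>K. chart_controlled K U \<psi> round_metric"
proof -
  note o = chart_of_open[OF ch]
  have pb: "pullback \<psi>' round_metric y u v = pullback \<psi> round_metric y u v" if "y \<in> U" for y u v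
    unfolding pullback_def round_metric_def 
    using dir_deriv_cong_open[OF o that, of \<psi>' \<psi>] eq that by simp
  have ip: "inner_product_on UNIV (pullback \<psi> round_metric y)" if "y \<in> U" for y
    by (rule inner_product_on_pullback[OF ch that])
      (simp add: inner_product_on_def round_metric_def inner_commute inner_add_right)
  have ck: "Ck_on 2 V (\<lambda>y. pullback \<psi>' round_metric y i j)" for i j
  proof -
    have "Ck_on (Suc 2) V \<psi>'" by (rule chart_of_Ck_on[OF ch'])
    then have "Ck_on 2 V (dir_deriv u \<psi>')" for u by (simp only: Ck_on.simps)
    then show ?thesis unfolding pullback_def round_metric_def
      by (intro Ck_on_inner chart_of_open[OF ch'])
  qed
  have "\<exists>K. \<forall>p\<in>Basis \<times> Basis. C2_bounded U K K K (\<lambda>y. pullback \<psi>' round_metric y (fst p) (snd p))"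
    by (rule finite_uniform_bound[OF _ C2_bounded_compact_closure[OF o U ck]])
      (auto intro: C2_bounded_mono)
  then obtain K0 where K0: "\<forall>p\<in>Basis \<times> Basis. C2_bounded U K0 K0 K0 (\<lambda>y. pullback \<psi>' round_metric y (fst p) (snd p))"
    by blast
  have "C2_bounded U (max K0 0) (max K0 0) (max K0 0) (\<lambda>y. pullback \<psi> round_metric y i j)"
    if "i \<in> Basis" "j \<in> Basis" for i j
  proof (rule C2_bounded_cong[OF _ pb])
    have "C2_bounded U K0 K0 K0 (\<lambda>y. pullback \<psi>' round_metric y i j)"
      using K0[rule_format, of "(i, j)"] that by simp
    then show "C2_bounded U (max K0 0) (max K0 0) (max K0 0) (\<lambda>y. pullback \<psi>' round_metric y i j)"
      by (rule C2_bounded_mono) auto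
  qed
  note b = this
  define N where "N = (real DIM(real^'n))\<^sup>2 * max K0 0"
  have N: "C2_bounded U (N * norm u * norm v) (N * norm u * norm v) (N * norm u * norm v)
        (\<lambda>y. pullback \<psi> round_metric y u v)" for u v
    using C2_bounded_bilinear[of U "pullback \<psi> round_metric" "max K0 0", OF o ip _ b, of u v]
    by (simp add: N_def)
  \<comment> \<open>The differential of \<open>\<psi>'\<close> in coordinates, which makes its joint
    continuity in the point and the vector visible.\<close>
  define D where "D = (\<lambda>x u. \<Sum>i\<in>Basis. (u \<bullet> i) *\<^sub>R dir_deriv i \<psi>' x)"
  have D: "D x u = dir_deriv u \<psi>' x" if "x \<in> V" for x u
    unfolding D_def by (rule dir_deriv_basis_sum[OF chart_of_differentiable[OF ch' that], symmetric])
  have "\<exists>\<kappa>>0. \<forall>x\<in>U. \<forall>u. \<kappa> * (norm u)\<^sup>2 \<le> (norm (D x u))\<^sup>2"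
  proof (cases "U = {}")
    case True
    then show ?thesis by (intro exI[of _ 1]) simp
  next
    case False
    let ?C = "closure U \<times> sphere (0::real^'n) 1"
    have "continuous_on (closure U) (dir_deriv i \<psi>')" for i
    proof (rule continuous_on_subset[OF _ U(2)])
      show "continuous_on V (dir_deriv i \<psi>')"
        using chart_of_Ck_on[OF ch', of "Suc 0"] by (simp only: Ck_on.simps)
    qed
    then have "continuous_on ?C (\<lambda>z. dir_deriv i \<psi>' (fst z))" for i
      by (rule continuous_on_compose2) (auto intro!: continuous_intros)
    then have cont: "continuous_on ?C (\<lambda>z. (norm (D (fst z) (snd z)))\<^sup>2)"
      unfolding D_def by (intro continuous_intros)
    have "?C \<noteq> {}" using False by (auto simp: closure_eq_empty)
    from continuous_attains_inf[OF compact_Times[OF U(1) compact_sphere] this cont]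
    obtain z where z: "z \<in> ?C" "\<forall>y\<in>?C. (norm (D (fst z) (snd z)))\<^sup>2 \<le> (norm (D (fst y) (snd y)))\<^sup>2"
      by (rule bexE)
    define \<kappa> where "\<kappa> = (norm (D (fst z) (snd z)))\<^sup>2"
    have zV: "fst z \<in> V" "snd z \<noteq> 0" using z(1) U(2) by auto
    then have "\<kappa> > 0" using chart_of_immersion[OF ch' zV(1), of "snd z"] D[OF zV(1)] by (auto simp: \<kappa>_def)
    moreover have "\<kappa> * (norm u)\<^sup>2 \<le> (norm (D x u))\<^sup>2" if x: "x \<in> U" for x u
    proof (cases "u = 0")
      case False
      define w where "w = u /\<^sub>R norm u"
      have w: "u = norm u *\<^sub>R w" "norm w = 1" using False by (simp_all add: w_def)
      then have "\<kappa> \<le> (norm (D x w))\<^sup>2"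
        using z(2)[rule_format, of "(x, w)"] x closure_subset by (auto simp: \<kappa>_def)
      then have "\<kappa> * (norm u)\<^sup>2 \<le> (norm (D x w))\<^sup>2 * (norm u)\<^sup>2" by (intro mult_right_mono) auto
      also have "D x u = norm u *\<^sub>R D x w"
        unfolding D_def scaleR_sum_right by (subst w(1)) simp
      then have "(norm (D x w))\<^sup>2 * (norm u)\<^sup>2 = (norm (D x u))\<^sup>2" by (simp add: power_mult_distrib)
      finally show ?thesis .
    qed simp
    ultimately show ?thesis by blast
  qed
  then obtain \<kappa> where k: "\<kappa> > 0" "\<forall>x\<in>U. \<forall>u. \<kappa> * (norm u)\<^sup>2 \<le> (norm (D x u))\<^sup>2" by blast
  have pos: "(norm u)\<^sup>2 \<le> max N (1 / \<kappa>) * pullback \<psi> round_metric y u u" if y: "y \<in> U" for y u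
  proof -
    have p: "pullback \<psi> round_metric y u u = (norm (D y u))\<^sup>2"
    proof -
      have "y \<in> V" using y U(2) closure_subset by blast
      from D[OF this, of u] show ?thesis unfolding pb[OF y, symmetric]
        by (simp add: pullback_def round_metric_def power2_norm_eq_inner)
    qed
    have "(norm u)\<^sup>2 \<le> 1 / \<kappa> * (norm (D y u))\<^sup>2" using k y by (simp add: field_simps)
    also have "\<dots> \<le> max N (1 / \<kappa>) * (norm (D y u))\<^sup>2" by (rule mult_right_mono) auto
    finally show ?thesis unfolding p .
  qed
  have "C2_bounded U (max N (1 / \<kappa>) * norm u * norm v) (max N (1 / \<kappa>) * norm u * norm v)
        (max N (1 / \<kappa>) * norm u * norm v) (\<lambda>y. pullback \<psi> round_metric y u v)" for u v
    by (rule C2_bounded_mono[OF N]) (auto intro!: mult_right_mono)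
  then show ?thesis using ip pos unfolding chart_controlled_def by blast
qed

text \<open>For \<open>c\<close>-bounded metrics the constant is already uniform. For the round
  metric it depends on the chart, and finiteness of the atlas provides a common one.\<close>

lemma atlas_controlled:
  assumes A: "good_atlas \<A>" and "c > 1"
  shows "\<exists>K\<ge>1. \<forall>U \<psi>. (U, \<psi>) \<in> \<A> \<longrightarrow> chart_controlled K U \<psi> round_metric \<and>
    (\<forall>g. sphere_metric g \<longrightarrow> c_bounded \<A> c g \<longrightarrow> chart_controlled K U \<psi> g)"
proof -
  have ch: "chart_of (sphere 0 1) U \<psi>" if "(U, \<psi>) \<in> \<A>" for U \<psi>
    using A that unfolding good_atlas_def by blast
  obtain K1 where K1: "\<And>U \<psi> g. (U, \<psi>) \<in> \<A> \<Longrightarrow> sphere_metric g \<Longrightarrow> c_bounded \<A> c g \<Longrightarrow> chart_controlled K1 U \<psi> g"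
    using c_bounded_imp_controlled[of c \<A>] assms(2) ch by force
  have "finite \<A>" using A by (simp add: good_atlas_def)
  then have "\<exists>K. \<forall>p\<in>\<A>. chart_controlled K (fst p) (snd p) round_metric"
  proof (rule finite_uniform_bound)
    fix p assume p: "p \<in> \<A>"
    obtain U \<psi> where [simp]: "p = (U, \<psi>)" by (cases p)
    have "compact (closure U)" "\<exists>V \<psi>'. closure U \<subseteq> V \<and> chart_of (sphere 0 1) V \<psi>' \<and> (\<forall>x\<in>U. \<psi>' x = \<psi> x)"
      using A p unfolding good_atlas_def by auto
    then show "\<exists>K. chart_controlled K (fst p) (snd p) round_metric"
      using round_metric_controlled[OF ch] p by auto
  qed (rule chart_controlled_mono)
  then obtain K2 where K2: "\<forall>p\<in>\<A>. chart_controlled K2 (fst p) (snd p) round_metric" by blast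
  show ?thesis
    by (rule exI[of _ "max 1 (max K1 K2)"])
      (use K1 K2 in \<open>force intro: chart_controlled_mono\<close>)
qed

subsection \<open>Closeness to the hyperbolic model\<close>

text \<open>\<open>36 = 4 * 9\<close>: two derivatives contribute \<open>4\<close>, and
  \<open>exp 2 \<le> 9\<close> from \<open>exp 1 \<le> 3\<close>.\<close>

lemma exp_double_C2_bounded: "C2_bounded {-1<..<1::real} 36 36 36 (\<lambda>t. exp (2 * t))"
proof (rule C2_bounded_real[where ?f1.0 = "\<lambda>t. 2 * exp (2 * t)" and ?f2.0 = "\<lambda>t. 4 * exp (2 * t)"])
  have "exp (2::real) = exp 1 * exp 1" by (simp flip: exp_add)
  also have "\<dots> \<le> 3 * 3" using exp_le by (intro mult_mono) auto
  finally have e: "exp (2::real) \<le> 9" by simp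
  have "exp (2 * t) \<le> 9" if "t \<in> {-1<..<1}" for t :: real
    using that e by (auto intro: order_trans[of _ "exp 2"])
  then show "\<bar>exp (2 * t)\<bar> \<le> 36" "\<bar>2 * exp (2 * t)\<bar> \<le> 36" "\<bar>4 * exp (2 * t)\<bar> \<le> 36" if "t \<in> {-1<..<1}" for t :: real
    using that by fastforce+
qed (auto intro!: derivative_eq_intros continuous_intros)

text \<open>Expanding the square of \<open>exp (t + s) - exp (- t - s)\<close>, the leading term
  cancels and the cross term is constant in \<open>t\<close>.\<close>

lemma sinh_factor_eq:
  "4 * exp (- 2 * s) * (sinh (t + s))\<^sup>2 - exp (2 * t) = - 2 * exp (- 2 * s) + exp (- 2 * t - 4 * s)" for s t :: real
proof -
  have "exp (2 * t) = (exp t)\<^sup>2" "exp (- 2 * s) = (exp (-s))\<^sup>2" "exp (- 2 * t - 4 * s) = (exp (-t))\<^sup>2 * (exp (-s))^4"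
    by (simp_all flip: exp_of_nat_mult exp_add)
  moreover have "sinh (t + s) = (exp t * exp s - exp (-t) * exp (-s)) / 2"
    by (simp add: sinh_field_def flip: exp_add)
  moreover have "exp t * exp (-t) = 1" "exp s * exp (-s) = 1" by (simp_all flip: exp_add)
  ultimately show ?thesis by algebra
qed

lemma sinh_factor_C2_bounded:
  assumes "s \<ge> 1"
  shows "C2_bounded {-1<..<1} (6 * exp (-s)) (6 * exp (-s)) (6 * exp (-s))
    (\<lambda>t. 4 * exp (- 2 * s) * (sinh (t + s))\<^sup>2 - exp (2 * t))" (is ?A)
    and "C2_bounded {-1<..<1} 42 42 42 (\<lambda>t. 4 * exp (- 2 * s) * (sinh (t + s))\<^sup>2)" (is ?B)
proof -
  show ?A unfolding sinh_factor_eq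
  proof (rule C2_bounded_real[where ?f1.0 = "\<lambda>t. - 2 * exp (- 2 * t - 4 * s)" and ?f2.0 = "\<lambda>t. 4 * exp (- 2 * t - 4 * s)"])
    fix t :: real assume t: "t \<in> {-1<..<1}"
    \<comment> \<open>Since \<open>t > -1\<close> and \<open>s \<ge> 1\<close>, the exponent
      \<open>- 2 * t - 4 * s\<close> is below \<open>2 - 4 * s\<close>, hence below
      \<open>- s\<close>.\<close>
    have "exp (- 2 * t - 4 * s) \<le> exp (- s)" "exp (- 2 * s) \<le> exp (- s)" using t assms by simp_all
    moreover have "exp (- 2 * t - 4 * s) > 0" "exp (- 2 * s) > 0" by simp_all
    ultimately show "\<bar>- 2 * exp (- 2 * s) + exp (- 2 * t - 4 * s)\<bar> \<le> 6 * exp (- s)"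
      "\<bar>- 2 * exp (- 2 * t - 4 * s)\<bar> \<le> 6 * exp (- s)" "\<bar>4 * exp (- 2 * t - 4 * s)\<bar> \<le> 6 * exp (- s)"
      by linarith+
  qed (auto intro!: derivative_eq_intros continuous_intros)
  from C2_bounded_add[OF this exp_double_C2_bounded]
  have "C2_bounded {-1<..<1} (6 * exp (-s) + 36) (6 * exp (-s) + 36) (6 * exp (-s) + 36)
    (\<lambda>t. 4 * exp (- 2 * s) * (sinh (t + s))\<^sup>2)" by simp
  moreover have "exp (-s) \<le> 1" using assms by simp
  ultimately show ?B by (elim C2_bounded_mono) linarith+
qed

lemma cutoff_C2_bounded:
  assumes "cutoff \<rho>"
  shows "C2_bounded UNIV 1 3 12 \<rho>"
proof -
  have "Ck_on 2 UNIV \<rho>" using assms smooth_on_open_iff[OF open_UNIV] unfolding cutoff_def by blast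
  then have ck: "\<rho> differentiable (at t)" "dir_deriv u \<rho> differentiable (at t)"
    "continuous_on UNIV (dir_deriv v (dir_deriv u \<rho>))" for t u v by (auto simp: numeral_2_eq_2)
  have dd: "dir_deriv 1 f = deriv f" if "\<And>t. f differentiable (at t)" for f :: "real \<Rightarrow> real"
  proof
    fix t
    have "(f has_real_derivative deriv f t) (at t)"
      using that DERIV_deriv_iff_real_differentiable by blast
    from dir_deriv_eq[OF has_field_derivative_imp_has_derivative[OF this], of 1]
    show "dir_deriv 1 f t = deriv f t" by simp
  qed
  have d1: "dir_deriv 1 \<rho> = deriv \<rho>" using dd ck(1) by blast
  have d2: "dir_deriv 1 (deriv \<rho>) = deriv (deriv \<rho>)" using dd ck(2)[of 1] d1 by metis
  show ?thesis
  proof (rule C2_bounded_real[where ?f1.0 = "deriv \<rho>" and ?f2.0 = "deriv (deriv \<rho>)"])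
    show "(\<rho> has_real_derivative deriv \<rho> t) (at t)" for t
      using ck(1) DERIV_deriv_iff_real_differentiable by blast
    show "(deriv \<rho> has_real_derivative deriv (deriv \<rho>) t) (at t)" for t
      using ck(2)[of 1] DERIV_deriv_iff_real_differentiable unfolding d1 by blast
    show "continuous_on UNIV (deriv (deriv \<rho>))" using ck(3)[of 1 1] by (simp add: d1 d2)
  qed (use assms in \<open>auto simp: cutoff_def less_imp_le\<close>)
qed

text \<open>The argument of \<open>\<rho>\<close> has slope \<open>2 / d\<close>; thus
  \<open>6 / d = (2 / d) * 3\<close> and
  \<open>48 / d\<^sup>2 = (2 / d)\<^sup>2 * 12\<close>.\<close>

lemma rho_ad_C2_bounded:
  assumes "cutoff \<rho>" "d > 0"
  shows "C2_bounded {-1<..<1} 1 (6 / d) (48 / d\<^sup>2) (\<lambda>t. rho_ad \<rho> a d (t + s))"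
proof -
  have lin: "bounded_linear (\<lambda>t. (2 / d) * t)" by (rule bounded_linear_mult_right)
  have "C2_bounded {-1<..<1} 1 (2 / d * 3) ((2 / d)\<^sup>2 * 12) (\<lambda>t. \<rho> (2 * (s - a) / d + (2 / d) * t))"
    by (rule C2_bounded_affine_comp[OF cutoff_C2_bounded[OF assms(1)] _ _ lin])
      (use assms(2) in \<open>auto simp: abs_mult\<close>)
  moreover have "2 * ((t + s - a) / d) = 2 * (s - a) / d + (2 / d) * t" for t
    using assms(2) by (simp add: field_simps)
  ultimately show ?thesis by (simp add: rho_ad_def power_divide)
qed

text \<open>The map \<open>x \<mapsto> p + \<eta> *\<^sub>R L x\<close> stretches by at most
  \<open>\<eta> * l\<close>, so each derivative gains this factor. Because it is at most
  \<open>1\<close>, the unit ball stays inside \<open>U\<close> and the second-order gain may be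
  weakened to the first-order one.\<close>

lemma pullback_scaled_C2_bounded:
  fixes g :: "((real^'n) \<times> real) tensor"
  assumes g: "chart_controlled K U \<psi> g" and K: "K \<ge> 0"
    and L: "bounded_linear L" "\<And>x. norm (L x) \<le> l * norm x" and l: "l \<ge> 0"
    and \<eta>: "\<eta> \<ge> 0" "\<eta> * l \<le> 1" and U: "ball p 1 \<subseteq> U" and uv: "norm u \<le> 1" "norm v \<le> 1"
  shows "C2_bounded (ball 0 1) (K * l\<^sup>2) (\<eta> * l * (K * l\<^sup>2)) (\<eta> * l * (K * l\<^sup>2))
    (\<lambda>x. pullback \<psi> g (p + \<eta> *\<^sub>R L x) (L u) (L v))"
proof -
  let ?N = "K * l\<^sup>2"
  have n: "norm (L w) \<le> l" if "norm w \<le> 1" for w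
    using L(2)[of w] mult_left_mono[OF that l] by simp
  have "K * norm (L u) * norm (L v) \<le> ?N"
    using mult_mono[OF n[OF uv(1)] n[OF uv(2)]] l K by (simp add: power2_eq_square mult_left_mono mult.assoc)
  moreover have "C2_bounded U (K * norm (L u) * norm (L v)) (K * norm (L u) * norm (L v))
      (K * norm (L u) * norm (L v)) (\<lambda>y. pullback \<psi> g y (L u) (L v))"
    using g unfolding chart_controlled_def by blast
  ultimately have b: "C2_bounded U ?N ?N ?N (\<lambda>y. pullback \<psi> g y (L u) (L v))"
    by (elim C2_bounded_mono)
  have N: "?N \<ge> 0" using K by simp
  have sc: "norm (\<eta> *\<^sub>R L x) \<le> \<eta> * l * norm x" for x
    using mult_left_mono[OF L(2)[of x] \<eta>(1)] \<eta>(1) by (simp add: mult.assoc)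
  have "p + \<eta> *\<^sub>R L x \<in> U" if "x \<in> ball 0 1" for x
  proof -
    have "norm (\<eta> *\<^sub>R L x) < 1" using sc[of x] mult_right_mono[OF \<eta>(2), of "norm x"] that by simp
    then show ?thesis using U by (auto simp: dist_norm)
  qed
  then have "C2_bounded (ball 0 1) ?N (\<eta> * l * ?N) ((\<eta> * l)\<^sup>2 * ?N)
      (\<lambda>x. pullback \<psi> g (p + \<eta> *\<^sub>R L x) (L u) (L v))"
    using sc N l \<eta> by (intro C2_bounded_affine_comp[OF b] bounded_linear_const_scaleR L) auto
  moreover have "(\<eta> * l)\<^sup>2 * ?N \<le> \<eta> * l * ?N"
    using \<eta> l N mult_right_mono[OF \<eta>(2), of "\<eta> * l"] by (intro mult_right_mono) (auto simp: power2_eq_square)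
  ultimately show ?thesis by (elim C2_bounded_mono) auto
qed

text \<open>The tangential entries of the pulled-back warped metric minus the model metric; the other
  entries vanish.\<close>

definition warp_defect ::
    "(real \<Rightarrow> real) \<Rightarrow> real \<Rightarrow> real \<Rightarrow> ((real^'n) \<times> real) tensor \<Rightarrow> (real^'n \<Rightarrow> (real^'n) \<times> real) \<Rightarrow>
     real^'n \<Rightarrow> real \<Rightarrow> (real^'n \<Rightarrow> real^'n) \<Rightarrow> real \<Rightarrow> real^'n \<Rightarrow> real^'n \<Rightarrow> (real^'n) \<times> real \<Rightarrow> real" where
  "warp_defect \<rho> a d g \<psi> p \<eta> L s u v z =
     \<eta>\<^sup>2 * (sinh (snd z + s))\<^sup>2 *
       (pullback \<psi> round_metric (p + \<eta> *\<^sub>R L (fst z)) (L u) (L v)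
        + rho_ad \<rho> a d (snd z + s) * (pullback \<psi> g (p + \<eta> *\<^sub>R L (fst z)) (L u) (L v)
            - pullback \<psi> round_metric (p + \<eta> *\<^sub>R L (fst z)) (L u) (L v)))
     - exp (2 * snd z) * (u \<bullet> v)"

text \<open>The differential of the chart respects the product structure, so the
  \<open>\<alpha> * \<beta>\<close> terms of the two metrics cancel. The factor
  \<open>\<eta>\<^sup>2\<close> is pulled out by bilinearity.\<close>

lemma pullback_minus_model:
  fixes \<psi> :: "real^'n \<Rightarrow> (real^'n) \<times> real"
  assumes \<psi>: "\<psi> differentiable (at (p + \<eta> *\<^sub>R L x))" and L: "bounded_linear L"
    and ip: "inner_product_on UNIV (pullback \<psi> g (p + \<eta> *\<^sub>R L x))"
      "inner_product_on UNIV (pullback \<psi> round_metric (p + \<eta> *\<^sub>R L x))"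
  shows "pullback (\<lambda>(x, t). (\<psi> (p + \<eta> *\<^sub>R L x), t + s)) (radial_metric (warp_family \<rho> a d g)) (x, t) (u, \<alpha>) (v, \<beta>)
      - model_metric (x, t) (u, \<alpha>) (v, \<beta>) = warp_defect \<rho> a d g \<psi> p \<eta> L s u v (x, t)"
proof -
  let ?y = "p + \<eta> *\<^sub>R L x"
  have M: "bounded_linear (\<lambda>z::(real^'n) \<times> real. \<eta> *\<^sub>R L (fst z))"
    by (intro bounded_linear_const_scaleR bounded_linear_compose[OF L] bounded_linear_fst)
  have "((\<lambda>z::(real^'n) \<times> real. (\<psi> (p + \<eta> *\<^sub>R L (fst z)), snd z + s)) has_derivative
      (\<lambda>w. (dir_deriv (\<eta> *\<^sub>R L (fst w)) \<psi> ?y, snd w))) (at (x, t))"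
    using has_derivative_affine_comp[OF M, of \<psi> p "(x, t)"] \<psi>
    by (intro has_derivative_Pair) (auto intro!: derivative_eq_intros)
  then have D: "dir_deriv w (\<lambda>(x, t). (\<psi> (p + \<eta> *\<^sub>R L x), t + s)) (x, t)
      = (dir_deriv (\<eta> *\<^sub>R L (fst w)) \<psi> ?y, snd w)" for w
    by (intro dir_deriv_eq) (simp add: case_prod_unfold)
  have scale: "pullback \<psi> h ?y (\<eta> *\<^sub>R L u) (\<eta> *\<^sub>R L v) = \<eta>\<^sup>2 * pullback \<psi> h ?y (L u) (L v)"
    if "inner_product_on UNIV (pullback \<psi> h ?y)" for h
  proof -
    have sym: "pullback \<psi> h ?y a b = pullback \<psi> h ?y b a"
      and sc: "pullback \<psi> h ?y (\<eta> *\<^sub>R a) b = \<eta> * pullback \<psi> h ?y a b" for a b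
      using that unfolding inner_product_on_def by auto
    show ?thesis unfolding sc sym[of "L u" "\<eta> *\<^sub>R L v"] sym[of "L v"] by (simp add: power2_eq_square)
  qed
  show ?thesis
    unfolding pullback_def[of "\<lambda>(x, t). (\<psi> (p + \<eta> *\<^sub>R L x), t + s)"] D warp_defect_def
    using scale[OF ip(1)] scale[OF ip(2)]
    by (simp add: radial_metric_def model_metric_def warp_family_def g_ad_def pullback_def algebra_simps)
qed

text \<open>With \<open>m t = 4 * exp (- 2 * s) * (sinh (t + s))\<^sup>2\<close> the defect equals
  \<open>m * (k + (r - r 0) * (\<gamma> - \<sigma>)) + (u \<bullet> v) * (m - exp (2 * t))\<close>.
  The term \<open>k\<close>, the spatial variation of the metric at level \<open>s\<close>, is of
  order \<open>exp (- s)\<close>; the variation \<open>r - r 0\<close> of the cutoff is of order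
  \<open>1 / d\<close>; and \<open>m - exp (2 * t)\<close> is of order
  \<open>exp (- s)\<close>.\<close>

lemma warp_defect_bound_normalized:
  fixes g :: "((real^'n) \<times> real) tensor"
  assumes \<rho>: "cutoff \<rho>" and d: "d \<ge> 1" and s: "s \<ge> 1"
    and g: "chart_controlled K U \<psi> g" "chart_controlled K U \<psi> round_metric" and K: "K \<ge> 0"
    and L: "bounded_linear L" "\<And>x. norm (L x) \<le> l * norm x" and l: "l \<ge> 0"
    and \<eta>: "\<eta> = 2 * exp (- s)" "\<eta> * l \<le> 1" and U: "ball p 1 \<subseteq> U" and uv: "norm u \<le> 1" "norm v \<le> 1"
    and norm: "pullback \<psi> (g_ad \<rho> a d g s) p (L u) (L v) = u \<bullet> v"
  defines "C \<equiv> (168 * (2 * l * (K * l\<^sup>2) + 384 * (K * l\<^sup>2)) + 6) * (exp (- s) + 1 / d)"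
  shows "C2_bounded cylinder C C C (warp_defect \<rho> a d g \<psi> p \<eta> L s u v)"
proof -
  define N where "N = K * l\<^sup>2"
  define \<sigma> \<gamma> r where f: "\<sigma> = (\<lambda>x. pullback \<psi> round_metric (p + \<eta> *\<^sub>R L x) (L u) (L v))"
    "\<gamma> = (\<lambda>x. pullback \<psi> g (p + \<eta> *\<^sub>R L x) (L u) (L v))" "r = (\<lambda>t. rho_ad \<rho> a d (t + s))"
  define e where "e = \<eta> * l * N"
  have N: "N \<ge> 0" using K by (simp add: N_def)
  have \<eta>0: "\<eta> \<ge> 0" by (simp add: \<eta>(1))
  have e0: "e \<ge> 0" "e \<le> N" using \<eta>0 l N mult_right_mono[OF \<eta>(2) N] by (simp_all add: e_def)
  have b: "C2_bounded (ball 0 1) N e e \<sigma>" "C2_bounded (ball 0 1) N e e \<gamma>"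
    unfolding f N_def e_def by (rule pullback_scaled_C2_bounded[OF _ K L l \<eta>0 \<eta>(2) U uv], rule g)+
  have r0: "0 \<le> r 0" "r 0 \<le> 1" using \<rho> by (simp_all add: f(3) rho_ad_def cutoff_def)
  define k where "k = (\<lambda>x. ((1 - r 0) * \<sigma> x + r 0 * \<gamma> x) - u \<bullet> v)"
  have "C2_bounded (ball 0 1) (\<bar>1 - r 0\<bar> * N + \<bar>r 0\<bar> * N + \<bar>u \<bullet> v\<bar>) (\<bar>1 - r 0\<bar> * e + \<bar>r 0\<bar> * e + 0)
      (\<bar>1 - r 0\<bar> * e + \<bar>r 0\<bar> * e + 0) k"
    unfolding k_def by (intro C2_bounded_diff C2_bounded_add C2_bounded_cmult b C2_bounded_const) simp
  moreover have "\<bar>1 - r 0\<bar> * e + \<bar>r 0\<bar> * e + 0 = e" using r0 by (simp add: algebra_simps)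
  ultimately have k1: "C2_bounded (ball 0 1) (\<bar>1 - r 0\<bar> * N + \<bar>r 0\<bar> * N + \<bar>u \<bullet> v\<bar>) e e k" by simp
  have "k 0 = 0" using norm linear_0[OF bounded_linear.linear[OF L(1)]]
    by (simp add: k_def f pullback_def g_ad_def algebra_simps)
  \<comment> \<open>The normalization makes \<open>k\<close> vanish at the centre, so its supremum
    is bounded by \<open>e\<close>, like its derivatives.\<close>
  from C2_bounded_vanishing[OF k1 _ _ this, of 1] e0
  have k: "C2_bounded (ball 0 1) e e e k" by simp
  have rb: "C2_bounded {-1<..<1} 1 (6 / d) (48 / d\<^sup>2) r"
    unfolding f(3) using rho_ad_C2_bounded[OF \<rho>] d by simp
  have "C2_bounded {-1<..<1} (1 + \<bar>r 0\<bar>) (6 / d + 0) (48 / d\<^sup>2 + 0) (\<lambda>t. r t - r 0)"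
    by (intro C2_bounded_diff rb C2_bounded_const) simp
  from C2_bounded_vanishing[OF this, of 0 1] d
  have "C2_bounded {-1<..<1} (6 / d) (6 / d) (48 / d\<^sup>2) (\<lambda>t. r t - r 0)"
    by (auto simp: abs_le_iff)
  \<comment> \<open>This is where \<open>d \<ge> 1\<close> turns the quadratic bound for the second
    derivative of the cutoff into a linear one.\<close>
  moreover have "48 / d\<^sup>2 \<le> 48 / d" using d by (intro divide_left_mono) (auto simp: power2_eq_square)
  moreover have "6 / d \<le> 48 / d" using d by (intro divide_right_mono) auto
  ultimately have r: "C2_bounded {-1<..<1} (48 / d) (48 / d) (48 / d) (\<lambda>t. r t - r 0)"
    by (elim C2_bounded_mono)
  have dd: "C2_bounded (ball 0 1) (2 * N) (2 * N) (2 * N) (\<lambda>x. \<gamma> x - \<sigma> x)"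
    by (rule C2_bounded_mono[OF C2_bounded_diff[OF b(2,1)]]) (use e0 in auto)
  have open_J: "open {-1<..<1::real}" and open_B: "open (ball (0::real^'n) 1)" by simp_all
  \<comment> \<open>The product of these numbers is the \<open>384 * N / d\<close> below.\<close>
  have "C2_bounded cylinder (4 * (48 / d) * (2 * N)) (4 * (48 / d) * (2 * N)) (4 * (48 / d) * (2 * N))
      (\<lambda>z. (r (snd z) - r 0) * (\<gamma> (fst z) - \<sigma> (fst z)))"
    unfolding cylinder_def using d N
    by (intro C2_bounded_mult' C2_bounded_snd[OF r open_B] C2_bounded_fst[OF dd open_J]) auto
  moreover have "C2_bounded cylinder e e e (\<lambda>z. k (fst z))"
    unfolding cylinder_def by (rule C2_bounded_fst[OF k open_J e0(1) e0(1)])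
  ultimately have H: "C2_bounded cylinder (e + 384 * N / d) (e + 384 * N / d) (e + 384 * N / d)
      (\<lambda>z. k (fst z) + (r (snd z) - r 0) * (\<gamma> (fst z) - \<sigma> (fst z)))" (is "C2_bounded _ ?H _ _ ?h")
    using C2_bounded_add[of cylinder e e e "\<lambda>z. k (fst z)"] by simp
  define m where "m = (\<lambda>t. 4 * exp (- 2 * s) * (sinh (t + s))\<^sup>2)"
  have "C2_bounded cylinder 42 42 42 (\<lambda>z::(real^'n) \<times> real. m (snd z))"
    unfolding cylinder_def m_def by (rule C2_bounded_snd[OF sinh_factor_C2_bounded(2)[OF s] open_B]) auto
  from C2_bounded_mult'[OF this H]
  have mH: "C2_bounded cylinder (168 * ?H) (168 * ?H) (168 * ?H) (\<lambda>z. m (snd z) * ?h z)"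
    using e0 N d by simp
  have "C2_bounded cylinder (6 * exp (-s)) (6 * exp (-s)) (6 * exp (-s)) (\<lambda>z::(real^'n) \<times> real. m (snd z) - exp (2 * snd z))"
    unfolding cylinder_def m_def by (rule C2_bounded_snd[OF sinh_factor_C2_bounded(1)[OF s] open_B]) auto
  from C2_bounded_cmult[OF this, of "u \<bullet> v"]
  have "C2_bounded cylinder (\<bar>u \<bullet> v\<bar> * (6 * exp (-s))) (\<bar>u \<bullet> v\<bar> * (6 * exp (-s))) (\<bar>u \<bullet> v\<bar> * (6 * exp (-s)))
     (\<lambda>z::(real^'n) \<times> real. (u \<bullet> v) * (m (snd z) - exp (2 * snd z)))" .
  moreover have "\<bar>u \<bullet> v\<bar> \<le> 1"
    using Cauchy_Schwarz_ineq2[of u v] mult_mono[OF uv] by simp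
  then have "\<bar>u \<bullet> v\<bar> * (6 * exp (-s)) \<le> 6 * exp (-s)" by simp
  ultimately have mE: "C2_bounded cylinder (6 * exp (-s)) (6 * exp (-s)) (6 * exp (-s))
     (\<lambda>z::(real^'n) \<times> real. (u \<bullet> v) * (m (snd z) - exp (2 * snd z)))"
    by (elim C2_bounded_mono)
  let ?T = "168 * ?H + 6 * exp (-s)"
  have "C2_bounded cylinder ?T ?T ?T (\<lambda>z. m (snd z) * ?h z + (u \<bullet> v) * (m (snd z) - exp (2 * snd z)))"
    by (rule C2_bounded_add[OF mH mE])
  then have "C2_bounded cylinder ?T ?T ?T (warp_defect \<rho> a d g \<psi> p \<eta> L s u v)"
  proof (rule C2_bounded_cong)
    fix z :: "(real^'n) \<times> real"
    have "\<eta>\<^sup>2 = 4 * exp (- 2 * s)" by (simp add: \<eta>(1) power_mult_distrib flip: exp_of_nat_mult)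
    then have "warp_defect \<rho> a d g \<psi> p \<eta> L s u v z
        = m (snd z) * (\<sigma> (fst z) + r (snd z) * (\<gamma> (fst z) - \<sigma> (fst z))) - exp (2 * snd z) * (u \<bullet> v)"
      by (simp add: warp_defect_def f m_def)
    then show "m (snd z) * ?h z + (u \<bullet> v) * (m (snd z) - exp (2 * snd z)) = warp_defect \<rho> a d g \<psi> p \<eta> L s u v z"
      by (simp add: k_def algebra_simps)
  qed
  moreover have "?T \<le> C"
  proof -
    \<comment> \<open>These are the cross terms that appear when the product in \<open>C\<close> is
      multiplied out; the remaining terms of \<open>C\<close> are exactly \<open>?T\<close>.\<close>
    have "0 \<le> (168 * (2 * l * N)) * (1 / d)" "0 \<le> (168 * (384 * N)) * exp (-s)" "0 \<le> 6 * (1 / d)"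
      using N l d by (auto intro!: mult_nonneg_nonneg)
    then show ?thesis unfolding C_def N_def[symmetric] e_def \<eta>(1) by (simp add: algebra_simps)
  qed
  ultimately show ?thesis by (elim C2_bounded_mono)
qed

text \<open>When \<open>\<epsilon>\<close> is large, a chart of tiny image makes the pulled-back metric negligible, and the defect
  is essentially minus the model metric, whose norm is a fixed constant.\<close>

lemma warp_defect_bound_tiny:
  fixes g :: "((real^'n) \<times> real) tensor"
  assumes \<rho>: "cutoff \<rho>" and d: "d > 0" and s: "s \<ge> 1"
    and g: "chart_controlled K U \<psi> g" "chart_controlled K U \<psi> round_metric" and K: "K \<ge> 0"
    and U: "ball p 1 \<subseteq> U"
  shows "\<exists>\<eta>>0. \<eta> \<le> 1 \<and> (\<forall>u v. norm u \<le> 1 \<longrightarrow> norm v \<le> 1 \<longrightarrow>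
    C2_bounded cylinder 37 37 37 (warp_defect \<rho> a d g \<psi> p \<eta> (\<lambda>x. x) s u v))"
proof -
  define R where "R = 1 + 6 / d + 48 / d\<^sup>2"
  define Q where "Q = K + 8 * R * K"
  \<comment> \<open>Undoes the normalization of the sinh factor, so that its uniform bound
    \<open>42\<close> can be used; \<open>168\<close> below is \<open>4 * 42\<close>.\<close>
  define c where "c = exp (2 * s) / 4"
  have R: "R \<ge> 0" "1 \<le> R" "6 / d \<le> R" "48 / d\<^sup>2 \<le> R" using d by (auto simp: R_def)
  have Q: "Q \<ge> 0" using R K by (simp add: Q_def)
  define P where "P = c * (168 * Q)"
  have P: "P \<ge> 0" using Q by (simp add: P_def c_def)
  \<comment> \<open>Chosen so that the metric contribution \<open>\<eta>\<^sup>2 * P\<close> is at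
    most \<open>1\<close>; with \<open>36\<close> for the model metric this gives \<open>37\<close>.
    The scale may depend on \<open>s\<close> and \<open>d\<close>, since only the existence of a
    chart is required.\<close>
  define \<eta> where "\<eta> = 1 / (1 + P)"
  have \<eta>: "0 < \<eta>" "\<eta> \<le> 1" using P by (auto simp: \<eta>_def)
  have "\<eta>\<^sup>2 \<le> \<eta>" using \<eta> by (simp add: power2_eq_square mult_left_le)
  then have \<eta>P: "\<eta>\<^sup>2 * P \<le> 1" using mult_right_mono[of "\<eta>\<^sup>2" \<eta> P] P by (simp add: \<eta>_def divide_simps split: if_splits)
  have "C2_bounded cylinder 37 37 37 (warp_defect \<rho> a d g \<psi> p \<eta> (\<lambda>x. x) s u v)"
    if uv: "norm u \<le> 1" "norm v \<le> 1" for u v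
  proof -
    define \<sigma> \<gamma> r where f: "\<sigma> = (\<lambda>x. pullback \<psi> round_metric (p + \<eta> *\<^sub>R x) u v)"
      "\<gamma> = (\<lambda>x. pullback \<psi> g (p + \<eta> *\<^sub>R x) u v)" "r = (\<lambda>t. rho_ad \<rho> a d (t + s))"
    have open_J: "open {-1<..<1::real}" and open_B: "open (ball (0::real^'n) 1)" by simp_all
    have eK: "\<eta> * K \<le> K" using mult_right_mono[OF \<eta>(2) K] by simp
    have "C2_bounded (ball 0 1) K (\<eta> * K) (\<eta> * K) \<sigma>" "C2_bounded (ball 0 1) K (\<eta> * K) (\<eta> * K) \<gamma>"
      unfolding f using pullback_scaled_C2_bounded[OF g(2) K bounded_linear_ident, of 1 \<eta> p u v]
        pullback_scaled_C2_bounded[OF g(1) K bounded_linear_ident, of 1 \<eta> p u v] \<eta> U uv by simp_all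
    then have b: "C2_bounded (ball 0 1) K K K \<sigma>" "C2_bounded (ball 0 1) K K K \<gamma>"
      using eK by (elim C2_bounded_mono; simp)+
    have dd: "C2_bounded (ball 0 1) (2 * K) (2 * K) (2 * K) (\<lambda>x. \<gamma> x - \<sigma> x)"
      using C2_bounded_diff[OF b(2,1)] by simp
    have "C2_bounded {-1<..<1} R R R r"
      unfolding f(3) by (rule C2_bounded_mono[OF rho_ad_C2_bounded[OF \<rho> d] R(2-)])
    then have "C2_bounded cylinder R R R (\<lambda>z::(real^'n) \<times> real. r (snd z))"
      unfolding cylinder_def using C2_bounded_snd open_B R(1) by blast
    moreover have "C2_bounded cylinder (2 * K) (2 * K) (2 * K) (\<lambda>z. \<gamma> (fst z) - \<sigma> (fst z))"
      unfolding cylinder_def using K by (intro C2_bounded_fst[OF dd open_J]) auto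
    ultimately have "C2_bounded cylinder (8 * R * K) (8 * R * K) (8 * R * K) (\<lambda>z. r (snd z) * (\<gamma> (fst z) - \<sigma> (fst z)))"
      using C2_bounded_mult'[of cylinder R _ "2 * K"] R(1) K by (simp add: mult_ac)
    moreover have "C2_bounded cylinder K K K (\<lambda>z. \<sigma> (fst z))"
      unfolding cylinder_def by (rule C2_bounded_fst[OF b(1) open_J K K])
    ultimately have H: "C2_bounded cylinder Q Q Q (\<lambda>z. \<sigma> (fst z) + r (snd z) * (\<gamma> (fst z) - \<sigma> (fst z)))"
      (is "C2_bounded _ _ _ _ ?h") unfolding Q_def by (intro C2_bounded_add)
    define m where "m = (\<lambda>t. 4 * exp (- 2 * s) * (sinh (t + s))\<^sup>2)"
    have "C2_bounded cylinder 42 42 42 (\<lambda>z::(real^'n) \<times> real. m (snd z))"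
      unfolding cylinder_def m_def by (rule C2_bounded_snd[OF sinh_factor_C2_bounded(2)[OF s] open_B]) auto
    from C2_bounded_cmult[OF C2_bounded_mult'[OF this H], of "\<eta>\<^sup>2 * c"] Q
    have "C2_bounded cylinder (\<eta>\<^sup>2 * P) (\<eta>\<^sup>2 * P) (\<eta>\<^sup>2 * P) (\<lambda>z. \<eta>\<^sup>2 * c * (m (snd z) * ?h z))"
      by (simp add: P_def c_def abs_mult mult_ac)
    then have 1: "C2_bounded cylinder 1 1 1 (\<lambda>z. \<eta>\<^sup>2 * c * (m (snd z) * ?h z))"
      using \<eta>P by (elim C2_bounded_mono)
    have "C2_bounded cylinder 36 36 36 (\<lambda>z::(real^'n) \<times> real. exp (2 * snd z))"
      unfolding cylinder_def by (rule C2_bounded_snd[OF exp_double_C2_bounded open_B]) auto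
    from C2_bounded_cmult[OF this, of "u \<bullet> v"]
    have 2: "C2_bounded cylinder (\<bar>u \<bullet> v\<bar> * 36) (\<bar>u \<bullet> v\<bar> * 36) (\<bar>u \<bullet> v\<bar> * 36) (\<lambda>z::(real^'n) \<times> real. (u \<bullet> v) * exp (2 * snd z))" .
    have "\<bar>u \<bullet> v\<bar> \<le> 1" using Cauchy_Schwarz_ineq2[of u v] mult_mono[OF uv] by simp
    then have "C2_bounded cylinder 37 37 37 (\<lambda>z. \<eta>\<^sup>2 * c * (m (snd z) * ?h z) - (u \<bullet> v) * exp (2 * snd z))"
      by (intro C2_bounded_mono[OF C2_bounded_diff[OF 1 2]]) linarith+
    then show ?thesis
    proof (rule C2_bounded_cong)
      fix z :: "(real^'n) \<times> real"
      have "c * m (snd z) = (sinh (snd z + s))\<^sup>2"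
        by (simp add: c_def m_def flip: exp_add)
      then have "\<eta>\<^sup>2 * c * (m (snd z) * ?h z) = \<eta>\<^sup>2 * (sinh (snd z + s))\<^sup>2 * ?h z" by algebra
      then show "\<eta>\<^sup>2 * c * (m (snd z) * ?h z) - (u \<bullet> v) * exp (2 * snd z) = warp_defect \<rho> a d g \<psi> p \<eta> (\<lambda>x. x) s u v z"
        by (simp add: warp_defect_def f mult.commute)
    qed
  qed
  then show ?thesis using \<eta> by blast
qed

text \<open>The common last step for both sizes of \<open>\<epsilon>\<close>: a bound on the
  tangential defects becomes a bound on the norm, provided that the chart exists. The condition
  \<open>s > 1\<close> keeps \<open>t + s\<close> positive on the cylinder.\<close>

lemma radially_close_chart:
  fixes g :: "((real^'n) \<times> real) tensor" and \<psi> :: "real^'n \<Rightarrow> (real^'n) \<times> real"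
  assumes ch: "chart_of (sphere 0 1) U \<psi>" and U: "ball p 1 \<subseteq> U" and s: "s > 1"
    and g: "\<And>y. y \<in> U \<Longrightarrow> inner_product_on UNIV (pullback \<psi> g y)"
      "\<And>y. y \<in> U \<Longrightarrow> inner_product_on UNIV (pullback \<psi> round_metric y)"
    and L: "bounded_linear L" "bounded_linear L'" "\<And>y. L (L' y) = y" "\<And>x. L' (L x) = x"
      "\<And>x. norm (L x) \<le> l * norm x"
    and \<eta>: "\<eta> > 0" "\<eta> * l \<le> 1" and T: "T < \<epsilon>" "\<epsilon> > 0"
    and b: "\<And>u v. norm u \<le> 1 \<Longrightarrow> norm v \<le> 1 \<Longrightarrow>
      C2_bounded cylinder T T T (warp_defect \<rho> a d g \<psi> p \<eta> L s u v)"
  shows "\<exists>(\<phi> :: (real^'n) \<times> real \<Rightarrow> ((real^'n) \<times> real) \<times> real) \<phi>\<^sub>1 t\<^sub>0.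
        chart_of (sphere 0 1 \<times> {0<..}) cylinder \<phi> \<and> \<phi> (0, 0) = (\<psi> p, s) \<and>
        chart_of (sphere 0 1) (ball 0 1) \<phi>\<^sub>1 \<and>
        (\<forall>(x, t)\<in>cylinder. \<phi> (x, t) = (\<phi>\<^sub>1 x, t + t\<^sub>0)) \<and>
        C2_norm cylinder
          (\<lambda>z u v. pullback \<phi> (radial_metric (warp_family \<rho> a d g)) z u v - model_metric z u v) < ennreal \<epsilon>"
proof -
  define \<phi>1 where "\<phi>1 = (\<lambda>x. \<psi> (p + \<eta> *\<^sub>R L x))"
  define \<phi> where "\<phi> = (\<lambda>(x, t). (\<phi>1 x, t + s))"
  have inU: "p + \<eta> *\<^sub>R L x \<in> U" if "x \<in> ball 0 1" for x
  proof -
    have "norm (\<eta> *\<^sub>R L x) \<le> \<eta> * l * norm x"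
      using mult_left_mono[OF L(5)[of x], of \<eta>] \<eta>(1) by (simp add: mult.assoc)
    also have "\<dots> < 1" using mult_right_mono[OF \<eta>(2), of "norm x"] that by simp
    finally show ?thesis using U by (auto simp: dist_norm)
  qed
  have c1: "chart_of (sphere 0 1) (ball 0 1) \<phi>1" unfolding \<phi>1_def
  proof (rule chart_of_affine[OF ch open_ball inU])
    show "bounded_linear (\<lambda>x. \<eta> *\<^sub>R L x)" "bounded_linear (\<lambda>y. L' ((1 / \<eta>) *\<^sub>R y))"
      using L(1,2) by (auto intro: bounded_linear_const_scaleR bounded_linear_compose[OF L(2)] bounded_linear_scaleR_right)
  qed (use L \<eta>(1) linear_scale[OF bounded_linear.linear[OF L(1)]] in auto)
  have c2: "chart_of (sphere 0 1 \<times> {0<..}) cylinder \<phi>"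
    unfolding \<phi>_def cylinder_def by (rule chart_of_times_translation[OF c1]) (use s in auto)
  have "C2_bounded cylinder T T T
      (\<lambda>z. pullback \<phi> (radial_metric (warp_family \<rho> a d g)) z i j - model_metric z i j)"
    if ij: "i \<in> Basis" "j \<in> Basis" for i j :: "(real^'n) \<times> real"
  proof (rule C2_bounded_cong[OF b])
    \<comment> \<open>A basis vector of the product has a tangential part of norm at most
      \<open>1\<close>, possibly \<open>0\<close>; this is why \<open>b\<close> is stated for the
      unit ball of vectors.\<close>
    show "norm (fst i) \<le> 1" "norm (fst j) \<le> 1"
      using norm_fst_le[of "fst i" "snd i"] norm_fst_le[of "fst j" "snd j"] ij by simp_all
    fix z :: "(real^'n) \<times> real" assume "z \<in> cylinder"
    then have y: "p + \<eta> *\<^sub>R L (fst z) \<in> U" using inU by (auto simp: cylinder_def)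
    have "pullback \<phi> (radial_metric (warp_family \<rho> a d g)) (fst z, snd z) (fst i, snd i) (fst j, snd j)
        - model_metric (fst z, snd z) (fst i, snd i) (fst j, snd j)
      = warp_defect \<rho> a d g \<psi> p \<eta> L s (fst i) (fst j) (fst z, snd z)"
      unfolding \<phi>_def \<phi>1_def
      by (rule pullback_minus_model[OF chart_of_differentiable[OF ch y] L(1) g(1)[OF y] g(2)[OF y]])
    then show "warp_defect \<rho> a d g \<psi> p \<eta> L s (fst i) (fst j) z
      = pullback \<phi> (radial_metric (warp_family \<rho> a d g)) z i j - model_metric z i j" by simp
  qed
  then have "C2_norm cylinder
      (\<lambda>z u v. pullback \<phi> (radial_metric (warp_family \<rho> a d g)) z u v - model_metric z u v) \<le> ennreal T"
    unfolding C2_norm_def by (intro SUP_least C2_norm_fun_le)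
  also have "ennreal T < ennreal \<epsilon>" using T by (simp add: ennreal_lessI)
  finally show ?thesis
    using c1 c2 linear_0[OF bounded_linear.linear[OF L(1)]]
    by (intro exI[of _ \<phi>] exI[of _ \<phi>1] exI[of _ s]) (auto simp: \<phi>_def \<phi>1_def)
qed

text \<open>At each level the interpolated metric is a convex combination of
  \<open>round_metric\<close> and \<open>g\<close>, so it inherits their common lower bound with the
  same \<open>K\<close>. This bounds the frame that is orthonormal at level
  \<open>s\<close>.\<close>

lemma g_ad_controlled:
  assumes \<rho>: "cutoff \<rho>" and g: "chart_controlled K U \<psi> g" "chart_controlled K U \<psi> round_metric" and y: "y \<in> U"
  shows "inner_product_on UNIV (pullback \<psi> (g_ad \<rho> a d g t) y)"
    and "(norm u)\<^sup>2 \<le> K * pullback \<psi> (g_ad \<rho> a d g t) y u u"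
proof -
  define r where "r = rho_ad \<rho> a d t"
  have r: "0 \<le> r" "r \<le> 1" using \<rho> by (simp_all add: r_def rho_ad_def cutoff_def)
  have eq: "pullback \<psi> (g_ad \<rho> a d g t) y u v
      = (1 - r) * pullback \<psi> round_metric y u v + r * pullback \<psi> g y u v" for u v
    by (simp add: pullback_def g_ad_def r_def algebra_simps)
  have ip: "inner_product_on UNIV (pullback \<psi> round_metric y)" "inner_product_on UNIV (pullback \<psi> g y)"
    and lo: "(norm u)\<^sup>2 \<le> K * pullback \<psi> round_metric y u u" "(norm u)\<^sup>2 \<le> K * pullback \<psi> g y u u" for u
    using g y by (auto simp: chart_controlled_def)
  have "pullback \<psi> (g_ad \<rho> a d g t) y u u > 0" if "u \<noteq> 0" for u
  proof (cases "r = 0")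
    case True
    then show ?thesis using ip(1) that by (simp add: eq inner_product_on_def)
  next
    case False
    then have "0 < r * pullback \<psi> g y u u" using r ip(2) that by (simp add: inner_product_on_def)
    moreover have "0 \<le> (1 - r) * pullback \<psi> round_metric y u u"
      using r ip(1) that by (simp add: inner_product_on_def less_imp_le)
    ultimately show ?thesis by (simp add: eq)
  qed
  note pos = this
  show "inner_product_on UNIV (pullback \<psi> (g_ad \<rho> a d g t) y)"
  proof -
    note S = ip(1)[unfolded inner_product_on_def] and G = ip(2)[unfolded inner_product_on_def]
    have sym: "pullback \<psi> round_metric y u v = pullback \<psi> round_metric y v u"
      "pullback \<psi> g y u v = pullback \<psi> g y v u" for u v using S G by blast+
    have add: "pullback \<psi> round_metric y (u + v) w = pullback \<psi> round_metric y u w + pullback \<psi> round_metric y v w"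
      "pullback \<psi> g y (u + v) w = pullback \<psi> g y u w + pullback \<psi> g y v w" for u v w using S G by blast+
    have sc: "pullback \<psi> round_metric y (k *\<^sub>R u) w = k * pullback \<psi> round_metric y u w"
      "pullback \<psi> g y (k *\<^sub>R u) w = k * pullback \<psi> g y u w" for k u w using S G by blast+
    show ?thesis
      unfolding inner_product_on_def
    proof (intro conjI ballI impI allI)
      show "pullback \<psi> (g_ad \<rho> a d g t) y u v = pullback \<psi> (g_ad \<rho> a d g t) y v u" for u v
        by (simp only: eq sym)
      show "pullback \<psi> (g_ad \<rho> a d g t) y (u + v) w
        = pullback \<psi> (g_ad \<rho> a d g t) y u w + pullback \<psi> (g_ad \<rho> a d g t) y v w" for u v w
        unfolding eq add by (simp add: algebra_simps)
      show "pullback \<psi> (g_ad \<rho> a d g t) y (k *\<^sub>R u) w = k * pullback \<psi> (g_ad \<rho> a d g t) y u w" for k u w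
        unfolding eq sc by (simp add: algebra_simps)
    qed (rule pos)
  qed
  have "(norm u)\<^sup>2 = (1 - r) * (norm u)\<^sup>2 + r * (norm u)\<^sup>2" by (simp add: algebra_simps)
  also have "\<dots> \<le> (1 - r) * (K * pullback \<psi> round_metric y u u) + r * (K * pullback \<psi> g y u u)"
    using r lo by (intro add_mono mult_left_mono) auto
  finally show "(norm u)\<^sup>2 \<le> K * pullback \<psi> (g_ad \<rho> a d g t) y u u" by (simp add: eq algebra_simps)
qed

theorem theorem1:
  fixes \<rho> :: "real \<Rightarrow> real"
    and \<A> :: "((real^'n) set \<times> (real^'n \<Rightarrow> (real^'n) \<times> real)) set"
    and c :: real
  assumes "cutoff \<rho>"
    and "good_atlas \<A>"
    and "c > 1"
  shows "\<exists>C2 :: real. \<forall>(g :: ((real^'n) \<times> real) tensor) a d b \<epsilon>.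
    sphere_metric g \<longrightarrow> c_bounded \<A> c g \<longrightarrow> a > 0 \<longrightarrow> d > 0 \<longrightarrow> b > 1 \<longrightarrow> \<epsilon> > 0 \<longrightarrow>
      hyperbolic_on (ball 0 a) (two_variable_warp \<rho> a d g) \<and>
      (C2 * (exp (- b) + 1 / d) \<le> \<epsilon> \<longrightarrow>
        radially_close_to_hyperbolic \<epsilon> (warp_family \<rho> a d g) (outside_ball b))"
proof -
  obtain K where K: "K \<ge> 1" "\<And>U \<psi>. (U, \<psi>) \<in> \<A> \<Longrightarrow> chart_controlled K U \<psi> round_metric"
    "\<And>U \<psi> g. (U, \<psi>) \<in> \<A> \<Longrightarrow> sphere_metric g \<Longrightarrow> c_bounded \<A> c g \<Longrightarrow> chart_controlled K U \<psi> g"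
    using atlas_controlled[OF assms(2,3)] by blast
  \<comment> \<open>The norm bound of an orthonormal frame for a metric bounded below by
    \<open>1 / K\<close>.\<close>
  define l where "l = sqrt K"
  define C0 where "C0 = 168 * (2 * l * (K * l\<^sup>2) + 384 * (K * l\<^sup>2)) + 6"
  \<comment> \<open>\<open>C0\<close> is the constant of the normalized estimate. For
    \<open>\<epsilon> \<le> 100\<close> the summands \<open>200 * l\<close> and \<open>200\<close>
    force \<open>l * exp (- b) \<le> 1/2\<close> and \<open>d \<ge> 2\<close>, hence a chart inside
    the unit ball and a linear bound in \<open>1 / d\<close>.\<close>
  define C2 where "C2 = C0 + 200 * l + 200"
  have l: "l \<ge> 0" "l > 0" using K(1) by (auto simp: l_def)
  have C0: "C0 \<ge> 0" using K(1) l by (auto simp: C0_def)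
  have C2: "C2 > C0" "C2 \<ge> 200 * l" "C2 \<ge> 200" "C2 > 0" using C0 l by (auto simp: C2_def)
  have close: "radially_close_to_hyperbolic \<epsilon> (warp_family \<rho> a d g) (outside_ball b)"
    if g: "sphere_metric g" "c_bounded \<A> c g" and d: "d > 0" and b: "b > 1" and \<epsilon>: "\<epsilon> > 0"
      and C: "C2 * (exp (- b) + 1 / d) \<le> \<epsilon>"
    for g :: "((real^'n) \<times> real) tensor" and a d b \<epsilon>
    unfolding radially_close_to_hyperbolic_def
  proof
    fix q :: "((real^'n) \<times> real) \<times> real" assume "q \<in> outside_ball b"
    then obtain \<theta> s where q: "q = (\<theta>, s)" "\<theta> \<in> sphere 0 1" "s \<ge> b"
      by (auto simp: outside_ball_def)
    then obtain U \<psi> where A: "(U, \<psi>) \<in> \<A>" "\<theta> \<in> \<psi> ` U" "infdist (inv_into U \<psi> \<theta>) (- U) \<ge> 1"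
      using assms(2) unfolding good_atlas_def by blast
    define p where "p = inv_into U \<psi> \<theta>"
    have p: "p \<in> U" "\<psi> p = \<theta>" using A(2) by (simp_all add: p_def inv_into_into f_inv_into_f)
    \<comment> \<open>A point of the unit ball outside \<open>U\<close> would lie at distance less
      than \<open>1\<close> from \<open>p\<close>, against the choice of the atlas chart.\<close>
    have U: "ball p 1 \<subseteq> U"
    proof
      fix y assume y: "y \<in> ball p 1"
      show "y \<in> U"
      proof (rule ccontr)
        assume "y \<notin> U"
        then have "infdist p (- U) \<le> dist p y" by (intro infdist_le) simp
        then show False using A(3) y by (simp add: p_def)
      qed
    qed
    have ch: "chart_of (sphere 0 1) U \<psi>" using assms(2) A(1) unfolding good_atlas_def by blast
    note ctrl = K(3)[OF A(1) g] K(2)[OF A(1)]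
    have ip: "inner_product_on UNIV (pullback \<psi> g y)" "inner_product_on UNIV (pullback \<psi> round_metric y)"
      if "y \<in> U" for y using ctrl that by (simp_all add: chart_controlled_def)
    have s: "s > 1" "s \<ge> 1" using q(3) b by simp_all
    have K0: "K \<ge> 0" using K(1) by simp
    show "\<exists>(\<phi> :: (real^'n) \<times> real \<Rightarrow> ((real^'n) \<times> real) \<times> real) \<phi>\<^sub>1 t\<^sub>0.
        chart_of (sphere 0 1 \<times> {0<..}) cylinder \<phi> \<and> \<phi> (0, 0) = q \<and>
        chart_of (sphere 0 1) (ball 0 1) \<phi>\<^sub>1 \<and>
        (\<forall>(x, t)\<in>cylinder. \<phi> (x, t) = (\<phi>\<^sub>1 x, t + t\<^sub>0)) \<and>
        C2_norm cylinder
          (\<lambda>z u v. pullback \<phi> (radial_metric (warp_family \<rho> a d g)) z u v - model_metric z u v) < ennreal \<epsilon>"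
    \<comment> \<open>Above this threshold the fixed bound \<open>37\<close> of the tiny chart
      already lies below \<open>\<epsilon>\<close>.\<close>
    proof (cases "\<epsilon> \<le> 100")
      case True
      have "exp (- b) > 0" "1 / d > 0" using d by simp_all
      then have "C2 * exp (- b) \<le> 100" "C2 * (1 / d) \<le> 100"
        using C True C2(4) mult_pos_pos[OF C2(4), of "exp (- b)"] mult_pos_pos[OF C2(4), of "1 / d"]
        unfolding distrib_left by linarith+
      moreover have "200 * l * exp (- b) \<le> C2 * exp (- b)" "200 * (1 / d) \<le> C2 * (1 / d)"
        using d by (intro mult_right_mono[OF C2(2)] mult_right_mono[OF C2(3)]; simp)+
      ultimately have "200 * l * exp (- b) \<le> 100" "200 * (1 / d) \<le> 100" by linarith+
      moreover have es: "exp (- s) \<le> exp (- b)" using q(3) by simp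
      ultimately have d1: "d \<ge> 1" using d by (simp add: field_simps)
      have "l * exp (- s) \<le> l * exp (- b)" by (rule mult_left_mono[OF es l(1)])
      then have \<eta>l: "2 * exp (- s) * l \<le> 1"
        using \<open>200 * l * exp (- b) \<le> 100\<close> by (simp add: mult_ac)
      have low: "1 / K * (norm u)\<^sup>2 \<le> pullback \<psi> (g_ad \<rho> a d g s) p u u" for u
        using g_ad_controlled(2)[OF assms(1) ctrl p(1), of u a d s] K(1) by (simp add: field_simps)
      have K1: "1 / K > 0" using K(1) by simp
      obtain L L' :: "real^'n \<Rightarrow> real^'n" where L: "bounded_linear L" "bounded_linear L'" "\<forall>y. L (L' y) = y" "\<forall>x. L' (L x) = x"
        "\<forall>u v. pullback \<psi> (g_ad \<rho> a d g s) p (L u) (L v) = u \<bullet> v" "\<forall>x. norm (L x) \<le> (1 / sqrt (1 / K)) * norm x"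
        by (rule orthonormal_frame[OF g_ad_controlled(1)[OF assms(1) ctrl p(1)] K1 low])
      have Ll: "norm (L x) \<le> l * norm x" for x
        using L(6)[rule_format, of x] by (simp add: l_def real_sqrt_divide)
      show ?thesis unfolding q(1) p(2)[symmetric]
      proof (rule radially_close_chart[OF ch U s(1) ip L(1,2) L(3,4)[rule_format] Ll _ \<eta>l _ \<epsilon>])
        show "C2_bounded cylinder (C0 * (exp (- s) + 1 / d)) (C0 * (exp (- s) + 1 / d)) (C0 * (exp (- s) + 1 / d))
            (warp_defect \<rho> a d g \<psi> p (2 * exp (- s)) L s u v)" if "norm u \<le> 1" "norm v \<le> 1" for u v
          unfolding C0_def
          by (rule warp_defect_bound_normalized[OF assms(1) d1 s(2) ctrl K0 L(1) Ll l(1) refl \<eta>l U that L(5)[rule_format]])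
        have "C0 * (exp (- s) + 1 / d) \<le> C0 * (exp (- b) + 1 / d)"
          using es C0 by (intro mult_left_mono) auto
        \<comment> \<open>The strict gap between \<open>C0\<close> and \<open>C2\<close> yields the
          strict inequality in the definition of closeness.\<close>
        also have "\<dots> < C2 * (exp (- b) + 1 / d)"
          using C2(1) d by (intro mult_strict_right_mono add_pos_pos) auto
        finally show "C0 * (exp (- s) + 1 / d) < \<epsilon>" using C by simp
        show "0 < 2 * exp (- s)" by simp
      qed
    next
      case False
      obtain \<eta> where \<eta>: "\<eta> > 0" "\<eta> \<le> 1" "\<And>u v. norm u \<le> 1 \<Longrightarrow> norm v \<le> 1 \<Longrightarrow>
          C2_bounded cylinder 37 37 37 (warp_defect \<rho> a d g \<psi> p \<eta> (\<lambda>x. x) s u v)"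
        using warp_defect_bound_tiny[OF assms(1) d s(2) ctrl K0 U, of a] by blast
      show ?thesis unfolding q(1) p(2)[symmetric]
        by (rule radially_close_chart[OF ch U s(1) ip bounded_linear_ident bounded_linear_ident refl refl,
              of 1 \<eta> 37]) (use \<eta> False in auto)
    qed
  qed
  show ?thesis
    using hyperbolic_on_two_variable_warp[OF assms(1)] close by blast
qed

end
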